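(* Let $l\in\mathbb{N}^*$ and $m,s,t\in\mathbb{N}$ with $l\ge m\ge s$ and $l\ge t+m$. Let $\mathbf{G}$ be the set of all simple finite undirected graphs (not necessarily connected) with no vertex of degree $2$. Then for every $G\in\mathbf{G}$ the independence polynomial of the graph $E_{\mathcal{G}_4(l,m,t,s)}(G)$ is log-concave.
   Context: $\mathbb{N}=\{0,1,2,\dots\}$ and $\mathbb{N}^*=\{1,2,\dots\}$. $K_r$ is the complete graph on $r$ vertices ($K_0$ is the empty graph). The independence polynomial of a graph $G$ is $I(G;x)=\sum_{k=0}^{\alpha(G)} i_k(G)x^k$, where $i_k(G)$ is the number of independent sets of size $k$ in $G$ ($i_0(G)=1$) and $\alpha(G)$ is the maximum size of an independent set. It is log-concave if $i_{k-1}(G)\,i_{k+1}(G)\le i_k(G)^2$ for all $1\le k\le \alpha(G)-1$. The graph $\mathcal{F}(l,m,t,s)$ (for $l\ge m\ge s$, $l\ge t+m$): take a vertex $c$ (the center), a vertex $x_i$, and vertex-disjoint complete graphs $K_m$, $K_l$, $K_{m-s}$, $K_{l-t}$. Join $c$ to $x_i$ by an edge; join $c$ to $s$ vertices of $K_m$, to $t$ vertices of $K_l$, to all $m-s$ vertices of $K_{m-s}$, and to $l-t-m$ vertices of $K_{l-t}$; join $x_i$ to all $m$ vertices of $K_m$ and to $l-m$ vertices of $K_l$. There are no other edges. The vertices of the complete graphs to which $c$ and $x_i$ are joined may be chosen arbitrarily; the result holds for every such choice. The graph $\mathcal{G}_4(l,m,t,s)$: take two disjoint copies of $\mathcal{F}(l,m,t,s)$,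 with their vertices $x_i$ named $x_1$ and $x_2$ respectively, and add an edge joining $x_1$ and $x_2$. The two vertices $c$ (one in each copy) are called its endpoints. The operator $E_{\mathcal{G}_4(l,m,t,s)}$ sends a simple finite undirected graph $G$ to the graph obtained by replacing every edge $e=uv$ of $G$ by a new copy of $\mathcal{G}_4(l,m,t,s)$, whose two endpoints are identified with $u$ and $v$ (the edge $e$ itself being removed; different edges use otherwise disjoint copies; isolated vertices are unchanged). *)

theory Defs
  imports
    "Graph_Theory.Pair_Digraph"
    "HOL-Computational_Algebra.Polynomial"
begin

text \<open>
  A simple finite undirected graph is a \<open>pair_graph\<close>: a finite loop-free digraph without parallel
  arcs whose arc relation is symmetric. An undirected edge is the two-element set of the ends of
  a pair of opposite arcs, and the degree of a vertex is its out-degree.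
\<close>

definition edge_sets :: "'a pair_pre_digraph \<Rightarrow> 'a set set" where
  "edge_sets G = {{u, v} | u v. (u, v) \<in> parcs G}"

subsection \<open>Independence polynomial\<close>

definition independent_set :: "'a pair_pre_digraph \<Rightarrow> 'a set \<Rightarrow> bool" where
  "independent_set G A \<longleftrightarrow> A \<subseteq> pverts G \<and> (\<forall>u\<in>A. \<forall>v\<in>A. (u, v) \<notin> parcs G)"

definition independence_number :: "'a pair_pre_digraph \<Rightarrow> nat" where
  "independence_number G = Max {card A | A. independent_set G A}"

definition num_independent_sets :: "'a pair_pre_digraph \<Rightarrow> nat \<Rightarrow> nat" where
  "num_independent_sets G k = card {A. independent_set G A \<and> card A = k}"

definition independence_poly :: "'a pair_pre_digraph \<Rightarrow> int poly" where
  "independence_poly G =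
     (\<Sum>k = 0..independence_number G. monom (int (num_independent_sets G k)) k)"

definition independence_poly_log_concave :: "'a pair_pre_digraph \<Rightarrow> bool" where
  "independence_poly_log_concave G \<longleftrightarrow>
     (\<forall>k. 1 \<le> k \<and> k \<le> independence_number G - 1 \<longrightarrow>
        coeff (independence_poly G) (k - 1) * coeff (independence_poly G) (k + 1)
          \<le> (coeff (independence_poly G) k)\<^sup>2)"

subsection \<open>The graphs \<open>F(l,m,t,s)\<close> and \<open>G\<^sub>4(l,m,t,s)\<close>\<close>

definition complete_arcs :: "'a set \<Rightarrow> 'a rel" where
  "complete_arcs A = {(u, v). u \<in> A \<and> v \<in> A \<and> u \<noteq> v}"

definition join_arcs :: "'a set \<Rightarrow> 'a set \<Rightarrow> 'a rel" where
  "join_arcs A B = A \<times> B \<union> B \<times> A"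

text \<open>
  \<open>Center\<close> is \<open>c\<close>, \<open>XVertex\<close> is \<open>x\<^sub>i\<close>; the other constructors enumerate the vertices of the complete
  graphs \<open>K\<^sub>m\<close>, \<open>K\<^sub>l\<close>, \<open>K\<^bsub>m-s\<^esub>\<close> and \<open>K\<^bsub>l-t\<^esub>\<close>, in this order.
\<close>

datatype F_vertex = Center | XVertex | KM nat | KL nat | KMS nat | KLT nat

text \<open>
  The freely chosen sets of neighbours: \<open>c_KM\<close>, \<open>c_KL\<close>, \<open>c_KLT\<close> are those of \<open>c\<close> in \<open>K\<^sub>m\<close>, \<open>K\<^sub>l\<close>,
  \<open>K\<^bsub>l-t\<^esub>\<close>, and \<open>x_KL\<close> are those of \<open>x\<^sub>i\<close> in \<open>K\<^sub>l\<close>.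
\<close>

record F_choice =
  c_KM :: "nat set"
  c_KL :: "nat set"
  c_KLT :: "nat set"
  x_KL :: "nat set"

definition valid_F_choice :: "nat \<Rightarrow> nat \<Rightarrow> nat \<Rightarrow> nat \<Rightarrow> F_choice \<Rightarrow> bool" where
  "valid_F_choice l m t s a \<longleftrightarrow>
     c_KM a \<subseteq> {..<m} \<and> card (c_KM a) = s \<and>
     c_KL a \<subseteq> {..<l} \<and> card (c_KL a) = t \<and>
     c_KLT a \<subseteq> {..<l - t} \<and> card (c_KLT a) = l - t - m \<and>
     x_KL a \<subseteq> {..<l} \<and> card (x_KL a) = l - m"

definition F_graph :: "nat \<Rightarrow> nat \<Rightarrow> nat \<Rightarrow> nat \<Rightarrow> F_choice \<Rightarrow> F_vertex pair_pre_digraph" where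
  "F_graph l m t s a =
     \<lparr> pverts = {Center, XVertex} \<union> KM ` {..<m} \<union> KL ` {..<l} \<union> KMS ` {..<m - s} \<union> KLT ` {..<l - t},
       parcs =
         complete_arcs (KM ` {..<m}) \<union> complete_arcs (KL ` {..<l}) \<union>
         complete_arcs (KMS ` {..<m - s}) \<union> complete_arcs (KLT ` {..<l - t}) \<union>
         join_arcs {Center}
           ({XVertex} \<union> KM ` c_KM a \<union> KL ` c_KL a \<union> KMS ` {..<m - s} \<union> KLT ` c_KLT a) \<union>
         join_arcs {XVertex} (KM ` {..<m} \<union> KL ` x_KL a) \<rparr>"

definition G4_graph ::
  "nat \<Rightarrow> nat \<Rightarrow> nat \<Rightarrow> nat \<Rightarrow> F_choice \<Rightarrow> F_choice \<Rightarrow> (F_vertex + F_vertex) pair_pre_digraph" where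
  "G4_graph l m t s a b =
     \<lparr> pverts = pverts (F_graph l m t s a) <+> pverts (F_graph l m t s b),
       parcs = map_prod Inl Inl ` parcs (F_graph l m t s a) \<union>
               map_prod Inr Inr ` parcs (F_graph l m t s b) \<union>
               join_arcs {Inl XVertex} {Inr XVertex} \<rparr>"

subsection \<open>Replacing edges by copies of a graph\<close>

text \<open>
  Every edge \<open>e\<close> of \<open>G\<close> is replaced by a copy of the graph \<open>H e\<close> with endpoints \<open>p\<close>, \<open>q\<close>, where \<open>p\<close>
  is identified with \<open>fst (ends e)\<close> and \<open>q\<close> with \<open>snd (ends e)\<close>. Vertices \<open>Inl v\<close> are those of
  \<open>G\<close>, and \<open>Inr (e, w)\<close> is the vertex \<open>w\<close> in the copy belonging to \<open>e\<close>. One copy is used per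
  undirected edge, not per arc.
\<close>

definition valid_ends :: "'a pair_pre_digraph \<Rightarrow> ('a set \<Rightarrow> 'a \<times> 'a) \<Rightarrow> bool" where
  "valid_ends G ends \<longleftrightarrow> (\<forall>e\<in>edge_sets G. e = {fst (ends e), snd (ends e)})"

definition copy_vertex ::
  "('a set \<Rightarrow> 'a \<times> 'a) \<Rightarrow> 'b \<Rightarrow> 'b \<Rightarrow> 'a set \<Rightarrow> 'b \<Rightarrow> 'a + 'a set \<times> 'b" where
  "copy_vertex ends p q e w =
     (if w = p then Inl (fst (ends e))
      else if w = q then Inl (snd (ends e))
      else Inr (e, w))"

definition replace_edges ::
  "('a set \<Rightarrow> 'b pair_pre_digraph) \<Rightarrow> 'b \<Rightarrow> 'b \<Rightarrow> ('a set \<Rightarrow> 'a \<times> 'a) \<Rightarrow>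
   'a pair_pre_digraph \<Rightarrow> ('a + 'a set \<times> 'b) pair_pre_digraph" where
  "replace_edges H p q ends G =
     \<lparr> pverts = Inl ` pverts G \<union>
         (\<Union>e\<in>edge_sets G. copy_vertex ends p q e ` pverts (H e)),
       parcs = (\<Union>e\<in>edge_sets G.
         map_prod (copy_vertex ends p q e) (copy_vertex ends p q e) ` parcs (H e)) \<rparr>"

text \<open>
  The neighbour choices \<open>a e\<close>, \<open>b e\<close> for the two halves may differ from copy to copy; the
  operator with one fixed choice of \<open>G\<^sub>4(l,m,t,s)\<close> is the case of constant \<open>a\<close> and \<open>b\<close>.
\<close>

definition E_G4 ::
  "nat \<Rightarrow> nat \<Rightarrow> nat \<Rightarrow> nat \<Rightarrow> ('a set \<Rightarrow> F_choice) \<Rightarrow> ('a set \<Rightarrow> F_choice) \<Rightarrow>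
   ('a set \<Rightarrow> 'a \<times> 'a) \<Rightarrow> 'a pair_pre_digraph \<Rightarrow>
   ('a + 'a set \<times> (F_vertex + F_vertex)) pair_pre_digraph" where
  "E_G4 l m t s a b ends G =
     replace_edges (\<lambda>e. G4_graph l m t s (a e) (b e)) (Inl Center) (Inr Center) ends G"

end

theory Submission imports Defs begin

text \<open>
  Let a gadget be the graph that replaces an edge. Summing \<open>x\<close> to the number of inner vertices over
  the independent sets of a gadget with a prescribed subset of its endpoints gives \<open>A(x)\<^sup>2\<close> times \<open>(1 + l x) (1 + (l + 2) x)\<close>,
  \<open>1 + (l + 1) x\<close> or \<open>1\<close>, when none, one or both of the endpoints belong to the set; the product
  \<open>A\<close> of three linear polynomials is the same for all choices of neighbours (\<open>gadget_gf_eq\<close>).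
  So the independence polynomial is a power of \<open>A\<close> times a polynomial \<open>Q\<close>, the sum over all
  \<open>S \<subseteq> V\<close> of \<open>x\<^bsup>|S|\<^esup>\<close> times the product of these three weights over the edges (\<open>hard_core\<close>).
  In general \<open>Q\<close> has non-real zeros: without the interaction along edges a vertex of degree
  \<open>d \<ge> 3\<close> would contribute the factor \<open>x + (1 + (l + 1) x)\<^sup>d\<close>.

  Log-concavity comes from two variables. If \<open>Q(p) Q(q)\<close> is a nonnegative combination of the Schur
  polynomials \<open>(p q)\<^sup>k h\<^sub>r(p, q)\<close>, then \<open>Q\<close> is log-concave, because in each of these the
  coefficient of \<open>p\<^sup>k q\<^sup>k\<close> is at least that of \<open>p\<^bsup>k-1\<^esup> q\<^bsup>k+1\<^esup>\<close>
  (\<open>schur_cone_coeff_unimodal\<close>). These combinations are closed under sums and products, so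
  the square of \<open>A\<close> is harmless and only \<open>Q\<close> matters.

  Now \<open>Q(p) Q(q)\<close> is a sum over pairs of subsets of \<open>V\<close>, one for each copy of \<open>Q\<close>, that is over
  assignments of one of four states to each vertex. The weight of an edge is a sum of three terms
  that factor over its ends and a fourth, the double edge term, in which each copy uses one of the
  two special vertices \<open>XVertex\<close> of the gadget (\<open>edge_pair\<close>). Expand all edges. For a fixed set of double edges the vertices that
  are not in the neutral state fall into connected clusters, and the weight vanishes unless the
  members of a cluster with several vertices alternate between the two copies. The two alternating
  patterns are exchanged by swapping \<open>p\<close> and \<open>q\<close>; their sum can have negative Schur coefficients, but these are outweighed
  by a small multiple of the weight of the neutral state on the cluster (\<open>cluster_single\<close>,
  \<open>cluster_many\<close>, \<open>cluster_sum_ge\<close>). With \<open>e\<close> double edges inside a cluster and \<open>f\<close> leaving it,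
  the multiple is \<open>4\<^bsup>-e-1\<^esup> 2\<^bsup>-f\<^esup>\<close>.

  By induction on the set \<open>U\<close> of vertices that may be active, removing one vertex from \<open>U\<close> costs at
  most a factor \<open>3/4\<close> in the Schur order, so the whole sum stays positive
  (\<open>config_sum_positive\<close>). In the induction step the losses are added up over all clusters that
  contain the vertex, each with a factor \<open>4/3\<close> for every other vertex of the cluster or its
  boundary. They are then at most a quarter of the probabilities that the vertex has the given
  component in site percolation with density \<open>1/3\<close>, which add up to \<open>1\<close> (\<open>percolation\<close>).
\<close>

section \<open>The cone of Schur-positive polynomials in two variables\<close>

text \<open>Polynomials in \<open>p\<close>, the outer variable, and \<open>q\<close>, the inner one.\<close>
type_synonym bipoly = "real poly poly"

definition cst :: "real \<Rightarrow> bipoly" where "cst c = [:[:c:]:]"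

definition pv :: bipoly where "pv = [:0, 1:]"

definition qv :: bipoly where "qv = [:[:0, 1:]:]"

definition e1 :: bipoly where "e1 = pv + qv"

definition e2 :: bipoly where "e2 = pv * qv"

text \<open>
  The complete homogeneous symmetric polynomial of degree \<open>r\<close>, by its linear recurrence; the
  Schur polynomials in two variables are the products \<open>e2 ^ k * hsym r\<close>.
\<close>
fun hsym :: "nat \<Rightarrow> bipoly" where
  "hsym 0 = 1"
| "hsym (Suc 0) = e1"
| "hsym (Suc (Suc r)) = e1 * hsym (Suc r) - e2 * hsym r"

lemma cst_0 [simp]: "cst 0 = 0" and cst_1 [simp]: "cst 1 = 1"
  by (simp_all add: cst_def flip: one_pCons)

lemma cst_add: "cst (x + y) = cst x + cst y"
  and cst_mult: "cst (x * y) = cst x * cst y"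
  and cst_diff: "cst (x - y) = cst x - cst y"
  by (simp_all add: cst_def)

lemma cst_of_nat: "cst (of_nat n) = of_nat n"
  by (induction n) (simp_all add: cst_add)

lemma cst_numeral [simp]: "cst (numeral n) = numeral n"
  using cst_of_nat[of "numeral n"] by simp

lemma cst_power: "cst (x ^ n) = cst x ^ n"
  by (induction n) (simp_all add: cst_mult)

lemma cst_sum: "cst (sum f A) = (\<Sum>x\<in>A. cst (f x))"
  by (induction A rule: infinite_finite_induct) (simp_all add: cst_add)

text \<open>One step of the Clebsch-Gordan rule; iterating it expands a product of two \<open>hsym\<close>.\<close>
lemma hsym_mult: "hsym (Suc r) * hsym (Suc s) = hsym (r + s + 2) + e2 * (hsym r * hsym s)"
proof (induction s rule: hsym.induct)
  case (3 s)
  have "hsym (Suc r) * hsym (Suc (Suc (Suc s)))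
      = e1 * (hsym (Suc r) * hsym (Suc (Suc s))) - e2 * (hsym (Suc r) * hsym (Suc s))"
    by (simp add: algebra_simps)
  also have "\<dots> = e1 * (hsym (r + Suc s + 2) + e2 * (hsym r * hsym (Suc s)))
                  - e2 * (hsym (r + s + 2) + e2 * (hsym r * hsym s))"
    using 3 by simp
  also have "\<dots> = (e1 * hsym (Suc (r + s + 2)) - e2 * hsym (r + s + 2))
                  + e2 * (hsym r * (e1 * hsym (Suc s) - e2 * hsym s))"
    by (simp add: algebra_simps)
  finally show ?case by (simp add: algebra_simps)
qed (simp_all add: algebra_simps)

lemma hsym_explicit: "hsym r = (\<Sum>i\<le>r. pv ^ i * qv ^ (r - i))"
proof (induction r rule: hsym.induct)
  case (3 r)
  define H where "H n = (\<Sum>i\<le>n. pv ^ i * qv ^ (n - i))" for n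
  have right: "H (Suc n) = qv * H n + pv ^ Suc n" for n
    by (simp add: H_def sum_distrib_left Suc_diff_le mult_ac)
  have "H (Suc (Suc r)) = e1 * H (Suc r) - e2 * H r"
    unfolding right[of "Suc r"] right[of r] by (simp add: e1_def e2_def algebra_simps)
  with 3 show ?case by (simp add: H_def)
qed (simp_all add: e1_def)

inductive_set schur_cone :: "bipoly set" where
  zero [intro, simp]: "0 \<in> schur_cone"
| step: "f \<in> schur_cone \<Longrightarrow> c \<ge> 0 \<Longrightarrow> cst c * (e2 ^ k * hsym r) + f \<in> schur_cone"

lemma schur_cone_basis: "c \<ge> 0 \<Longrightarrow> cst c * (e2 ^ k * hsym r) \<in> schur_cone"
  using schur_cone.step[OF schur_cone.zero] by simp

lemma schur_cone_add [intro]: "f \<in> schur_cone \<Longrightarrow> g \<in> schur_cone \<Longrightarrow> f + g \<in> schur_cone"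
  by (induction f rule: schur_cone.induct) (simp_all add: add.assoc schur_cone.step)

lemma schur_cone_cst_mult: "f \<in> schur_cone \<Longrightarrow> c \<ge> 0 \<Longrightarrow> cst c * f \<in> schur_cone"
proof (induction f rule: schur_cone.induct)
  case (step f d k r)
  then have "cst (c * d) * (e2 ^ k * hsym r) + cst c * f \<in> schur_cone"
    by (intro schur_cone.step) auto
  then show ?case by (simp add: cst_mult algebra_simps)
qed simp

lemma schur_cone_e2_mult: "f \<in> schur_cone \<Longrightarrow> e2 ^ j * f \<in> schur_cone"
proof (induction f rule: schur_cone.induct)
  case (step f c k r)
  then have "cst c * (e2 ^ (j + k) * hsym r) + e2 ^ j * f \<in> schur_cone"
    by (intro schur_cone.step) auto
  then show ?case by (simp add: power_add algebra_simps)
qed simp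

lemma schur_cone_hsym_mult_hsym: "hsym r * hsym s \<in> schur_cone"
proof (induction r arbitrary: s)
  case 0
  then show ?case using schur_cone_basis[of 1 0 s] by simp
next
  case (Suc r)
  show ?case
  proof (cases s)
    case 0
    then show ?thesis using schur_cone_basis[of 1 0 "Suc r"] by simp
  next
    case (Suc s')
    have "hsym (r + s' + 2) \<in> schur_cone" using schur_cone_basis[of 1 0 "r + s' + 2"] by simp
    moreover have "e2 * (hsym r * hsym s') \<in> schur_cone"
      using schur_cone_e2_mult[OF Suc.IH, of 1] by simp
    ultimately show ?thesis unfolding Suc hsym_mult by auto
  qed
qed

lemma schur_cone_hsym_mult: "f \<in> schur_cone \<Longrightarrow> hsym s * f \<in> schur_cone"
proof (induction f rule: schur_cone.induct)
  case (step f c k r)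
  have "cst c * (e2 ^ k * (hsym s * hsym r)) \<in> schur_cone"
    using step by (intro schur_cone_cst_mult schur_cone_e2_mult schur_cone_hsym_mult_hsym)
  with step.IH have "cst c * (e2 ^ k * (hsym s * hsym r)) + hsym s * f \<in> schur_cone" by auto
  then show ?case by (simp add: algebra_simps)
qed simp

lemma schur_cone_mult [intro]: "f \<in> schur_cone \<Longrightarrow> g \<in> schur_cone \<Longrightarrow> f * g \<in> schur_cone"
proof (induction f rule: schur_cone.induct)
  case (step f c k r)
  have "cst c * (e2 ^ k * (hsym r * g)) \<in> schur_cone"
    using step by (intro schur_cone_cst_mult schur_cone_e2_mult schur_cone_hsym_mult)
  then have "cst c * (e2 ^ k * (hsym r * g)) + f * g \<in> schur_cone" using step by auto
  then show ?case by (simp add: algebra_simps)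
qed simp

lemma schur_cone_cst [intro]: "c \<ge> 0 \<Longrightarrow> cst c \<in> schur_cone"
  using schur_cone_basis[of c 0 0] by simp

lemma schur_cone_1 [intro, simp]: "1 \<in> schur_cone"
  using schur_cone_cst[of 1] by simp

lemma schur_cone_of_nat [intro, simp]: "of_nat n \<in> schur_cone"
  using schur_cone_cst[of "of_nat n"] by (simp add: cst_of_nat)

lemma schur_cone_numeral [intro, simp]: "numeral n \<in> schur_cone"
  using schur_cone_of_nat[of "numeral n"] by simp

lemma schur_cone_hsym [intro, simp]: "hsym r \<in> schur_cone"
  using schur_cone_basis[of 1 0 r] by simp

lemma schur_cone_e1 [intro, simp]: "e1 \<in> schur_cone"
  using schur_cone_hsym[of 1] by simp

lemma schur_cone_e2 [intro, simp]: "e2 \<in> schur_cone"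
  using schur_cone_basis[of 1 1 0] by simp

lemma schur_cone_power [intro]: "f \<in> schur_cone \<Longrightarrow> f ^ n \<in> schur_cone"
  by (induction n) auto

lemma schur_cone_sum [intro]: "(\<And>x. x \<in> A \<Longrightarrow> f x \<in> schur_cone) \<Longrightarrow> sum f A \<in> schur_cone"
  by (induction A rule: infinite_finite_induct) auto

lemma schur_cone_prod [intro]: "(\<And>x. x \<in> A \<Longrightarrow> f x \<in> schur_cone) \<Longrightarrow> prod f A \<in> schur_cone"
  by (induction A rule: infinite_finite_induct) auto

text \<open>The partial order whose positive elements are the Schur-positive polynomials.\<close>
definition schur_le :: "bipoly \<Rightarrow> bipoly \<Rightarrow> bool" (infix "\<sqsubseteq>" 50) where
  "f \<sqsubseteq> g \<longleftrightarrow> g - f \<in> schur_cone"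

lemma schur_le_refl [simp, intro]: "f \<sqsubseteq> f" by (simp add: schur_le_def)

lemma schur_le_trans [trans]: "f \<sqsubseteq> g \<Longrightarrow> g \<sqsubseteq> h \<Longrightarrow> f \<sqsubseteq> h"
  unfolding schur_le_def using schur_cone_add[of "g - f" "h - g"] by simp

lemma schur_le_add: "f \<sqsubseteq> g \<Longrightarrow> f' \<sqsubseteq> g' \<Longrightarrow> f + f' \<sqsubseteq> g + g'"
  unfolding schur_le_def using schur_cone_add[of "g - f" "g' - f'"] by (simp add: algebra_simps)

lemma schur_le_0 [simp]: "0 \<sqsubseteq> f \<longleftrightarrow> f \<in> schur_cone" by (simp add: schur_le_def)

lemma schur_le_mult_left: "h \<in> schur_cone \<Longrightarrow> f \<sqsubseteq> g \<Longrightarrow> h * f \<sqsubseteq> h * g"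
  unfolding schur_le_def using schur_cone_mult[of h "g - f"] by (simp add: algebra_simps)

lemma schur_le_mult_right: "h \<in> schur_cone \<Longrightarrow> f \<sqsubseteq> g \<Longrightarrow> f * h \<sqsubseteq> g * h"
  using schur_le_mult_left[of h f g] by (simp add: mult.commute)

lemma schur_le_mult: "f \<sqsubseteq> g \<Longrightarrow> f' \<sqsubseteq> g' \<Longrightarrow> f \<in> schur_cone \<Longrightarrow> g' \<in> schur_cone \<Longrightarrow> f * f' \<sqsubseteq> g * g'"
  by (rule schur_le_trans[OF schur_le_mult_left[of f f' g'] schur_le_mult_right[of g' f g]])

lemma schur_le_cone: "f \<in> schur_cone \<Longrightarrow> f \<sqsubseteq> g \<Longrightarrow> g \<in> schur_cone"
  unfolding schur_le_def using schur_cone_add[of f "g - f"] by simp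

lemma schur_le_power: "f \<sqsubseteq> g \<Longrightarrow> f \<in> schur_cone \<Longrightarrow> f ^ n \<sqsubseteq> g ^ n"
proof (induction n)
  case (Suc n)
  then show ?case
    using schur_le_mult[of f g "f ^ n" "g ^ n"] schur_cone_power[OF schur_le_cone[of f g], of n] by simp
qed simp

lemma schur_le_add_left: "f \<in> schur_cone \<Longrightarrow> g \<sqsubseteq> f + g"
  and schur_le_add_right: "f \<in> schur_cone \<Longrightarrow> g \<sqsubseteq> g + f"
  by (simp_all add: schur_le_def)

lemma schur_le_sum: "(\<And>x. x \<in> A \<Longrightarrow> f x \<sqsubseteq> g x) \<Longrightarrow> sum f A \<sqsubseteq> sum g A"
  unfolding schur_le_def by (simp flip: sum_subtractf) (auto intro: schur_cone_sum)

lemma schur_le_cst: "x \<le> y \<Longrightarrow> f \<in> schur_cone \<Longrightarrow> cst x * f \<sqsubseteq> cst y * f"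
  unfolding schur_le_def using schur_cone_cst_mult[of f "y - x"] by (simp add: cst_diff algebra_simps)

lemma pv_qv_power: "pv ^ i * qv ^ j = monom (monom 1 j) i"
proof -
  have "pv ^ i = monom 1 i" by (simp add: pv_def monom_altdef)
  moreover have "qv ^ j = [:monom 1 j:]"
    by (induction j) (simp_all add: qv_def monom_0 monom_Suc flip: one_pCons)
  ultimately show ?thesis by (simp add: smult_monom)
qed

lemma coeff_basis:
  "coeff (coeff (e2 ^ k * hsym r) i) j = (if i + j = 2 * k + r \<and> k \<le> i \<and> k \<le> j then 1 else 0)"
proof -
  have eq: "e2 ^ k * hsym r = (\<Sum>n\<le>r. monom (monom 1 (k + r - n)) (k + n))"
    unfolding hsym_explicit sum_distrib_left
  proof (rule sum.cong)
    fix n assume "n \<in> {..r}"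
    then have "k + r - n = k + (r - n)" by simp
    then have "e2 ^ k * (pv ^ n * qv ^ (r - n)) = pv ^ (k + n) * qv ^ (k + r - n)"
      by (simp only: e2_def power_mult_distrib power_add mult_ac)
    then show "e2 ^ k * (pv ^ n * qv ^ (r - n)) = monom (monom 1 (k + r - n)) (k + n)"
      by (simp add: pv_qv_power)
  qed simp
  have "coeff (coeff (e2 ^ k * hsym r) i) j
      = (\<Sum>n\<le>r. if k + n = i \<and> k + r - n = j then 1 else 0)"
    unfolding eq coeff_sum by (rule sum.cong) (simp_all add: coeff_monom)
  also have "\<dots> = (\<Sum>n\<in>{n \<in> {..r}. k + n = i \<and> k + r - n = j}. 1)"
    by (rule sum.inter_filter[symmetric]) simp
  also have "{n \<in> {..r}. k + n = i \<and> k + r - n = j}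
      = (if i + j = 2 * k + r \<and> k \<le> i \<and> k \<le> j then {i - k} else {})"
    by (intro set_eqI) (simp split: if_split, linarith)
  finally show ?thesis by (simp split: if_splits)
qed

text \<open>
  If the monomial \<open>p\<^bsup>k-1\<^esup> q\<^bsup>k+1\<^esup>\<close> occurs in \<open>e2 ^ n * hsym r\<close>, then so does the more balanced
  monomial \<open>p\<^sup>k q\<^sup>k\<close>, and all nonzero coefficients are \<open>1\<close>.
\<close>
lemma schur_cone_coeff_unimodal:
  assumes "f \<in> schur_cone" "k \<ge> 1"
  shows "coeff (coeff f (k - 1)) (k + 1) \<le> coeff (coeff f k) k"
  using assms(1)
proof (induction f rule: schur_cone.induct)
  case (step f c n r)
  have "coeff (coeff (e2 ^ n * hsym r) (k - 1)) (k + 1) \<le> coeff (coeff (e2 ^ n * hsym r) k) k"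
    using \<open>k \<ge> 1\<close> by (auto simp: coeff_basis)
  then have "c * coeff (coeff (e2 ^ n * hsym r) (k - 1)) (k + 1) \<le> c * coeff (coeff (e2 ^ n * hsym r) k) k"
    using step.hyps(2) by (rule mult_left_mono)
  with step.IH show ?case by (simp add: cst_def)
qed simp

section \<open>Negative parts of cluster weights\<close>
definition lin_p :: "real \<Rightarrow> bipoly" where "lin_p c = 1 + cst c * pv"

definition lin_q :: "real \<Rightarrow> bipoly" where "lin_q c = 1 + cst c * qv"

definition sym_monomial :: "nat \<Rightarrow> nat \<Rightarrow> bipoly" where
  "sym_monomial i j = pv ^ i * qv ^ j + pv ^ j * qv ^ i"

text \<open>
  Minus the negative part of the Schur expansion of \<open>sym_monomial i j\<close>: for \<open>i \<ge> j + 2\<close> the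
  latter is \<open>e2 ^ j * hsym (i - j) - e2 ^ (j + 1) * hsym (i - j - 2)\<close>.
\<close>
definition deficit :: "nat \<Rightarrow> nat \<Rightarrow> bipoly" where
  "deficit i j = (if j + 2 \<le> i then e2 ^ (j + 1) * hsym (i - j - 2)
     else if i + 2 \<le> j then e2 ^ (i + 1) * hsym (j - i - 2) else 0)"

lemma sym_monomial_commute: "sym_monomial i j = sym_monomial j i"
  by (simp add: sym_monomial_def add.commute)

lemma deficit_commute: "deficit i j = deficit j i"
  by (simp add: deficit_def)

lemma power_sum_eq: "pv ^ (d + 2) + qv ^ (d + 2) = hsym (d + 2) - e2 * hsym d"
proof (induction d rule: hsym.induct)
  case 1
  then show ?case by (simp add: e1_def e2_def power2_eq_square algebra_simps)
next
  case 2
  have "hsym (Suc 0 + 2) = e1 * (e1 * e1 - e2) - e2 * e1" by simp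
  then show ?case by (simp add: e1_def e2_def algebra_simps eval_nat_numeral)
next
  case (3 d)
  have "pv ^ (d + 4) + qv ^ (d + 4)
      = e1 * (pv ^ (Suc d + 2) + qv ^ (Suc d + 2)) - e2 * (pv ^ (d + 2) + qv ^ (d + 2))"
    by (simp add: e1_def e2_def algebra_simps power_add eval_nat_numeral)
  also have "\<dots> = e1 * (hsym (Suc d + 2) - e2 * hsym (Suc d)) - e2 * (hsym (d + 2) - e2 * hsym d)"
    using 3 by simp
  also have "\<dots> = (e1 * hsym (Suc (Suc (Suc d))) - e2 * hsym (Suc (Suc d)))
      - e2 * (e1 * hsym (Suc d) - e2 * hsym d)"
    by (simp add: algebra_simps)
  also have "\<dots> = hsym (d + 4) - e2 * hsym (d + 2)"
    by (simp add: eval_nat_numeral)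
  finally show ?case by (simp add: eval_nat_numeral)
qed

lemma deficit_sym_monomial: "deficit i j + sym_monomial i j \<in> schur_cone"
proof -
  have wlog: "deficit i j + sym_monomial i j \<in> schur_cone" if "j \<le> i" for i j
  proof -
    have eq: "sym_monomial i j = e2 ^ j * (pv ^ (i - j) + qv ^ (i - j))"
      using that by (simp add: sym_monomial_def e2_def power_mult_distrib algebra_simps flip: power_add)
    consider "i = j" | "i = j + 1" | d where "i = j + (d + 2)"
    proof -
      have "i = j \<or> i = j + 1 \<or> i = j + ((i - j - 2) + 2)" using \<open>j \<le> i\<close> by linarith
      then show thesis using that by blast
    qed
    then show ?thesis
    proof cases
      case 1
      then have "deficit i j + sym_monomial i j = e2 ^ j * 2" unfolding eq by (simp add: deficit_def)
      then show ?thesis by auto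
    next
      case 2
      then have "deficit i j + sym_monomial i j = e2 ^ j * e1" unfolding eq by (simp add: deficit_def e1_def)
      then show ?thesis by auto
    next
      case 3
      have "pv ^ (i - j) + qv ^ (i - j) = hsym (d + 2) - e2 * hsym d"
        using power_sum_eq[of d] 3 by (simp del: hsym.simps)
      moreover have "deficit i j = e2 ^ (j + 1) * hsym d" using 3 by (simp add: deficit_def)
      ultimately have "deficit i j + sym_monomial i j = e2 ^ j * hsym (d + 2)"
        unfolding eq by (simp add: right_diff_distrib mult_ac del: hsym.simps)
      then show ?thesis by (simp del: hsym.simps add: schur_cone_mult schur_cone_power)
    qed
  qed
  show ?thesis
    using wlog[of i j] wlog[of j i] sym_monomial_commute[of i j] deficit_commute[of i j]
    by (cases "j \<le> i") auto
qed

lemma hsym_le_e1_power: "hsym d \<sqsubseteq> e1 ^ d"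
proof (induction d rule: hsym.induct)
  case (3 d)
  have "hsym (Suc (Suc d)) \<sqsubseteq> e1 * hsym (Suc d)"
    by (simp add: schur_le_def) (auto intro: schur_cone_mult)
  also have "\<dots> \<sqsubseteq> e1 * e1 ^ Suc d"
    by (intro schur_le_mult_left 3) simp
  finally show ?case by simp
qed auto

lemma e2_le_e1_sq: "e2 \<sqsubseteq> e1 ^ 2"
  using schur_cone_hsym[of 2] by (simp add: schur_le_def power2_eq_square eval_nat_numeral)

lemma e2_hsym_le_e1_power: "e2 ^ j * hsym d \<sqsubseteq> e1 ^ (2 * j + d)"
proof -
  have "e2 ^ j * hsym d \<sqsubseteq> (e1 ^ 2) ^ j * e1 ^ d"
    by (intro schur_le_mult schur_le_power e2_le_e1_sq hsym_le_e1_power) auto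
  then show ?thesis by (simp add: power_add power_mult)
qed

text \<open>The first two terms of the binomial expansion.\<close>
lemma e1_e2_power:
  "e1 ^ Suc m + of_nat (Suc m) * (e2 * e1 ^ m) \<sqsubseteq> (e1 + e2) ^ Suc m"
proof (induction m)
  case (Suc m)
  have "e1 ^ Suc (Suc m) + of_nat (Suc (Suc m)) * (e2 * e1 ^ Suc m)
     \<sqsubseteq> e1 ^ Suc (Suc m) + of_nat (Suc (Suc m)) * (e2 * e1 ^ Suc m) + of_nat (Suc m) * (e2 * (e2 * e1 ^ m))"
    by (intro schur_le_add_right schur_cone_mult schur_cone_power) auto
  also have "\<dots> = (e1 + e2) * (e1 ^ Suc m + of_nat (Suc m) * (e2 * e1 ^ m))"
    by (simp add: algebra_simps)
  also have "\<dots> \<sqsubseteq> (e1 + e2) * (e1 + e2) ^ Suc m"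
    by (intro schur_le_mult_left Suc.IH schur_cone_add) auto
  finally show ?case by simp
qed simp

lemma e1_e2_power': "of_nat (Suc m) * (e2 * e1 ^ m) \<sqsubseteq> (e1 + e2) ^ Suc m"
  by (rule schur_le_trans[OF _ e1_e2_power])
    (intro schur_le_add_left schur_cone_power, simp)

text \<open>
  In degree \<open>D = m + 2\<close> the deficit is a single Schur polynomial below \<open>e2 * e1 ^ m\<close>, and the
  binomial coefficient \<open>D - 1 \<ge> 4\<close> pays for the factor \<open>1/4\<close>.
\<close>
lemma deficit_le:
  assumes "i \<ge> 1" "j \<ge> 1" "i + j = m + 2" "m + 1 \<ge> 4"
  shows "deficit i j \<sqsubseteq> cst (1/4) * (of_nat (m + 1) * (e2 * e1 ^ m))"
proof -
  have cone: "e2 * e1 ^ m \<in> schur_cone" by (intro schur_cone_mult schur_cone_power) auto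
  have le: "e2 * e1 ^ m \<sqsubseteq> cst (1/4) * (of_nat (m + 1) * (e2 * e1 ^ m))"
  proof -
    have "cst 1 * (e2 * e1 ^ m) \<sqsubseteq> cst (1/4 * real (m + 1)) * (e2 * e1 ^ m)"
      using assms cone by (intro schur_le_cst) auto
    then show ?thesis by (simp only: cst_mult cst_of_nat cst_1 mult.assoc mult_1)
  qed
  have wlog: "deficit i j \<sqsubseteq> e2 * e1 ^ m" if "j + 2 \<le> i" "j \<ge> 1" "i + j = m + 2" for i j
  proof -
    have "e2 * (e2 ^ j * hsym (i - j - 2)) \<sqsubseteq> e2 * e1 ^ (2 * j + (i - j - 2))"
      by (intro schur_le_mult_left e2_hsym_le_e1_power) auto
    moreover have "2 * j + (i - j - 2) = m" using that by linarith
    ultimately show ?thesis using that by (simp add: deficit_def algebra_simps)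
  qed
  have "deficit i j \<sqsubseteq> e2 * e1 ^ m"
  proof -
    consider "j + 2 \<le> i" | "i + 2 \<le> j" | "\<not> j + 2 \<le> i" "\<not> i + 2 \<le> j" by blast
    then show ?thesis
    proof cases
      case 1 then show ?thesis using wlog[of j i] assms by simp
    next
      case 2 then show ?thesis using wlog[of i j] assms deficit_commute[of i j] by simp
    next
      case 3 then show ?thesis using cone by (simp add: deficit_def)
    qed
  qed
  then show ?thesis using le by (rule schur_le_trans)
qed

text \<open>
  In degree at most \<open>3\<close> there is no deficit. In degree \<open>4\<close> the power \<open>(e1 + e2) ^ 3\<close> falls short by
  one copy of \<open>e2 ^ 2\<close>, so that this case needs its own hypothesis.
\<close>
lemma deficit_le_power:
  assumes "i \<ge> 1" "j \<ge> 1" "i + j = Suc D" "(e1 + e2) ^ D \<sqsubseteq> X"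
    and "D = 3 \<Longrightarrow> 4 * e2 ^ 2 \<sqsubseteq> X"
  shows "deficit i j \<sqsubseteq> cst (1/4) * X"
proof -
  have X: "X \<in> schur_cone"
    by (rule schur_le_cone[OF _ assms(4)]) (intro schur_cone_power schur_cone_add; simp)
  consider "D \<le> 2" | "D = 3" | "D \<ge> 4" by linarith
  then show ?thesis
  proof cases
    case 1
    then have "deficit i j = 0" using assms by (auto simp: deficit_def)
    then show ?thesis using X by (simp add: schur_cone_cst_mult)
  next
    case 2
    then have "(i, j) = (1, 3) \<or> (i, j) = (2, 2) \<or> (i, j) = (3, 1)" using assms(1-3) by auto
    then have "deficit i j \<in> {0, e2 ^ 2}"
      by (elim disjE) (simp_all add: deficit_def power2_eq_square)
    moreover have "e2 ^ 2 \<sqsubseteq> cst (1/4) * X"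
    proof -
      have "cst (1/4) * (4 * e2 ^ 2) \<sqsubseteq> cst (1/4) * X"
        using assms(5)[OF 2] by (intro schur_le_mult_left) auto
      moreover have "cst (1/4) * (4 * e2 ^ 2) = e2 ^ 2"
        using cst_mult[of "1/4" 4] by (simp flip: mult.assoc)
      ultimately show ?thesis by simp
    qed
    ultimately show ?thesis using X by (auto simp: schur_cone_cst_mult)
  next
    case 3
    define m where "m = D - 1"
    have "deficit i j \<sqsubseteq> cst (1/4) * (of_nat (m + 1) * (e2 * e1 ^ m))"
      using 3 assms by (intro deficit_le) (auto simp: m_def)
    also have "\<dots> \<sqsubseteq> cst (1/4) * X"
      using e1_e2_power'[of m] assms(4) 3
      by (intro schur_le_mult_left) (auto simp: m_def intro: schur_le_trans)
    finally show ?thesis .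
  qed
qed

text \<open>
  Both copies together when exactly one of them uses the special vertex of a clique: that copy
  contributes \<open>p\<close> or \<open>q\<close>, the other one its linear factor.
\<close>
definition special :: "real \<Rightarrow> bipoly" where "special c = pv * lin_q c + qv * lin_p c"

lemma lin_p_lin_q: "lin_p c * lin_q c = 1 + cst c * (e1 + cst c * e2)"
  by (simp add: lin_p_def lin_q_def e1_def e2_def algebra_simps)

lemma special_eq: "special c = e1 + 2 * (cst c * e2)"
  by (simp add: special_def lin_p_def lin_q_def e1_def e2_def algebra_simps)

lemma e12_cone [simp, intro]: "e1 + e2 \<in> schur_cone"
  by (intro schur_cone_add) auto

lemma e2_le_cst_e2: "c \<ge> 1 \<Longrightarrow> e2 \<sqsubseteq> cst c * e2"
  using schur_le_cst[of 1 c e2] by simp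

lemma lin_p_lin_q_ge:
  assumes "c \<ge> 1"
  shows "1 + (e1 + e2) \<sqsubseteq> lin_p c * lin_q c"
proof -
  have "e1 + e2 \<sqsubseteq> e1 + cst c * e2"
    using assms by (intro schur_le_add e2_le_cst_e2) auto
  also have "\<dots> \<sqsubseteq> cst c * (e1 + cst c * e2)"
    using assms schur_le_cst[of 1 c "e1 + cst c * e2"] schur_cone_cst_mult[of e2 c]
    by (auto intro: schur_cone_add)
  finally show ?thesis unfolding lin_p_lin_q by (intro schur_le_add) auto
qed

lemma lin_p_lin_q_cone: "c \<ge> 0 \<Longrightarrow> lin_p c * lin_q c \<in> schur_cone"
  unfolding lin_p_lin_q by (intro schur_cone_add schur_cone_mult schur_cone_cst) auto

lemma special_ge:
  assumes "c \<ge> 1"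
  shows "e1 + e2 + e2 \<sqsubseteq> special c"
proof -
  have "e1 + (e2 + e2) \<sqsubseteq> e1 + (cst c * e2 + cst c * e2)"
    using assms by (intro schur_le_add e2_le_cst_e2) auto
  then show ?thesis by (simp add: special_eq algebra_simps)
qed

lemma special_cone: "c \<ge> 0 \<Longrightarrow> special c \<in> schur_cone"
  unfolding special_eq by (intro schur_cone_add schur_cone_mult schur_cone_cst) auto

lemma e12_le_special: "c \<ge> 1 \<Longrightarrow> e1 + e2 \<sqsubseteq> special c"
  by (rule schur_le_trans[OF schur_le_add_right special_ge]) auto

text \<open>
  One summand of a cluster weight after the powers of the linear factors have been expanded, with
  its share of the compensating neutral weight.
\<close>
definition cluster_term :: "real \<Rightarrow> nat \<Rightarrow> nat \<Rightarrow> nat \<Rightarrow> nat \<Rightarrow> nat \<Rightarrow> bipoly" where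
  "cluster_term c e s k i j = cst (1/4) * ((cst c * (e1 + cst c * e2)) ^ k * (lin_p c * lin_q c) ^ e * special c ^ s)
     + cst c ^ k * sym_monomial i j"

text \<open>
  The powers of \<open>lin_q c\<close> and \<open>lin_p c\<close> in the cluster weight and the power of
  \<open>lin_p c * lin_q c = 1 + u\<close> in the neutral weight are expanded with the same binomial
  coefficients, so that they can be compared summand by summand.
\<close>
lemma cluster_expand:
  "cst (1/4) * ((lin_p c * lin_q c) ^ (A + B + e) * special c ^ s)
     + (pv ^ i * qv ^ j * lin_q c ^ B * lin_p c ^ A + pv ^ j * qv ^ i * lin_p c ^ B * lin_q c ^ A)
   = (\<Sum>x\<le>B. \<Sum>y\<le>A. of_nat ((B choose x) * (A choose y)) * cluster_term c e s (x + y) (i + y) (j + x))"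
proof -
  define u where "u = cst c * (e1 + cst c * e2)"
  have pow: "(1 + z) ^ n = (\<Sum>x\<le>n. of_nat (n choose x) * z ^ x)" for z :: bipoly and n
    using binomial_ring[of z 1 n] by (simp add: add.commute)
  have two: "(1 + z) ^ B * (1 + w) ^ A
      = (\<Sum>x\<le>B. \<Sum>y\<le>A. of_nat ((B choose x) * (A choose y)) * (z ^ x * w ^ y))" for z w :: bipoly
    unfolding pow sum_product by (simp add: mult_ac)
  have main: "(lin_p c * lin_q c) ^ (A + B + e) * special c ^ s
      = ((1 + u) ^ B * (1 + u) ^ A) * ((lin_p c * lin_q c) ^ e * special c ^ s)"
    by (simp add: lin_p_lin_q u_def power_add mult_ac)
  have 1: "lin_q c ^ B * lin_p c ^ A = (1 + cst c * qv) ^ B * (1 + cst c * pv) ^ A"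
    by (simp add: lin_p_def lin_q_def)
  have 2: "lin_p c ^ B * lin_q c ^ A = (1 + cst c * pv) ^ B * (1 + cst c * qv) ^ A"
    by (simp add: lin_p_def lin_q_def)
  have "cst (1/4) * ((lin_p c * lin_q c) ^ (A + B + e) * special c ^ s)
     + (pv ^ i * qv ^ j * lin_q c ^ B * lin_p c ^ A + pv ^ j * qv ^ i * lin_p c ^ B * lin_q c ^ A)
    = cst (1/4) * (((1 + u) ^ B * (1 + u) ^ A) * ((lin_p c * lin_q c) ^ e * special c ^ s))
     + (pv ^ i * qv ^ j * (lin_q c ^ B * lin_p c ^ A) + pv ^ j * qv ^ i * (lin_p c ^ B * lin_q c ^ A))"
    unfolding main by (simp add: mult_ac)
  also have "\<dots> = (\<Sum>x\<le>B. \<Sum>y\<le>A. of_nat ((B choose x) * (A choose y)) *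
      (cst (1/4) * ((u ^ x * u ^ y) * ((lin_p c * lin_q c) ^ e * special c ^ s))
      + (pv ^ i * qv ^ j * ((cst c * qv) ^ x * (cst c * pv) ^ y)
      + pv ^ j * qv ^ i * ((cst c * pv) ^ x * (cst c * qv) ^ y))))"
    unfolding 1 2 two sum_distrib_left sum_distrib_right sum.distrib[symmetric]
    by (intro sum.cong refl) (simp add: algebra_simps)
  also have "\<dots> = (\<Sum>x\<le>B. \<Sum>y\<le>A. of_nat ((B choose x) * (A choose y)) * cluster_term c e s (x + y) (i + y) (j + x))"
    by (intro sum.cong refl arg_cong2[where f = "(*)"])
      (simp add: cluster_term_def sym_monomial_def u_def power_add power_mult_distrib distrib_left mult_ac)
  finally show ?thesis .
qed

lemma cluster_term_ge:
  assumes "c \<ge> 1" "deficit i j \<sqsubseteq> cst (1/4) * X"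
    and "X \<sqsubseteq> (e1 + e2) ^ k * (lin_p c * lin_q c) ^ e * special c ^ s"
  shows "cluster_term c e s k i j \<in> schur_cone"
proof -
  let ?r = "(lin_p c * lin_q c) ^ e * special c ^ s"
  have r: "?r \<in> schur_cone"
    using assms(1) by (intro schur_cone_mult schur_cone_power lin_p_lin_q_cone special_cone) auto
  have "deficit i j \<sqsubseteq> cst (1/4) * ((e1 + e2) ^ k * ?r)"
    using assms(3) by (intro schur_le_trans[OF assms(2)] schur_le_mult_left) (auto simp: mult_ac)
  also have "\<dots> \<sqsubseteq> cst (1/4) * ((e1 + cst c * e2) ^ k * ?r)"
    using assms(1) r by (intro schur_le_mult_left schur_le_mult_right schur_le_power schur_le_add e2_le_cst_e2) auto
  finally have "cst (c ^ k) * (deficit i j + sym_monomial i j)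
      \<sqsubseteq> cst (c ^ k) * (cst (1/4) * ((e1 + cst c * e2) ^ k * ?r) + sym_monomial i j)"
    using assms(1) by (intro schur_le_mult_left schur_le_add) auto
  moreover have "cst (c ^ k) * (deficit i j + sym_monomial i j) \<in> schur_cone"
    using assms(1) by (intro schur_cone_cst_mult deficit_sym_monomial) auto
  moreover have "cst (c ^ k) * (cst (1/4) * ((e1 + cst c * e2) ^ k * ?r) + sym_monomial i j)
      = cluster_term c e s k i j"
    unfolding cluster_term_def cst_power power_mult_distrib[of "cst c"]
    by (subst distrib_left) (simp only: mult_ac)
  ultimately show ?thesis using schur_le_cone by metis
qed

lemma three_e2_sq_le: "3 * e2 ^ 2 \<sqsubseteq> (e1 + e2) ^ 3"
proof -
  have "3 * e2 ^ 2 \<sqsubseteq> 3 * (e2 * e1 ^ 2)"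
    using schur_le_mult_left[OF _ e2_le_e1_sq, of e2]
    by (intro schur_le_mult_left) (auto simp: power2_eq_square)
  also have "\<dots> \<sqsubseteq> (e1 + e2) ^ 3"
    using e1_e2_power'[of 2] by (simp add: eval_nat_numeral)
  finally show ?thesis .
qed

lemma e2_sq_le_e12_sq: "e2 ^ 2 \<sqsubseteq> (e1 + e2) ^ 2"
  by (intro schur_le_power schur_le_add_left) auto

text \<open>
  A cluster with \<open>n + 1 \<ge> 2\<close> vertices has \<open>e \<ge> n\<close> inner double edges. Each contributes a factor
  at least \<open>1 + (e1 + e2)\<close> to the neutral weight; its constant term supplies the copy of \<open>e2 ^ 2\<close>
  that is missing in degree \<open>4\<close>.
\<close>
lemma cluster_term_several:
  assumes "c \<ge> 1" "n \<ge> 1" "n \<le> e" "i \<ge> 1" "j \<ge> 1" "i + j = Suc (n + k + s)"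
  shows "cluster_term c e s k i j \<in> schur_cone"
proof (rule cluster_term_ge)
  let ?X = "(e1 + e2) ^ k * (1 + (e1 + e2)) ^ n * (e1 + e2) ^ s"
  have one: "(1 + (e1 + e2)) ^ n \<in> schur_cone" by (intro schur_cone_power schur_cone_add) auto
  have ge: "(e1 + e2) ^ (n - 1) + (e1 + e2) ^ n \<sqsubseteq> (1 + (e1 + e2)) ^ n"
  proof -
    have "(1 + (e1 + e2)) * (e1 + e2) ^ (n - 1) \<sqsubseteq> (1 + (e1 + e2)) * (1 + (e1 + e2)) ^ (n - 1)"
      by (intro schur_le_mult_left schur_le_power schur_le_add_left schur_cone_add) auto
    moreover have pow: "x * x ^ (n - 1) = x ^ n" for x :: bipoly
      using \<open>n \<ge> 1\<close> by (cases n) auto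
    ultimately show ?thesis by (simp only: distrib_right[of 1] pow mult_1)
  qed
  have X: "(e1 + e2) ^ (n - 1 + k + s) + (e1 + e2) ^ (n + k + s) \<sqsubseteq> ?X"
  proof -
    have "(e1 + e2) ^ k * ((e1 + e2) ^ (n - 1) + (e1 + e2) ^ n) * (e1 + e2) ^ s \<sqsubseteq> ?X"
      by (intro schur_le_mult_left schur_le_mult_right schur_cone_power ge) auto
    then show ?thesis by (simp add: power_add algebra_simps)
  qed
  show "deficit i j \<sqsubseteq> cst (1/4) * ?X"
  proof (rule deficit_le_power)
    show "(e1 + e2) ^ (n + k + s) \<sqsubseteq> ?X"
      by (rule schur_le_trans[OF _ X]) (intro schur_le_add_left schur_cone_power; simp)
  next
    assume "n + k + s = 3"
    moreover have "n - 1 + k + s = 2" using calculation assms(2) by simp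
    ultimately have "(e1 + e2) ^ 2 + (e1 + e2) ^ 3 \<sqsubseteq> ?X" using X by simp
    moreover have "e2 ^ 2 + 3 * e2 ^ 2 \<sqsubseteq> (e1 + e2) ^ 2 + (e1 + e2) ^ 3"
      by (intro schur_le_add e2_sq_le_e12_sq three_e2_sq_le)
    ultimately show "4 * e2 ^ 2 \<sqsubseteq> ?X" using schur_le_trans by (simp add: algebra_simps)
  qed (use assms in auto)
  show "?X \<sqsubseteq> (e1 + e2) ^ k * (lin_p c * lin_q c) ^ e * special c ^ s"
  proof -
    have c: "c \<ge> 0" using assms by simp
    have "(1 + (e1 + e2)) ^ n \<sqsubseteq> (lin_p c * lin_q c) ^ n"
      using assms by (intro schur_le_power lin_p_lin_q_ge schur_cone_add) auto
    also have "\<dots> \<sqsubseteq> (lin_p c * lin_q c) ^ n * (lin_p c * lin_q c) ^ (e - n)"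
    proof -
      have "1 \<sqsubseteq> lin_p c * lin_q c"
        by (rule schur_le_trans[OF schur_le_add_right lin_p_lin_q_ge]) (use assms in auto)
      then have "1 ^ (e - n) \<sqsubseteq> (lin_p c * lin_q c) ^ (e - n)" by (intro schur_le_power) auto
      then have "(lin_p c * lin_q c) ^ n * 1 ^ (e - n) \<sqsubseteq> (lin_p c * lin_q c) ^ n * (lin_p c * lin_q c) ^ (e - n)"
        using assms(1) by (intro schur_le_mult_left schur_cone_power lin_p_lin_q_cone) auto
      then show ?thesis by simp
    qed
    finally have "(1 + (e1 + e2)) ^ n \<sqsubseteq> (lin_p c * lin_q c) ^ e"
      using assms by (simp only: power_add[symmetric] le_add_diff_inverse)
    then have "(e1 + e2) ^ k * (1 + (e1 + e2)) ^ n \<sqsubseteq> (e1 + e2) ^ k * (lin_p c * lin_q c) ^ e"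
      by (intro schur_le_mult_left) auto
    moreover have "(e1 + e2) ^ s \<sqsubseteq> special c ^ s"
      using assms by (intro schur_le_power e12_le_special) auto
    moreover have "(e1 + e2) ^ k * (1 + (e1 + e2)) ^ n \<in> schur_cone"
      by (intro schur_cone_mult one) auto
    moreover have "special c ^ s \<in> schur_cone" by (intro schur_cone_power special_cone c)
    ultimately show ?thesis by (rule schur_le_mult)
  qed
qed (use assms in auto)

text \<open>
  For a single vertex the degree is \<open>k + s + 1\<close>. In degree \<open>4\<close> the missing \<open>e2 ^ 2\<close> comes from a factor
  \<open>special c\<close>, where \<open>e2\<close> has coefficient at least \<open>2\<close>.
\<close>
lemma cluster_term_single:
  assumes "c \<ge> 1" "k + s \<noteq> 3 \<or> s \<ge> 1"
  shows "cluster_term c 0 s k 1 (k + s) \<in> schur_cone"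
proof (cases "k + s = 0")
  case True
  then show ?thesis
    using schur_cone_add[OF schur_cone_cst[of "1/4"] deficit_sym_monomial[of 1 0]]
    by (simp add: cluster_term_def deficit_def)
next
  case False
  let ?X = "(e1 + e2) ^ k * (lin_p c * lin_q c) ^ 0 * special c ^ s"
  show ?thesis
  proof (rule cluster_term_ge)
    show "deficit 1 (k + s) \<sqsubseteq> cst (1/4) * ?X"
    proof (rule deficit_le_power)
      have "(e1 + e2) ^ k * (e1 + e2) ^ s \<sqsubseteq> (e1 + e2) ^ k * special c ^ s"
        using assms by (intro schur_le_mult_left schur_le_power e12_le_special) auto
      then show "(e1 + e2) ^ (k + s) \<sqsubseteq> ?X" by (simp add: power_add)
    next
      assume D: "k + s = 3"
      then obtain s' where s: "s = Suc s'" using assms(2) by (cases s) auto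
      have "(e1 + e2) ^ k * ((e1 + e2 + e2) * (e1 + e2) ^ s') \<sqsubseteq> (e1 + e2) ^ k * (special c * special c ^ s')"
        using assms by (intro schur_le_mult_left schur_le_mult schur_le_power e12_le_special special_ge)
          (use assms in \<open>auto intro!: special_cone schur_cone_power\<close>)
      moreover have "(e1 + e2) ^ k * ((e1 + e2 + e2) * (e1 + e2) ^ s')
          = (e1 + e2) ^ 3 + e2 * (e1 + e2) ^ 2"
      proof -
        have "(e1 + e2) ^ k * ((e1 + e2 + e2) * (e1 + e2) ^ s')
          = (e1 + e2) * (e1 + e2) ^ (k + s') + e2 * (e1 + e2) ^ (k + s')"
          by (simp add: power_add algebra_simps)
        moreover have "k + s' = 2" using D s by simp
        ultimately show ?thesis by (simp add: eval_nat_numeral)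
      qed
      moreover have "3 * e2 ^ 2 + e2 * e2 \<sqsubseteq> (e1 + e2) ^ 3 + e2 * (e1 + e2) ^ 2"
      proof (intro schur_le_add three_e2_sq_le schur_le_mult_left)
        show "e2 \<sqsubseteq> (e1 + e2) ^ 2"
          by (rule schur_le_trans[OF e2_le_e1_sq]) (intro schur_le_power schur_le_add_right; simp)
      qed auto
      ultimately have "3 * e2 ^ 2 + e2 * e2 \<sqsubseteq> (e1 + e2) ^ k * special c ^ s"
        using schur_le_trans by (simp add: s)
      then show "4 * e2 ^ 2 \<sqsubseteq> ?X" by (simp add: power2_eq_square)
    qed (use False in auto)
  qed (use assms in auto)
qed

text \<open>The comparison of coefficients of \<open>e2 ^ 2\<close> that \<open>cluster_term_234\<close> comes down to.\<close>
lemma choose_3_le: "(B choose 3) \<le> (B choose 2) + 2 * (B choose 4)"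
proof -
  have step: "Suc k * (B choose Suc k) = (B - k) * (B choose k)" for k
    using binomial_absorption[of k B] binomial_absorb_comp[of B k] by simp
  show ?thesis
  proof (cases "B \<le> 5")
    case True
    have "3 * (B choose 3) = (B - 2) * (B choose 2)" using step[of 2] by (simp only: Suc_numeral add_num_simps)
    also have "\<dots> \<le> 3 * (B choose 2)" using True by (intro mult_right_mono) auto
    finally show ?thesis by linarith
  next
    case False
    have "2 * (B choose 3) \<le> (B - 3) * (B choose 3)" using False by (intro mult_right_mono) auto
    also have "\<dots> = 4 * (B choose 4)" using step[of 3] by (simp only: Suc_numeral add_num_simps)
    finally show ?thesis by linarith
  qed
qed

text \<open>
  The summand of degree \<open>4\<close> for a single vertex without factors \<open>special c\<close> is not positive by itself.
  Its two neighbours have a surplus of \<open>e2 ^ 2\<close>: the square of \<open>e2\<close> in the one of degree \<open>3\<close>, and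
  the part \<open>2 * e2 ^ 2\<close> of \<open>e1 ^ 4\<close> in the one of degree \<open>5\<close>, which needs only the next term of
  its expansion for its own deficit.
\<close>
lemma cluster_term_234:
  assumes "c \<ge> 1"
  shows "of_nat (B choose 2) * cluster_term c 0 0 2 1 2 + of_nat (B choose 3) * cluster_term c 0 0 3 1 3
    + of_nat (B choose 4) * cluster_term c 0 0 4 1 4 \<in> schur_cone"
proof -
  define v where "v = e1 + cst c * e2"
  have vge: "e1 + e2 \<sqsubseteq> v" unfolding v_def using assms by (intro schur_le_add e2_le_cst_e2) auto
  have e2sq: "e2 ^ 2 \<in> schur_cone" by (intro schur_cone_power) auto
  have br: "cluster_term c 0 0 k i j = cst (c ^ k) * (cst (1/4) * v ^ k + sym_monomial i j)" for k i j
    unfolding cluster_term_def v_def[symmetric] cst_power power_mult_distrib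
    by (simp add: distrib_left mult_ac)
  have b2: "cst (c ^ 3 / 4) * e2 ^ 2 \<sqsubseteq> cluster_term c 0 0 2 1 2"
  proof -
    have "(cst c * e2) ^ 2 \<sqsubseteq> v ^ 2"
      unfolding v_def using assms
      by (intro schur_le_power schur_le_add_left schur_cone_mult schur_cone_cst) auto
    then have "cst (1/4) * (cst c * e2) ^ 2 \<sqsubseteq> cst (1/4) * v ^ 2"
      by (intro schur_le_mult_left) auto
    also have "\<dots> \<sqsubseteq> cst (1/4) * v ^ 2 + sym_monomial 1 2"
      using deficit_sym_monomial[of 1 2] by (intro schur_le_add_right) (simp add: deficit_def)
    finally have "cst (c ^ 2) * (cst (1/4) * (cst c * e2) ^ 2) \<sqsubseteq> cluster_term c 0 0 2 1 2"
      unfolding br using assms by (intro schur_le_mult_left) auto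
    moreover have "cst (c ^ 2) * (cst (1/4) * (cst c * e2) ^ 2) = cst (c ^ 2 * (1/4) * c ^ 2) * e2 ^ 2"
      by (simp only: cst_mult cst_power power_mult_distrib mult_ac)
    moreover have "cst (c ^ 3 / 4) * e2 ^ 2 \<sqsubseteq> cst (c ^ 2 * (1/4) * c ^ 2) * e2 ^ 2"
    proof (intro schur_le_cst e2sq)
      have "c ^ 3 \<le> c ^ 4" using assms by (intro power_increasing) auto
      then show "c ^ 3 / 4 \<le> c ^ 2 * (1/4) * c ^ 2" by (simp flip: power_add)
    qed
    ultimately show ?thesis by (simp only: schur_le_trans)
  qed
  have b3: "cst (- (c ^ 3 / 4)) * e2 ^ 2 \<sqsubseteq> cluster_term c 0 0 3 1 3"
  proof -
    have "3 * e2 ^ 2 \<sqsubseteq> v ^ 3"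
      by (rule schur_le_trans[OF three_e2_sq_le]) (intro schur_le_power vge; simp)
    then have "cst (1/4) * (3 * e2 ^ 2) \<sqsubseteq> cst (1/4) * v ^ 3"
      by (intro schur_le_mult_left) auto
    moreover have "- (e2 ^ 2) \<sqsubseteq> sym_monomial 1 3"
      using deficit_sym_monomial[of 1 3] by (simp add: deficit_def schur_le_def power2_eq_square add.commute)
    ultimately have "cst (1/4) * (3 * e2 ^ 2) + - (e2 ^ 2) \<sqsubseteq> cst (1/4) * v ^ 3 + sym_monomial 1 3"
      by (rule schur_le_add)
    then have "cst (c ^ 3) * (cst (1/4) * (3 * e2 ^ 2) + - (e2 ^ 2)) \<sqsubseteq> cluster_term c 0 0 3 1 3"
      unfolding br using assms by (intro schur_le_mult_left) auto
    moreover have "cst (c ^ 3) * (cst (1/4) * (3 * e2 ^ 2) + - (e2 ^ 2)) = cst (- (c ^ 3 / 4)) * e2 ^ 2"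
    proof -
      have "cst (1/4) * (3 * e2 ^ 2) + - (e2 ^ 2) = cst (1/4 * 3 - 1) * e2 ^ 2"
        unfolding cst_diff cst_mult by (simp add: algebra_simps)
      then have "cst (c ^ 3) * (cst (1/4) * (3 * e2 ^ 2) + - (e2 ^ 2)) = cst (c ^ 3 * (1/4 * 3 - 1)) * e2 ^ 2"
        by (simp only: cst_mult mult.assoc)
      also have "c ^ 3 * (1/4 * 3 - 1) = - (c ^ 3 / 4)" by simp
      finally show ?thesis .
    qed
    ultimately show ?thesis by simp
  qed
  have b4: "cst (c ^ 3 / 2) * e2 ^ 2 \<sqsubseteq> cluster_term c 0 0 4 1 4"
  proof -
    have e14: "2 * e2 ^ 2 \<sqsubseteq> e1 ^ 4"
    proof -
      have "e1 ^ 4 - 2 * e2 ^ 2 = hsym 4 + 3 * (e2 * hsym 2)"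
      proof -
        have 2: "hsym 2 = e1 * e1 - e2" by (simp add: eval_nat_numeral)
        have "hsym 4 = e1 * (e1 * hsym 2 - e2 * e1) - e2 * hsym 2" by (simp add: eval_nat_numeral)
        then show ?thesis unfolding 2 by algebra
      qed
      also have "\<dots> \<in> schur_cone" by (intro schur_cone_add schur_cone_mult) (auto simp del: hsym.simps)
      finally show ?thesis by (simp add: schur_le_def)
    qed
    have "2 * e2 ^ 2 + 4 * (e2 * e1 ^ 3) \<sqsubseteq> e1 ^ 4 + 4 * (e2 * e1 ^ 3)"
      by (intro schur_le_add e14) auto
    also have "\<dots> \<sqsubseteq> (e1 + e2) ^ 4" using e1_e2_power[of 3] by (simp add: eval_nat_numeral)
    also have "\<dots> \<sqsubseteq> v ^ 4" by (intro schur_le_power vge) simp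
    finally have "cst (1/4) * (2 * e2 ^ 2 + 4 * (e2 * e1 ^ 3)) + - (cst (1/4) * (of_nat (3 + 1) * (e2 * e1 ^ 3)))
        \<sqsubseteq> cst (1/4) * v ^ 4 + sym_monomial 1 4"
    proof (intro schur_le_add schur_le_mult_left)
      have "deficit 1 4 \<sqsubseteq> cst (1/4) * (of_nat (3 + 1) * (e2 * e1 ^ 3))"
        by (rule deficit_le) auto
      from schur_le_add[OF this, of 0 "deficit 1 4 + sym_monomial 1 4"]
      show "- (cst (1/4) * (of_nat (3 + 1) * (e2 * e1 ^ 3))) \<sqsubseteq> sym_monomial 1 4"
        using deficit_sym_monomial[of 1 4] by (simp add: schur_le_def algebra_simps)
    qed auto
    moreover have "cst (1/4) * (2 * e2 ^ 2 + 4 * (e2 * e1 ^ 3)) + - (cst (1/4) * (of_nat (3 + 1) * (e2 * e1 ^ 3)))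
        = cst (1/2) * e2 ^ 2"
    proof -
      have "cst (1/4) * 2 = cst (1/2)" using cst_mult[of "1/4" 2] by simp
      then show ?thesis by (simp add: algebra_simps)
    qed
    ultimately have "cst (c ^ 4) * (cst (1/2) * e2 ^ 2) \<sqsubseteq> cluster_term c 0 0 4 1 4"
      unfolding br using assms by (intro schur_le_mult_left) auto
    moreover have "cst (c ^ 3 / 2) * e2 ^ 2 \<sqsubseteq> cst (c ^ 4 * (1/2)) * e2 ^ 2"
    proof (intro schur_le_cst e2sq)
      have "c ^ 3 \<le> c ^ 4" using assms by (intro power_increasing) auto
      then show "c ^ 3 / 2 \<le> c ^ 4 * (1/2)" by simp
    qed
    ultimately show ?thesis unfolding cst_mult[of "c ^ 4"] mult.assoc by (rule schur_le_trans[rotated])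
  qed
  have "of_nat (B choose 2) * (cst (c ^ 3 / 4) * e2 ^ 2) + of_nat (B choose 3) * (cst (- (c ^ 3 / 4)) * e2 ^ 2)
      + of_nat (B choose 4) * (cst (c ^ 3 / 2) * e2 ^ 2)
    \<sqsubseteq> of_nat (B choose 2) * cluster_term c 0 0 2 1 2 + of_nat (B choose 3) * cluster_term c 0 0 3 1 3
      + of_nat (B choose 4) * cluster_term c 0 0 4 1 4" (is "?l \<sqsubseteq> ?r")
    by (intro schur_le_add schur_le_mult_left b2 b3 b4) auto
  moreover have "?l = cst (real (B choose 2) * (c ^ 3 / 4) + real (B choose 3) * (- (c ^ 3 / 4))
      + real (B choose 4) * (c ^ 3 / 2)) * e2 ^ 2"
    unfolding cst_add cst_mult cst_of_nat by (simp only: distrib_right mult.assoc)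
  moreover have "\<dots> \<in> schur_cone"
  proof (intro schur_cone_mult schur_cone_cst e2sq)
    have "real (B choose 3) \<le> real (B choose 2) + 2 * real (B choose 4)"
      using choose_3_le[of B] by linarith
    then have "0 \<le> (c ^ 3 / 4) * (real (B choose 2) - real (B choose 3) + 2 * real (B choose 4))"
      using assms by (intro mult_nonneg_nonneg) auto
    then show "0 \<le> real (B choose 2) * (c ^ 3 / 4) + real (B choose 3) * (- (c ^ 3 / 4))
      + real (B choose 4) * (c ^ 3 / 2)" by (simp add: algebra_simps)
  qed
  ultimately show ?thesis using schur_le_cone[of ?l ?r] by simp
qed

text \<open>
  The weights of a single active vertex: \<open>B\<close> counts the ends of plain type and the double edges at
  the vertex, \<open>s\<close> the ends of special type.
\<close>
lemma cluster_single:
  assumes "c \<ge> 1"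
  shows "cst (1/4) * ((lin_p c * lin_q c) ^ B * special c ^ s)
     + (pv * qv ^ s * lin_q c ^ B + pv ^ s * qv * lin_p c ^ B) \<in> schur_cone"
proof -
  have "cst (1/4) * ((lin_p c * lin_q c) ^ B * special c ^ s) + (pv * qv ^ s * lin_q c ^ B + pv ^ s * qv * lin_p c ^ B)
      = (\<Sum>x\<le>B. of_nat (B choose x) * cluster_term c 0 s x 1 (s + x))" (is "_ = sum ?t _")
    using cluster_expand[of c 0 B 0 s 1 s] by (simp add: mult_ac)
  \<comment> \<open>The added summands vanish; they make sure that \<open>2\<close>, \<open>3\<close> and \<open>4\<close> are indices.\<close>
  also have "\<dots> = sum ?t {..B + 4}"
    by (rule sum.mono_neutral_left) (auto simp: binomial_eq_0)
  also have "\<dots> \<in> schur_cone"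
  proof (cases "s = 0")
    case False
    then show ?thesis
      using cluster_term_single[OF assms, of _ s] by (intro schur_cone_sum schur_cone_mult) (auto simp: add.commute)
  next
    case True
    have "sum ?t {..B + 4} = sum ?t ({..B + 4} - {2, 3, 4}) + sum ?t {2, 3, 4}"
      by (rule sum.subset_diff) auto
    moreover have "sum ?t ({..B + 4} - {2, 3, 4}) \<in> schur_cone"
      using cluster_term_single[OF assms, of _ s] True by (intro schur_cone_sum schur_cone_mult) auto
    moreover have "sum ?t {2, 3, 4} \<in> schur_cone"
      using cluster_term_234[OF assms, of B] True by (simp add: add.assoc)
    ultimately show ?thesis by auto
  qed
  finally show ?thesis .
qed

text \<open>
  The same for an alternating pattern with \<open>n1\<close> and \<open>n2\<close> vertices active in the first and in the
  second copy. Both numbers are positive, which keeps the exponents of \<open>p\<close> and \<open>q\<close> positive;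
  \<open>n1 + n2 \<le> Suc e\<close> is the bound for the number of edges of a connected graph.
\<close>
lemma cluster_many:
  assumes "c \<ge> 1" "n1 \<ge> 1" "n2 \<ge> 1" "n1 + n2 \<le> Suc e"
  shows "cst (1/4) * ((lin_p c * lin_q c) ^ (A + B + e) * special c ^ (s1 + s2))
     + (pv ^ (n1 + s2) * qv ^ (n2 + s1) * lin_q c ^ B * lin_p c ^ A
      + pv ^ (n2 + s1) * qv ^ (n1 + s2) * lin_p c ^ B * lin_q c ^ A) \<in> schur_cone"
proof -
  have "cluster_term c e (s1 + s2) (x + y) (n1 + s2 + y) (n2 + s1 + x) \<in> schur_cone" for x y
    by (rule cluster_term_several[where n = "n1 + n2 - 1"]) (use assms in auto)
  then show ?thesis
    unfolding cluster_expand[of c A B e "s1 + s2" "n1 + s2" "n2 + s1"]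
    by (intro schur_cone_sum schur_cone_mult schur_cone_of_nat)
qed

section \<open>Connected clusters and site percolation\<close>

text \<open>
  Edges are indices with two endpoints, so that subsets of the edge set and the removal of vertices
  need no further structure.
\<close>
locale multigraph =
  fixes x y :: "'e \<Rightarrow> 'v"
begin

definition adj :: "'e set \<Rightarrow> 'v \<Rightarrow> 'v \<Rightarrow> bool" where
  "adj I u w \<longleftrightarrow> (\<exists>i\<in>I. (x i = u \<and> y i = w) \<or> (x i = w \<and> y i = u))"

definition component :: "'e set \<Rightarrow> 'v \<Rightarrow> 'v set \<Rightarrow> 'v set" where
  "component I v D = {u. (v, u) \<in> {(a, b). a \<in> D \<and> b \<in> D \<and> adj I a b}\<^sup>*}"

definition boundary :: "'e set \<Rightarrow> 'v set \<Rightarrow> 'v set" where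
  "boundary I K = {u. u \<notin> K \<and> (\<exists>w\<in>K. adj I w u)}"

definition touching :: "'e set \<Rightarrow> 'v set \<Rightarrow> 'e set" where
  "touching I K = {i \<in> I. x i \<in> K \<or> y i \<in> K}"

definition inner :: "'e set \<Rightarrow> 'v set \<Rightarrow> 'e set" where
  "inner I K = {i \<in> I. x i \<in> K \<and> y i \<in> K}"

definition clusters :: "'e set \<Rightarrow> 'v set \<Rightarrow> 'v \<Rightarrow> 'v set set" where
  "clusters I U v = {K. K \<subseteq> U \<and> v \<in> K \<and> component I v K = K}"

lemma component_subset: "v \<in> D \<Longrightarrow> component I v D \<subseteq> D"
  unfolding component_def by (auto elim: rtranclE)

lemma self_in_component: "v \<in> component I v D"
  by (simp add: component_def)

lemma boundary_component: 
  assumes "v \<in> D"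
  shows "boundary I (component I v D) \<inter> D = {}"
proof -
  have "u \<in> component I v D" if "w \<in> component I v D" "adj I w u" "u \<in> D" for u w
  proof -
    have "w \<in> D" using that component_subset[OF assms, of I] by auto
    then show ?thesis using that unfolding component_def by (auto intro: rtrancl_into_rtrancl)
  qed
  then show ?thesis by (auto simp: boundary_def)
qed

lemma component_eqI:
  assumes "v \<in> K" "component I v K = K" "K \<subseteq> D" "boundary I K \<inter> D = {}"
  shows "component I v D = K"
proof
  show "K \<subseteq> component I v D"
  proof
    fix u assume "u \<in> K"
    then have "(v, u) \<in> {(a, b). a \<in> K \<and> b \<in> K \<and> adj I a b}\<^sup>*"
      using assms(2) by (auto simp: component_def)
    then have "(v, u) \<in> {(a, b). a \<in> D \<and> b \<in> D \<and> adj I a b}\<^sup>*"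
      by (rule rtrancl_mono[THEN subsetD, rotated]) (use assms(3) in auto)
    then show "u \<in> component I v D" by (simp add: component_def)
  qed
  show "component I v D \<subseteq> K"
  proof
    fix u assume "u \<in> component I v D"
    then have "(v, u) \<in> {(a, b). a \<in> D \<and> b \<in> D \<and> adj I a b}\<^sup>*" by (simp add: component_def)
    then show "u \<in> K"
      by (induction rule: rtrancl_induct) (use assms in \<open>auto simp: boundary_def\<close>)
  qed
qed

lemma component_component:
  assumes "v \<in> D"
  shows "component I v (component I v D) = component I v D"
proof
  show "component I v (component I v D) \<subseteq> component I v D"
    by (rule component_subset) (rule self_in_component)
  show "component I v D \<subseteq> component I v (component I v D)"
  proof
    fix u assume "u \<in> component I v D"
    then have "(v, u) \<in> {(a, b). a \<in> D \<and> b \<in> D \<and> adj I a b}\<^sup>*" by (simp add: component_def)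
    then show "u \<in> component I v (component I v D)"
    proof (induction rule: rtrancl_induct)
      case base
      show ?case by (rule self_in_component)
    next
      case (step w u)
      have "w \<in> component I v D" "u \<in> component I v D"
        using step(1,2) by (auto simp: component_def intro: rtrancl_into_rtrancl)
      then show ?case using step(2,3) unfolding component_def[of I v "component I v D"]
        by (auto intro: rtrancl_into_rtrancl)
    qed
  qed
qed

lemma component_in_clusters:
  assumes "v \<in> D" "D \<subseteq> U"
  shows "component I v D \<in> clusters I U v"
  using assms component_subset[OF assms(1), of I] component_component[OF assms(1), of I] self_in_component[of v I D]
  by (auto simp: clusters_def)

lemma component_eq_iff:
  assumes "K \<in> clusters I U v"
  shows "v \<in> D \<and> component I v D = K \<longleftrightarrow> K \<subseteq> D \<and> boundary I K \<inter> D = {}"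
  using assms component_eqI[of v K I D] component_subset[of v D I] boundary_component[of v D I]
  by (auto simp: clusters_def)

text \<open>A connected set can be grown from \<open>v\<close> by one vertex and at least one new inner edge at a time.\<close>
lemma card_cluster_le:
  assumes "finite I" "finite K" "v \<in> K" "component I v K = K"
  shows "card K \<le> card (inner I K) + 1"
proof -
  have grow: "card K \<le> card (inner I K) + 1"
    if "C \<subseteq> K" "v \<in> C" "card C \<le> card (inner I C) + 1" for C
    using that
  proof (induction "card (K - C)" arbitrary: C rule: less_induct)
    case less
    show ?case
    proof (cases "C = K")
      case True
      then show ?thesis using less by simp
    next
      case False
      obtain a b where ab: "a \<in> C" "b \<in> K - C" "adj I a b"
      proof -
        have "\<not> boundary I C \<inter> K = {}"
        proof
          assume *: "boundary I C \<inter> K = {}"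
          have "u \<in> C" if "u \<in> component I v K" for u
          proof -
            have "(v, u) \<in> {(a, b). a \<in> K \<and> b \<in> K \<and> adj I a b}\<^sup>*" using that by (simp add: component_def)
            then show ?thesis
              by (induction rule: rtrancl_induct) (use * less.prems in \<open>auto simp: boundary_def\<close>)
          qed
          then show False using assms(4) False less.prems by auto
        qed
        then show thesis using that by (auto simp: boundary_def)
      qed
      then obtain i where i: "i \<in> I" "(x i = a \<and> y i = b) \<or> (x i = b \<and> y i = a)"
        by (auto simp: adj_def)
      have fin: "finite (inner I D)" for D using assms(1) by (auto simp: inner_def)
      have "insert i (inner I C) \<subseteq> inner I (insert b C)" "i \<notin> inner I C"
        using i ab by (auto simp: inner_def)
      then have "card (inner I C) + 1 \<le> card (inner I (insert b C))"
        using card_mono[OF fin, of "insert i (inner I C)" "insert b C"] fin[of C] by simp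
      moreover have "card (insert b C) = card C + 1"
        using ab less.prems assms(2) finite_subset by (subst card_insert_disjoint) auto
      moreover have "card (K - insert b C) < card (K - C)"
        using ab assms(2) by (intro psubset_card_mono) auto
      ultimately show ?thesis using less.prems ab by (intro less.hyps[of "insert b C"]) auto
    qed
  qed
  show ?thesis by (rule grow[of "{v}"]) (use assms in auto)
qed

lemma card_boundary_le:
  assumes "finite I"
  shows "card (boundary I K) \<le> card (touching I K - inner I K)"
proof -
  have "boundary I K \<subseteq> (\<lambda>i. if x i \<in> K then y i else x i) ` (touching I K - inner I K)"
    by (force simp: boundary_def adj_def touching_def inner_def)
  moreover have "finite (touching I K - inner I K)" using assms by (auto simp: touching_def)
  ultimately show ?thesis using surj_card_le by blast
qed

lemma sum_Pow_powers:
  fixes p q :: real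
  assumes "finite A"
  shows "(\<Sum>C\<in>Pow A. p ^ card C * q ^ card (A - C)) = (p + q) ^ card A"
  using prod_add[OF assms, of "\<lambda>_. p" "\<lambda>_. q"] by simp

text \<open>
  Occupy \<open>v\<close>, and every other vertex of \<open>U\<close> independently with probability \<open>p\<close>. The summand at \<open>K\<close> is
  the probability that the component of \<open>v\<close> is \<open>K\<close>.
\<close>
lemma percolation:
  fixes p :: real
  assumes "finite U" "v \<in> U" "0 \<le> p" "p \<le> 1"
  shows "(\<Sum>K\<in>clusters I U v. p ^ (card K - 1) * (1 - p) ^ card (boundary I K \<inter> U)) \<le> 1"
proof -
  define W where "W = U - {v}"
  have finW: "finite W" using assms by (simp add: W_def)
  define weight where "weight C = p ^ card C * (1 - p) ^ card (W - C)" for C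
  define \<C> where "\<C> K = {C \<in> Pow W. component I v (insert v C) = K}" for K
  have finC: "finite (clusters I U v)"
    by (rule finite_subset[of _ "Pow U"]) (use assms(1) in \<open>auto simp: clusters_def\<close>)
  have "(\<Sum>C\<in>\<C> K. weight C) = p ^ (card K - 1) * (1 - p) ^ card (boundary I K \<inter> U)"
    if K: "K \<in> clusters I U v" for K
  proof -
    have KU: "K \<subseteq> U" "v \<in> K" using K by (auto simp: clusters_def)
    define R where "R = W - K - boundary I K"
    have vb: "v \<notin> boundary I K" using KU by (auto simp: boundary_def)
    have CK: "\<C> K = {C \<in> Pow W. K - {v} \<subseteq> C \<and> boundary I K \<inter> C = {}}"
    proof (rule set_eqI)
      fix C
      have "component I v (insert v C) = K \<longleftrightarrow> K \<subseteq> insert v C \<and> boundary I K \<inter> insert v C = {}"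
        using component_eq_iff[OF K, of "insert v C"] by simp
      also have "\<dots> \<longleftrightarrow> K - {v} \<subseteq> C \<and> boundary I K \<inter> C = {}" using vb by auto
      finally show "C \<in> \<C> K \<longleftrightarrow> C \<in> {C \<in> Pow W. K - {v} \<subseteq> C \<and> boundary I K \<inter> C = {}}"
        by (simp add: \<C>_def)
    qed
    have fin: "finite K" "finite R" "finite (boundary I K \<inter> U)"
      using KU assms(1) finW by (auto simp: R_def intro: finite_subset)
    have "(\<Sum>C\<in>\<C> K. weight C) = (\<Sum>C'\<in>Pow R. weight ((K - {v}) \<union> C'))"
    proof (rule sum.reindex_bij_witness[of _ "\<lambda>C'. (K - {v}) \<union> C'" "\<lambda>C. C - K"])
      fix C assume C: "C \<in> \<C> K"
      show *: "(K - {v}) \<union> (C - K) = C" using C KU by (auto simp: CK W_def)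
      show "C - K \<in> Pow R" using C by (auto simp: CK R_def)
      show "weight ((K - {v}) \<union> (C - K)) = weight C" unfolding * ..
    next
      fix C' assume C': "C' \<in> Pow R"
      show "(K - {v}) \<union> C' - K = C'" using C' by (auto simp: R_def)
      show "(K - {v}) \<union> C' \<in> \<C> K"
        using C' KU by (auto simp: CK R_def W_def boundary_def)
    qed
    also have "\<dots> = (\<Sum>C'\<in>Pow R. p ^ (card K - 1) * (1 - p) ^ card (boundary I K \<inter> U)
        * (p ^ card C' * (1 - p) ^ card (R - C')))"
    proof (rule sum.cong)
      fix C' assume "C' \<in> Pow R"
      then have C': "C' \<subseteq> R" by simp
      have 1: "card ((K - {v}) \<union> C') = (card K - 1) + card C'"
        using C' fin KU finite_subset[OF C'] by (subst card_Un_disjoint) (auto simp: R_def)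
      have "W - ((K - {v}) \<union> C') = (boundary I K \<inter> U) \<union> (R - C')"
        using C' KU vb by (auto simp: R_def W_def boundary_def)
      moreover have "card \<dots> = card (boundary I K \<inter> U) + card (R - C')"
        using fin by (intro card_Un_disjoint) (auto simp: R_def)
      ultimately have 2: "card (W - ((K - {v}) \<union> C')) = card (boundary I K \<inter> U) + card (R - C')"
        by simp
      show "weight ((K - {v}) \<union> C') = p ^ (card K - 1) * (1 - p) ^ card (boundary I K \<inter> U)
        * (p ^ card C' * (1 - p) ^ card (R - C'))"
        unfolding weight_def 1 2 by (simp add: power_add)
    qed simp
    also have "\<dots> = p ^ (card K - 1) * (1 - p) ^ card (boundary I K \<inter> U)"
      using sum_Pow_powers[OF fin(2), of p "1 - p"] by (simp flip: sum_distrib_left)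
    finally show ?thesis .
  qed
  then have "(\<Sum>K\<in>clusters I U v. p ^ (card K - 1) * (1 - p) ^ card (boundary I K \<inter> U))
      = (\<Sum>K\<in>clusters I U v. \<Sum>C\<in>\<C> K. weight C)" by simp
  also have "\<dots> = (\<Sum>C\<in>Pow W. weight C)"
    unfolding \<C>_def
  proof (rule sum.group)
    show "(\<lambda>C. component I v (insert v C)) ` Pow W \<subseteq> clusters I U v"
      using assms(2) by (auto simp: W_def intro!: component_in_clusters)
  qed (use finW finC in auto)
  also have "\<dots> = 1"
    using sum_Pow_powers[OF finW, of p "1 - p"] by (simp add: weight_def)
  finally show ?thesis by simp
qed

end

section \<open>Pairs of configurations with a fixed set of double edges\<close>

text \<open>The copies among two subsets of the vertex set that contain a given vertex.\<close>
datatype pair_state = Neither | OnlyA | OnlyB | Both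

instance pair_state :: finite
proof
  have "(UNIV :: pair_state set) = {Neither, OnlyA, OnlyB, Both}" using pair_state.exhaust by auto
  then show "finite (UNIV :: pair_state set)" by (metis finite.emptyI finite.insertI)
qed

fun center_factor :: "pair_state \<Rightarrow> bipoly" where
  "center_factor Neither = 1" | "center_factor OnlyA = pv" | "center_factor OnlyB = qv" | "center_factor Both = pv * qv"
text \<open>
  The factor of one end of an edge whose special vertices are not used at this end (\<open>plain_end\<close>) or
  used here in exactly one copy (\<open>special_end\<close>), depending on the state of the vertex. A center in
  a copy excludes the whole clique there.
\<close>
fun plain_end :: "real \<Rightarrow> pair_state \<Rightarrow> bipoly" where
  "plain_end c Neither = lin_p c * lin_q c" | "plain_end c OnlyA = lin_q c" | "plain_end c OnlyB = lin_p c" | "plain_end c Both = 1"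

fun special_end :: "real \<Rightarrow> pair_state \<Rightarrow> bipoly" where
  "special_end c Neither = special c" | "special_end c OnlyA = qv" | "special_end c OnlyB = pv" | "special_end c Both = 0"

definition vertex_weight :: "real \<Rightarrow> nat \<Rightarrow> nat \<Rightarrow> pair_state \<Rightarrow> bipoly" where
  "vertex_weight c g s t = center_factor t * plain_end c t ^ g * special_end c t ^ s"

text \<open>
  Each copy uses a special vertex of the edge, at an end whose center is absent from this copy. The
  four placements give \<open>4\<close>, \<open>2\<close> or \<open>1\<close> terms, and none if a copy has its center at both ends.
\<close>
fun double_edge :: "real \<Rightarrow> pair_state \<Rightarrow> pair_state \<Rightarrow> bipoly" where
  "double_edge c Neither Neither = 4 * e2 * (lin_p c * lin_q c)"
| "double_edge c Neither OnlyA = 2 * e2 * lin_q c" | "double_edge c OnlyA Neither = 2 * e2 * lin_q c"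
| "double_edge c Neither OnlyB = 2 * e2 * lin_p c" | "double_edge c OnlyB Neither = 2 * e2 * lin_p c"
| "double_edge c Neither Both = e2" | "double_edge c Both Neither = e2"
| "double_edge c OnlyA OnlyB = e2" | "double_edge c OnlyB OnlyA = e2"
| "double_edge c OnlyA OnlyA = 0" | "double_edge c OnlyB OnlyB = 0"
| "double_edge c OnlyA Both = 0" | "double_edge c Both OnlyA = 0"
| "double_edge c OnlyB Both = 0" | "double_edge c Both OnlyB = 0" | "double_edge c Both Both = 0"

lemma double_edge_commute: "double_edge c t u = double_edge c u t"
  by (cases t; cases u) simp_all

fun swap_state :: "pair_state \<Rightarrow> pair_state" where
  "swap_state Neither = Neither" | "swap_state OnlyA = OnlyB"
| "swap_state OnlyB = OnlyA" | "swap_state Both = Both"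

lemma swap_state_eq_iff [simp]:
  "swap_state t = Neither \<longleftrightarrow> t = Neither" "swap_state t = OnlyA \<longleftrightarrow> t = OnlyB"
  "swap_state t = OnlyB \<longleftrightarrow> t = OnlyA" "swap_state t = Both \<longleftrightarrow> t = Both"
  by (cases t; simp)+

lemma swap_state_inject [simp]: "swap_state t = swap_state u \<longleftrightarrow> t = u"
  by (cases t; cases u; simp)

locale two_copies = multigraph x y for x y :: "'e \<Rightarrow> 'v" +
  fixes c :: real and g s :: "'v \<Rightarrow> nat"
  assumes c: "c \<ge> 1"
begin

text \<open>
  The vertex \<open>v\<close> carries \<open>g v\<close> plain and \<open>s v\<close> special ends of edges already expanded; the edges in
  \<open>I\<close> are double.
\<close>
definition weight :: "'v set \<Rightarrow> 'e set \<Rightarrow> ('v \<Rightarrow> pair_state) \<Rightarrow> bipoly" where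
  "weight V I \<tau> = (\<Prod>v\<in>V. vertex_weight c (g v) (s v) (\<tau> v)) * (\<Prod>i\<in>I. double_edge c (\<tau> (x i)) (\<tau> (y i)))"

definition configs :: "'v set \<Rightarrow> ('v \<Rightarrow> pair_state) set" where
  "configs U = {\<tau>. \<forall>v. v \<notin> U \<longrightarrow> \<tau> v = Neither}"

text \<open>
  The vertices outside \<open>U\<close> stay neutral but keep their weight, so that the sums for different \<open>U\<close>
  can be compared.
\<close>
definition config_sum :: "'v set \<Rightarrow> 'e set \<Rightarrow> 'v set \<Rightarrow> bipoly" where
  "config_sum V I U = (\<Sum>\<tau>\<in>configs U. weight V I \<tau>)"

abbreviation neutral :: "'v \<Rightarrow> pair_state" where "neutral \<equiv> \<lambda>_. Neither"

definition supp :: "('v \<Rightarrow> pair_state) \<Rightarrow> 'v set" where "supp \<tau> = {v. \<tau> v \<noteq> Neither}"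

lemma finite_configs [simp]: "finite U \<Longrightarrow> finite (configs U)"
  using finite_set_of_finite_funs[of U "UNIV :: pair_state set" Neither] by (simp add: configs_def)

lemma configs_empty [simp]: "configs {} = {neutral}"
  by (auto simp: configs_def)

lemma supp_configs: "\<tau> \<in> configs U \<longleftrightarrow> supp \<tau> \<subseteq> U"
  by (auto simp: configs_def supp_def)

definition merge :: "'v set \<Rightarrow> ('v \<Rightarrow> pair_state) \<Rightarrow> ('v \<Rightarrow> pair_state) \<Rightarrow> 'v \<Rightarrow> pair_state" where
  "merge K \<sigma> \<tau> = (\<lambda>u. if u \<in> K then \<sigma> u else \<tau> u)"

text \<open>
  A cluster is separated from the other active vertices by its neutral boundary, hence the weight
  factors. The edges to the boundary are counted with the cluster.
\<close>
lemma weight_merge: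
  assumes "finite V" "finite I" "K \<subseteq> V" "\<sigma> \<in> configs K" "\<tau> \<in> configs (U - K - boundary I K)"
  shows "weight V I (merge K \<sigma> \<tau>)
    = weight K (touching I K) \<sigma> * weight (V - K) (I - touching I K) \<tau>"
proof -
  have sig: "\<sigma> u = Neither" if "u \<notin> K" for u using assms that by (auto simp: configs_def)
  have tau: "\<tau> u = Neither" if "u \<in> boundary I K" for u using assms that by (auto simp: configs_def)
  have 1: "(\<Prod>v\<in>V. vertex_weight c (g v) (s v) (merge K \<sigma> \<tau> v))
      = (\<Prod>v\<in>K. vertex_weight c (g v) (s v) (\<sigma> v)) * (\<Prod>v\<in>V - K. vertex_weight c (g v) (s v) (\<tau> v))"
    using assms by (subst prod.subset_diff[of K]) (auto simp: merge_def mult.commute)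
  have "double_edge c (merge K \<sigma> \<tau> (x i)) (merge K \<sigma> \<tau> (y i)) = double_edge c (\<sigma> (x i)) (\<sigma> (y i))"
    if "i \<in> touching I K" for i
  proof -
    have "merge K \<sigma> \<tau> (x i) = \<sigma> (x i)"
      using that sig[of "x i"] tau[of "x i"]
      by (auto simp: merge_def touching_def boundary_def adj_def)
    moreover have "merge K \<sigma> \<tau> (y i) = \<sigma> (y i)"
      using that sig[of "y i"] tau[of "y i"]
      by (auto simp: merge_def touching_def boundary_def adj_def)
    ultimately show ?thesis by simp
  qed
  moreover have "double_edge c (merge K \<sigma> \<tau> (x i)) (merge K \<sigma> \<tau> (y i)) = double_edge c (\<tau> (x i)) (\<tau> (y i))"
    if "i \<in> I - touching I K" for i
    using that by (auto simp: merge_def touching_def)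
  moreover have "touching I K \<subseteq> I" by (auto simp: touching_def)
  ultimately have 2: "(\<Prod>i\<in>I. double_edge c (merge K \<sigma> \<tau> (x i)) (merge K \<sigma> \<tau> (y i)))
      = (\<Prod>i\<in>touching I K. double_edge c (\<sigma> (x i)) (\<sigma> (y i)))
        * (\<Prod>i\<in>I - touching I K. double_edge c (\<tau> (x i)) (\<tau> (y i)))"
    using assms by (subst prod.subset_diff[of "touching I K"]) (auto simp: mult.commute)
  show ?thesis unfolding weight_def 1 2 by (simp only: mult_ac)
qed

text \<open>The special case of a neutral cluster, which provides the term to compare with.\<close>
lemma config_sum_off_cluster:
  assumes "finite V" "finite I" "K \<subseteq> V"
  shows "config_sum V I (U - K - boundary I K)
    = weight K (touching I K) neutral * config_sum (V - K) (I - touching I K) (U - K - boundary I K)"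
  unfolding config_sum_def sum_distrib_left
proof (rule sum.cong)
  fix \<tau> assume *: "\<tau> \<in> configs (U - K - boundary I K)"
  have "merge K neutral \<tau> = \<tau>" using * by (auto simp: merge_def configs_def)
  then show "weight V I \<tau> = weight K (touching I K) neutral * weight (V - K) (I - touching I K) \<tau>"
    using weight_merge[OF assms _ *, of neutral] by (simp add: configs_def)
qed simp

definition cluster_sum :: "'e set \<Rightarrow> 'v set \<Rightarrow> bipoly" where
  "cluster_sum I K = (\<Sum>\<sigma>\<in>{\<sigma>. supp \<sigma> = K}. weight K (touching I K) \<sigma>)"

text \<open>Sorting the configurations by the component of \<open>v\<close> among the active vertices.\<close>
lemma config_sum_expand:
  assumes "finite V" "finite I" "U \<subseteq> V" "v \<in> U"
  shows "config_sum V I U = config_sum V I (U - {v})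
    + (\<Sum>K\<in>clusters I U v. cluster_sum I K * config_sum (V - K) (I - touching I K) (U - K - boundary I K))"
proof -
  have finU: "finite U" using assms finite_subset by blast
  have finC: "finite (clusters I U v)"
    by (rule finite_subset[of _ "Pow U"]) (use finU in \<open>auto simp: clusters_def\<close>)
  define N where "N = {\<tau> \<in> configs U. \<tau> v \<noteq> Neither}"
  have "configs U = configs (U - {v}) \<union> N" "configs (U - {v}) \<inter> N = {}"
    using assms(4) by (auto simp: configs_def N_def)
  then have "config_sum V I U = config_sum V I (U - {v}) + (\<Sum>\<tau>\<in>N. weight V I \<tau>)"
    unfolding config_sum_def using finU finite_configs[OF finU]
    by (simp add: sum.union_disjoint)
  also have "(\<Sum>\<tau>\<in>N. weight V I \<tau>)
      = (\<Sum>K\<in>clusters I U v. \<Sum>\<tau>\<in>{\<tau> \<in> N. component I v (supp \<tau>) = K}. weight V I \<tau>)"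
  proof (rule sum.group[symmetric])
    show "(\<lambda>\<tau>. component I v (supp \<tau>)) ` N \<subseteq> clusters I U v"
      by (auto simp: N_def supp_configs intro!: component_in_clusters) (simp add: supp_def)
  qed (use finC finite_configs[OF finU] in \<open>auto simp: N_def\<close>)
  also have "\<dots> = (\<Sum>K\<in>clusters I U v.
      cluster_sum I K * config_sum (V - K) (I - touching I K) (U - K - boundary I K))"
  proof (rule sum.cong)
    fix K assume K: "K \<in> clusters I U v"
    then have KU: "K \<subseteq> U" by (auto simp: clusters_def)
    let ?S = "{\<sigma>. supp \<sigma> = K}" and ?R = "configs (U - K - boundary I K)"
    have NK: "{\<tau> \<in> N. component I v (supp \<tau>) = K}
        = {\<tau>. supp \<tau> \<subseteq> U \<and> K \<subseteq> supp \<tau> \<and> boundary I K \<inter> supp \<tau> = {}}" (is "?L = ?M")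
    proof (rule set_eqI)
      fix \<tau>
      show "\<tau> \<in> ?L \<longleftrightarrow> \<tau> \<in> ?M"
        using component_eq_iff[OF K, of "supp \<tau>"] by (auto simp: N_def supp_configs) (auto simp: supp_def)
    qed
    have "(\<Sum>\<tau>\<in>?M. weight V I \<tau>) = (\<Sum>(\<sigma>, \<tau>)\<in>?S \<times> ?R. weight V I (merge K \<sigma> \<tau>))"
    proof (rule sum.reindex_bij_witness[of _ "\<lambda>(\<sigma>, \<tau>). merge K \<sigma> \<tau>"
          "\<lambda>\<tau>. (merge K \<tau> neutral, merge K neutral \<tau>)"])
      fix \<tau> assume \<tau>: "\<tau> \<in> ?M"
      show "(case (merge K \<tau> neutral, merge K neutral \<tau>) of (\<sigma>, \<tau>) \<Rightarrow> merge K \<sigma> \<tau>) = \<tau>"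
        by (auto simp: merge_def)
      then show "(case (merge K \<tau> neutral, merge K neutral \<tau>) of (\<sigma>, \<tau>) \<Rightarrow> weight V I (merge K \<sigma> \<tau>)) = weight V I \<tau>"
        by simp
      have "supp (merge K \<tau> neutral) = K" using \<tau> by (auto simp: merge_def supp_def)
      moreover have "supp (merge K neutral \<tau>) \<subseteq> U - K - boundary I K"
        using \<tau> by (auto simp: merge_def supp_def split: if_splits)
      ultimately show "(merge K \<tau> neutral, merge K neutral \<tau>) \<in> ?S \<times> ?R" by (simp add: supp_configs)
    next
      fix st assume "st \<in> ?S \<times> ?R"
      then obtain \<sigma> \<tau> where st: "st = (\<sigma>, \<tau>)" "supp \<sigma> = K" "supp \<tau> \<subseteq> U - K - boundary I K"
        by (cases st) (auto simp: supp_configs)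
      have out: "\<sigma> u = Neither" if "u \<notin> K" for u using st that by (auto simp: supp_def)
      have out': "\<tau> u = Neither" if "u \<in> K" for u using st that by (auto simp: supp_def)
      show "(merge K (case st of (\<sigma>, \<tau>) \<Rightarrow> merge K \<sigma> \<tau>) neutral, merge K neutral (case st of (\<sigma>, \<tau>) \<Rightarrow> merge K \<sigma> \<tau>)) = st"
        using out out' by (auto simp: st merge_def)
      have "supp (merge K \<sigma> \<tau>) = K \<union> supp \<tau>"
        using st out' by (auto simp: merge_def supp_def)
      then show "(case st of (\<sigma>, \<tau>) \<Rightarrow> merge K \<sigma> \<tau>) \<in> ?M"
        using st KU by (auto simp: boundary_def)
    qed
    also have "\<dots> = (\<Sum>(\<sigma>, \<tau>)\<in>?S \<times> ?R.
        weight K (touching I K) \<sigma> * weight (V - K) (I - touching I K) \<tau>)"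
      by (rule sum.cong, simp, clarify, rule weight_merge)
        (use assms KU in \<open>auto simp: supp_configs\<close>)
    also have "\<dots> = cluster_sum I K * config_sum (V - K) (I - touching I K) (U - K - boundary I K)"
      unfolding cluster_sum_def config_sum_def by (rule sum_product[symmetric, unfolded sum.cartesian_product])
    finally show "(\<Sum>\<tau>\<in>{\<tau> \<in> N. component I v (supp \<tau>) = K}. weight V I \<tau>)
        = cluster_sum I K * config_sum (V - K) (I - touching I K) (U - K - boundary I K)"
      unfolding NK .
  qed simp
  finally show ?thesis .
qed

lemma weight_base_cone: "weight V I neutral \<in> schur_cone"
proof -
  have "vertex_weight c n m Neither \<in> schur_cone" for n m
    using c by (auto simp: vertex_weight_def intro!: schur_cone_mult schur_cone_power lin_p_lin_q_cone special_cone)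
  moreover have "4 * e2 * (lin_p c * lin_q c) \<in> schur_cone"
    using c by (intro schur_cone_mult[of "4 * e2"] lin_p_lin_q_cone) auto
  ultimately show ?thesis unfolding weight_def by (intro schur_cone_mult schur_cone_prod) auto
qed

text \<open>
  The multiple of the neutral weight spent on a cluster. A double edge has \<open>4\<close> placements in the
  neutral state, but one inside an alternating pattern and two on its boundary.
\<close>
definition cluster_loss :: "'e set \<Rightarrow> 'v set \<Rightarrow> real" where
  "cluster_loss I K = 1/4 * (1/4) ^ card (inner I K) * (1/2) ^ card (touching I K - inner I K)"

definition signing :: "'e set \<Rightarrow> 'v set \<Rightarrow> ('v \<Rightarrow> pair_state) \<Rightarrow> bool" where
  "signing I K \<sigma> \<longleftrightarrow> (\<forall>u\<in>K. \<sigma> u = OnlyA \<or> \<sigma> u = OnlyB) \<and> (\<forall>u. u \<notin> K \<longrightarrow> \<sigma> u = Neither)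
     \<and> (\<forall>i\<in>inner I K. \<sigma> (x i) \<noteq> \<sigma> (y i))"

lemma signing_swap: "signing I K \<sigma> \<Longrightarrow> signing I K (swap_state \<circ> \<sigma>)"
  unfolding signing_def by auto

lemma weight_signing:
  assumes "finite K" "finite I" "signing I K \<sigma>"
  defines "K1 \<equiv> {u \<in> K. \<sigma> u = OnlyA}" and "K2 \<equiv> {u \<in> K. \<sigma> u = OnlyB}"
    and "F1 \<equiv> {i \<in> touching I K - inner I K. \<sigma> (x i) = OnlyA \<or> \<sigma> (y i) = OnlyA}"
    and "F2 \<equiv> {i \<in> touching I K - inner I K. \<sigma> (x i) = OnlyB \<or> \<sigma> (y i) = OnlyB}"
  shows "weight K (touching I K) \<sigma>
    = e2 ^ card (touching I K) * 2 ^ card (touching I K - inner I K) *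
      (pv ^ (card K1 + sum s K2) * qv ^ (card K2 + sum s K1)
       * lin_q c ^ (sum g K1 + card F1) * lin_p c ^ (sum g K2 + card F2))" (is ?A)
   and "weight K (touching I K) neutral
    = 4 ^ card (touching I K) * e2 ^ card (touching I K) *
      ((lin_p c * lin_q c) ^ (sum g K1 + card F1 + (sum g K2 + card F2) + card (inner I K)) * special c ^ (sum s K1 + sum s K2))" (is ?B)
   and "card (touching I K - inner I K) = card F1 + card F2" (is ?C)
   and "card K = card K1 + card K2" (is ?D)
proof -
  have sg: "\<sigma> u = OnlyA \<or> \<sigma> u = OnlyB" if "u \<in> K" for u using assms that by (auto simp: signing_def)
  have out: "\<sigma> u = Neither" if "u \<notin> K" for u using assms that by (auto simp: signing_def)
  have alt: "\<sigma> (x i) \<noteq> \<sigma> (y i)" if "i \<in> inner I K" for i using assms that by (auto simp: signing_def)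
  have K: "K = K1 \<union> K2" "K1 \<inter> K2 = {}" "finite K1" "finite K2"
    using sg assms(1) by (auto simp: K1_def K2_def)
  have F: "touching I K - inner I K = F1 \<union> F2" "F1 \<inter> F2 = {}" "finite F1" "finite F2"
    using sg out assms(2) by (auto simp: F1_def F2_def touching_def inner_def)
  have I: "touching I K = inner I K \<union> (F1 \<union> F2)" "inner I K \<inter> (F1 \<union> F2) = {}" "finite (inner I K)"
    using assms(2) F by (auto simp: touching_def inner_def)
  show C: ?C unfolding F(1) using F by (simp add: card_Un_disjoint)
  show ?D using K card_Un_disjoint[of K1 K2] by simp
  have ct: "card (touching I K) = card (inner I K) + (card F1 + card F2)"
    using I F by (simp add: card_Un_disjoint)
  have v1: "(\<Prod>v\<in>K1. vertex_weight c (g v) (s v) (\<sigma> v)) = pv ^ card K1 * lin_q c ^ sum g K1 * qv ^ sum s K1"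
  proof -
    have "(\<Prod>v\<in>K1. vertex_weight c (g v) (s v) (\<sigma> v)) = (\<Prod>v\<in>K1. pv * lin_q c ^ g v * qv ^ s v)"
      by (rule prod.cong) (auto simp: K1_def vertex_weight_def)
    then show ?thesis by (simp add: prod.distrib power_sum)
  qed
  have v2: "(\<Prod>v\<in>K2. vertex_weight c (g v) (s v) (\<sigma> v)) = qv ^ card K2 * lin_p c ^ sum g K2 * pv ^ sum s K2"
  proof -
    have "(\<Prod>v\<in>K2. vertex_weight c (g v) (s v) (\<sigma> v)) = (\<Prod>v\<in>K2. qv * lin_p c ^ g v * pv ^ s v)"
      by (rule prod.cong) (auto simp: K2_def vertex_weight_def)
    then show ?thesis by (simp add: prod.distrib power_sum)
  qed
  have i0: "(\<Prod>i\<in>inner I K. double_edge c (\<sigma> (x i)) (\<sigma> (y i))) = e2 ^ card (inner I K)"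
  proof -
    have "double_edge c (\<sigma> (x i)) (\<sigma> (y i)) = e2" if "i \<in> inner I K" for i
      using sg[of "x i"] sg[of "y i"] alt[OF that] that by (auto simp: inner_def)
    then show ?thesis by simp
  qed
  have i1: "(\<Prod>i\<in>F1. double_edge c (\<sigma> (x i)) (\<sigma> (y i))) = (2 * e2 * lin_q c) ^ card F1"
  proof -
    have "double_edge c (\<sigma> (x i)) (\<sigma> (y i)) = 2 * e2 * lin_q c" if "i \<in> F1" for i
      using out[of "x i"] out[of "y i"] that by (auto simp: F1_def inner_def touching_def)
    then show ?thesis by simp
  qed
  have i2: "(\<Prod>i\<in>F2. double_edge c (\<sigma> (x i)) (\<sigma> (y i))) = (2 * e2 * lin_p c) ^ card F2"
  proof -
    have "double_edge c (\<sigma> (x i)) (\<sigma> (y i)) = 2 * e2 * lin_p c" if "i \<in> F2" for i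
      using out[of "x i"] out[of "y i"] that by (auto simp: F2_def inner_def touching_def)
    then show ?thesis by simp
  qed
  have "weight K (touching I K) \<sigma>
     = ((pv ^ card K1 * lin_q c ^ sum g K1 * qv ^ sum s K1) * (qv ^ card K2 * lin_p c ^ sum g K2 * pv ^ sum s K2))
       * (e2 ^ card (inner I K) * ((2 * e2 * lin_q c) ^ card F1 * (2 * e2 * lin_p c) ^ card F2))"
  proof -
    have "(\<Prod>v\<in>K. vertex_weight c (g v) (s v) (\<sigma> v))
      = (\<Prod>v\<in>K1. vertex_weight c (g v) (s v) (\<sigma> v)) * (\<Prod>v\<in>K2. vertex_weight c (g v) (s v) (\<sigma> v))"
      using prod.union_disjoint[OF K(3,4,2), of "\<lambda>v. vertex_weight c (g v) (s v) (\<sigma> v)"] K(1) by simp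
    moreover have "(\<Prod>i\<in>touching I K. double_edge c (\<sigma> (x i)) (\<sigma> (y i)))
      = (\<Prod>i\<in>inner I K. double_edge c (\<sigma> (x i)) (\<sigma> (y i)))
        * ((\<Prod>i\<in>F1. double_edge c (\<sigma> (x i)) (\<sigma> (y i))) * (\<Prod>i\<in>F2. double_edge c (\<sigma> (x i)) (\<sigma> (y i))))"
      unfolding I(1) using I(2,3) F by (simp add: prod.union_disjoint)
    ultimately show ?thesis unfolding weight_def by (simp only: v1 v2 i0 i1 i2)
  qed
  then show ?A unfolding ct C by (simp add: power_add power_mult_distrib mult_ac)
  have "weight K (touching I K) neutral = ((lin_p c * lin_q c) ^ sum g K * special c ^ sum s K)
      * (4 * e2 * (lin_p c * lin_q c)) ^ card (touching I K)"
    by (simp add: weight_def vertex_weight_def prod.distrib power_sum)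
  moreover have "sum g K = sum g K1 + sum g K2" "sum s K = sum s K1 + sum s K2"
    using K sum.union_disjoint[of K1 K2] by simp_all
  ultimately show ?B unfolding ct by (simp add: power_add power_mult_distrib mult_ac)
qed

text \<open>
  After the powers of \<open>e2\<close> and \<open>2\<close> have been taken out, this is \<open>cluster_single\<close> or \<open>cluster_many\<close>.
\<close>
lemma signing_positive:
  assumes "finite K" "finite I" "signing I K \<sigma>" "v \<in> K" "component I v K = K"
  shows "cst (cluster_loss I K) * weight K (touching I K) neutral
    + (weight K (touching I K) \<sigma> + weight K (touching I K) (swap_state \<circ> \<sigma>)) \<in> schur_cone"
proof -
  define K1 K2 where "K1 = {u \<in> K. \<sigma> u = OnlyA}" and "K2 = {u \<in> K. \<sigma> u = OnlyB}"
  define F1 where "F1 = {i \<in> touching I K - inner I K. \<sigma> (x i) = OnlyA \<or> \<sigma> (y i) = OnlyA}"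
  define F2 where "F2 = {i \<in> touching I K - inner I K. \<sigma> (x i) = OnlyB \<or> \<sigma> (y i) = OnlyB}"
  note w = weight_signing[OF assms(1-3), folded K1_def K2_def F1_def F2_def]
  note w' = weight_signing[OF assms(1,2) signing_swap[OF assms(3)], unfolded o_apply swap_state_eq_iff, folded K1_def K2_def F1_def F2_def]
  let ?n1 = "card K1" and ?n2 = "card K2" and ?A = "sum g K2 + card F2" and ?B = "sum g K1 + card F1"
    and ?e = "card (inner I K)" and ?f = "card (touching I K - inner I K)" and ?t = "card (touching I K)"
  define P where "P = cst (1/4) * ((lin_p c * lin_q c) ^ (?B + ?A + ?e) * special c ^ (sum s K1 + sum s K2))
      + (pv ^ (?n1 + sum s K2) * qv ^ (?n2 + sum s K1) * lin_q c ^ ?B * lin_p c ^ ?A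
      + pv ^ (?n2 + sum s K1) * qv ^ (?n1 + sum s K2) * lin_p c ^ ?B * lin_q c ^ ?A)"
  have P: "P \<in> schur_cone"
  proof -
    have le: "card K \<le> ?e + 1" using card_cluster_le[OF assms(2,1,4,5)] .
    show ?thesis
    proof (cases "K1 = {} \<or> K2 = {}")
      case False
      then have "?n1 \<ge> 1" "?n2 \<ge> 1" using assms(1) by (auto simp: K1_def K2_def Suc_le_eq card_gt_0_iff)
      then show ?thesis
        unfolding P_def using cluster_many[OF c, of ?n1 ?n2 ?e ?A ?B "sum s K1" "sum s K2"] le w(4)
        by (simp add: add.commute add.left_commute)
    next
      case True
      have "inner I K = {}"
        using True assms(3) by (force simp: signing_def K1_def K2_def inner_def)
      then have "card K \<le> 1" using le by simp
      then have Kv: "K = {v}" using assms(1,4) by (metis card_le_Suc0_iff_eq One_nat_def insertI1 singletonD subsetI subset_antisym empty_iff insert_iff)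
      have "cst (1/4) * ((lin_p c * lin_q c) ^ (?B + ?A) * special c ^ (sum s K1 + sum s K2))
         + (pv * qv ^ (sum s K1 + sum s K2) * lin_q c ^ (?B + ?A) + pv ^ (sum s K1 + sum s K2) * qv * lin_p c ^ (?B + ?A)) \<in> schur_cone"
        by (rule cluster_single[OF c])
      moreover have "\<sigma> v = OnlyA \<and> K1 = {v} \<and> K2 = {} \<and> F2 = {} \<or> \<sigma> v = OnlyB \<and> K2 = {v} \<and> K1 = {} \<and> F1 = {}"
      proof -
        have out: "\<sigma> u = Neither" if "u \<noteq> v" for u using assms(3) that by (auto simp: Kv signing_def)
        have "\<sigma> v = OnlyA \<or> \<sigma> v = OnlyB" using assms(3) by (auto simp: Kv signing_def)
        then show ?thesis
        proof
          assume A: "\<sigma> v = OnlyA"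
          then have "\<sigma> u \<noteq> OnlyB" for u using out[of u] by (cases "u = v") auto
          then show ?thesis using A by (auto simp: Kv K1_def K2_def F2_def)
        next
          assume A: "\<sigma> v = OnlyB"
          then have "\<sigma> u \<noteq> OnlyA" for u using out[of u] by (cases "u = v") auto
          then show ?thesis using A by (auto simp: Kv K1_def K2_def F1_def)
        qed
      qed
      ultimately show ?thesis
        unfolding P_def \<open>inner I K = {}\<close> by (elim disjE) (simp_all add: algebra_simps)
    qed
  qed
  have te: "?t = ?e + ?f"
  proof -
    have "touching I K = inner I K \<union> (touching I K - inner I K)" by (auto simp: touching_def inner_def)
    moreover have "finite (touching I K)" "finite (inner I K)" using assms(2) by (auto simp: touching_def inner_def)
    ultimately show ?thesis by (metis card_Un_disjoint finite_Diff Diff_disjoint)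
  qed
  have "cst (cluster_loss I K) * 4 ^ ?t = cst (1/4) * 2 ^ ?f"
  proof -
    have "cluster_loss I K * 4 ^ ?t = 1/4 * ((1/4) ^ ?e * 4 ^ ?e) * ((1/2) ^ ?f * 4 ^ ?f)"
      by (simp add: cluster_loss_def te power_add mult_ac)
    also have "\<dots> = 1/4 * 2 ^ ?f"
      by (simp flip: power_mult_distrib)
    finally have "cluster_loss I K * 4 ^ ?t = 1/4 * 2 ^ ?f" .
    from arg_cong[OF this, of cst] show ?thesis by (simp only: cst_mult cst_power cst_numeral)
  qed
  then have M: "cst (cluster_loss I K) * weight K (touching I K) neutral
      = e2 ^ ?t * 2 ^ ?f * (cst (1/4) * ((lin_p c * lin_q c) ^ (?B + ?A + ?e) * special c ^ (sum s K1 + sum s K2)))"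
    unfolding w(2) by (simp only: mult.assoc[symmetric]) (simp only: mult_ac)
  have "cst (cluster_loss I K) * weight K (touching I K) neutral
    + (weight K (touching I K) \<sigma> + weight K (touching I K) (swap_state \<circ> \<sigma>)) = e2 ^ ?t * 2 ^ ?f * P"
  proof -
    have "weight K (touching I K) (swap_state \<circ> \<sigma>) = e2 ^ ?t * 2 ^ ?f *
       (pv ^ (?n2 + sum s K1) * qv ^ (?n1 + sum s K2) * lin_q c ^ ?A * lin_p c ^ ?B)"
      using w'(1) by (simp add: o_def)
    then show ?thesis unfolding M w(1) P_def by (simp add: distrib_left mult_ac)
  qed
  then show ?thesis using P by (auto intro!: schur_cone_mult schur_cone_power)
qed

lemma cluster_neighbour:
  assumes "component I v K = K" "u \<in> K" "w \<in> K" "u \<noteq> w"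
  shows "\<exists>b\<in>K. adj I u b"
proof -
  let ?R = "{(a, b). a \<in> K \<and> b \<in> K \<and> adj I a b}"
  have path: "(v, a) \<in> ?R\<^sup>*" if "a \<in> K" for a using assms(1) that by (auto simp: component_def)
  have sym: "adj I a b \<Longrightarrow> adj I b a" for a b by (auto simp: adj_def)
  show ?thesis
  proof (cases "u = v")
    case True
    have "(v, w) \<in> ?R\<^sup>*" by (rule path[OF assms(3)])
    then show ?thesis
      by (cases rule: converse_rtranclE) (use True assms(4) in auto)
  next
    case False
    have "(v, u) \<in> ?R\<^sup>*" by (rule path[OF assms(2)])
    then show ?thesis
      by (cases rule: rtranclE) (use False sym in auto)
  qed
qed

text \<open>
  In a cluster with several vertices each vertex has a neighbour, and the only nonzero weights of a
  double edge between active ends are those of opposite states.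
\<close>
lemma signing_of_weight:
  assumes "component I v K = K" "finite I" "finite K" "supp \<sigma> = K" "weight K (touching I K) \<sigma> \<noteq> 0" "K \<noteq> {v}" "v \<in> K"
  shows "signing I K \<sigma>"
proof -
  have nz: "double_edge c (\<sigma> (x i)) (\<sigma> (y i)) \<noteq> 0" if "i \<in> touching I K" for i
  proof -
    have "finite (touching I K)" using assms(2) by (simp add: touching_def)
    then show ?thesis using assms(5) that by (auto simp: weight_def prod_zero_iff)
  qed
  have sup: "\<sigma> u \<noteq> Neither \<longleftrightarrow> u \<in> K" for u using assms(4) by (auto simp: supp_def)
  have double_edge: "t \<noteq> Neither \<Longrightarrow> u \<noteq> Neither \<Longrightarrow> double_edge c t u \<noteq> 0 \<Longrightarrow>
      (t = OnlyA \<and> u = OnlyB) \<or> (t = OnlyB \<and> u = OnlyA)" for t u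
    by (cases t; cases u) auto
  have adj: "(\<sigma> a = OnlyA \<and> \<sigma> b = OnlyB) \<or> (\<sigma> a = OnlyB \<and> \<sigma> b = OnlyA)"
    if ab: "a \<in> K" "b \<in> K" "adj I a b" for a b
  proof -
    obtain i where i: "i \<in> I" "(x i = a \<and> y i = b) \<or> (x i = b \<and> y i = a)"
      using ab(3) by (auto simp: adj_def)
    then have "double_edge c (\<sigma> (x i)) (\<sigma> (y i)) \<noteq> 0" using that by (intro nz) (auto simp: touching_def)
    then have "double_edge c (\<sigma> a) (\<sigma> b) \<noteq> 0" using i double_edge_commute by metis
    then show ?thesis using double_edge sup that by blast
  qed
  have "\<sigma> u = OnlyA \<or> \<sigma> u = OnlyB" if u: "u \<in> K" for u
  proof -
    obtain w where "w \<in> K" "u \<noteq> w" using assms(6,7) u by blast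
    then obtain b where "b \<in> K" "adj I u b" using cluster_neighbour[OF assms(1) u] by blast
    then show ?thesis using adj u by blast
  qed
  moreover have "\<sigma> (x i) \<noteq> \<sigma> (y i)" if "i \<in> inner I K" for i
  proof -
    have "adj I (x i) (y i)" using that by (auto simp: adj_def inner_def)
    then show ?thesis using adj[of "x i" "y i"] that by (auto simp: inner_def)
  qed
  ultimately show ?thesis using sup by (auto simp: signing_def)
qed

lemma signing_determined:
  assumes "component I v K = K" "signing I K \<sigma>" "signing I K \<sigma>'" "\<sigma> v = \<sigma>' v"
  shows "\<sigma> = \<sigma>'"
proof
  fix u
  show "\<sigma> u = \<sigma>' u"
  proof (cases "u \<in> K")
    case True
    then have "(v, u) \<in> {(a, b). a \<in> K \<and> b \<in> K \<and> adj I a b}\<^sup>*"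
      using assms(1) by (auto simp: component_def)
    then show ?thesis
    proof (induction rule: rtrancl_induct)
      case (step a b)
      then have ab: "a \<in> K" "b \<in> K" "adj I a b" by auto
      then obtain i where "i \<in> inner I K" "(x i = a \<and> y i = b) \<or> (x i = b \<and> y i = a)"
        by (auto simp: adj_def inner_def)
      then have "\<sigma> a \<noteq> \<sigma> b" "\<sigma>' a \<noteq> \<sigma>' b" using assms(2,3) by (auto simp: signing_def)
      moreover have "\<sigma> a = OnlyA \<or> \<sigma> a = OnlyB" "\<sigma> b = OnlyA \<or> \<sigma> b = OnlyB"
        "\<sigma>' a = OnlyA \<or> \<sigma>' a = OnlyB" "\<sigma>' b = OnlyA \<or> \<sigma>' b = OnlyB"
        using assms(2,3) ab by (auto simp: signing_def)
      ultimately show ?case using step.IH by metis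
    qed (rule assms(4))
  qed (use assms in \<open>simp add: signing_def\<close>)
qed

text \<open>
  The configurations with nonzero weight on a connected cluster are an alternating pattern and its
  swap, or none; a single vertex can also be in both copies, which only adds a positive term.
\<close>
lemma cluster_sum_ge:
  assumes "finite I" "finite K" "v \<in> K" "component I v K = K"
    and loopfree: "\<And>i. i \<in> I \<Longrightarrow> x i \<noteq> y i"
  shows "cst (cluster_loss I K) * weight K (touching I K) neutral + cluster_sum I K \<in> schur_cone"
proof -
  let ?w = "weight K (touching I K)"
  let ?S = "{\<sigma>. supp \<sigma> = K}"
  have loss: "0 \<le> cluster_loss I K" by (simp add: cluster_loss_def)
  have "?S \<subseteq> configs K" by (auto simp: supp_configs)
  then have finS: "finite ?S" using assms(2) finite_configs finite_subset by blast
  show ?thesis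
  proof (cases "K = {v}")
    case True
    define \<sigma> where "\<sigma> = neutral(v := OnlyA)"
    define \<beta> where "\<beta> = neutral(v := Both)"
    have "inner I K = {}" using loopfree by (force simp: True inner_def)
    then have sg: "signing I K \<sigma>" by (simp add: signing_def \<sigma>_def True)
    have "\<tau> \<in> ?S \<longleftrightarrow> \<tau> \<in> {\<sigma>, swap_state \<circ> \<sigma>, \<beta>}" for \<tau>
    proof -
      have "\<tau> \<in> ?S \<longleftrightarrow> \<tau> v \<noteq> Neither \<and> (\<forall>u. u \<noteq> v \<longrightarrow> \<tau> u = Neither)"
        by (auto simp: supp_def True)
      also have "\<dots> \<longleftrightarrow> \<tau> \<in> {\<sigma>, swap_state \<circ> \<sigma>, \<beta>}"
        by (cases "\<tau> v") (auto simp: \<sigma>_def \<beta>_def fun_eq_iff)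
      finally show ?thesis .
    qed
    then have S: "?S = {\<sigma>, swap_state \<circ> \<sigma>, \<beta>}" by blast
    have "\<sigma> v \<noteq> (swap_state \<circ> \<sigma>) v" "\<sigma> v \<noteq> \<beta> v" "(swap_state \<circ> \<sigma>) v \<noteq> \<beta> v"
      by (simp_all add: \<sigma>_def \<beta>_def)
    then have "\<sigma> \<noteq> swap_state \<circ> \<sigma>" "\<sigma> \<noteq> \<beta>" "swap_state \<circ> \<sigma> \<noteq> \<beta>" by metis+
    then have sum: "cluster_sum I K = ?w \<sigma> + ?w (swap_state \<circ> \<sigma>) + ?w \<beta>"
      unfolding cluster_sum_def S by (simp add: add.assoc)
    have "?w \<beta> \<in> schur_cone"
    proof -
      have "vertex_weight c (g v) (s v) Both = e2 * 0 ^ s v" by (simp add: vertex_weight_def e2_def)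
      moreover have "double_edge c (\<beta> (x i)) (\<beta> (y i)) = e2" if "i \<in> touching I K" for i
        using that loopfree[of i] by (auto simp: \<beta>_def True touching_def)
      ultimately show ?thesis
        unfolding weight_def by (intro schur_cone_mult schur_cone_prod) (auto simp: True \<beta>_def intro!: schur_cone_mult schur_cone_power)
    qed
    with signing_positive[OF assms(2,1) sg assms(3,4)] show ?thesis
      unfolding sum by (metis add.assoc schur_cone_add)
  next
    case False
    show ?thesis
    proof (cases "\<exists>\<sigma>\<in>?S. ?w \<sigma> \<noteq> 0")
      case none: False
      then have "cluster_sum I K = 0" unfolding cluster_sum_def by (intro sum.neutral) auto
      then show ?thesis using schur_cone_cst_mult[OF weight_base_cone loss] by simp
    next
      case True
      then obtain \<sigma> where \<sigma>: "supp \<sigma> = K" "?w \<sigma> \<noteq> 0" by auto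
      have sg: "signing I K \<tau>" if "supp \<tau> = K" "?w \<tau> \<noteq> 0" for \<tau>
        using signing_of_weight[OF assms(4,1,2) that False assms(3)] .
      have s\<sigma>: "signing I K \<sigma>" using sg \<sigma> .
      have v: "\<tau> v = OnlyA \<or> \<tau> v = OnlyB" if "signing I K \<tau>" for \<tau>
        using that assms(3) by (simp add: signing_def)
      have two: "\<tau> \<in> {\<sigma>, swap_state \<circ> \<sigma>}" if "supp \<tau> = K" "?w \<tau> \<noteq> 0" for \<tau>
      proof -
        have st: "signing I K \<tau>" using sg that .
        have "\<tau> v = \<sigma> v \<or> \<tau> v = (swap_state \<circ> \<sigma>) v" using v[OF st] v[OF s\<sigma>] by auto
        then show ?thesis
          using signing_determined[OF assms(4) st s\<sigma>] signing_determined[OF assms(4) st signing_swap[OF s\<sigma>]]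
          by auto
      qed
      have "\<sigma> v \<noteq> (swap_state \<circ> \<sigma>) v" using v[OF s\<sigma>] by auto
      then have ne: "\<sigma> \<noteq> swap_state \<circ> \<sigma>" by metis
      have "supp (swap_state \<circ> \<sigma>) = K" using \<sigma>(1) by (auto simp: supp_def)
      then have "cluster_sum I K = (\<Sum>\<tau>\<in>{\<sigma>, swap_state \<circ> \<sigma>}. ?w \<tau>)"
        unfolding cluster_sum_def
        by (intro sum.mono_neutral_right finS) (use \<sigma>(1) two in auto)
      then show ?thesis
        using signing_positive[OF assms(2,1) s\<sigma> assms(3,4)] ne by simp
    qed
  qed
qed

lemma config_sum_chain:
  assumes "finite Y" "X \<subseteq> Y"
    and "\<And>Z v. Z \<subseteq> Y \<Longrightarrow> v \<in> Z \<Longrightarrow> cst (3/4) * config_sum V I (Z - {v}) \<sqsubseteq> config_sum V I Z"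
  shows "cst ((3/4) ^ card (Y - X)) * config_sum V I X \<sqsubseteq> config_sum V I Y"
  using assms
proof (induction "card (Y - X)" arbitrary: Y)
  case 0
  then have "Y = X" by auto
  then show ?case by simp
next
  case (Suc n)
  have "Y - X \<noteq> {}"
  proof
    assume "Y - X = {}"
    then have "card (Y - X) = 0" by (simp only: card.empty)
    then show False using Suc.hyps(2) by linarith
  qed
  then obtain v where v: "v \<in> Y - X" by blast
  have n: "card (Y - {v} - X) = n"
  proof -
    have "Y - {v} - X = (Y - X) - {v}" by auto
    then show ?thesis using v Suc.hyps(2) Suc.prems(1) by (simp add: card_Diff_singleton)
  qed
  have "cst ((3/4) ^ n) * config_sum V I X \<sqsubseteq> config_sum V I (Y - {v})"
    unfolding n[symmetric]
  proof (rule Suc.hyps(1))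
    fix Z u assume "Z \<subseteq> Y - {v}" "u \<in> Z"
    then show "cst (3/4) * config_sum V I (Z - {u}) \<sqsubseteq> config_sum V I Z" using Suc.prems(3)[of Z u] by blast
  qed (use n Suc.prems v in auto)
  then have "cst (3/4) * (cst ((3/4) ^ n) * config_sum V I X) \<sqsubseteq> cst (3/4) * config_sum V I (Y - {v})"
    by (intro schur_le_mult_left) auto
  also have "\<dots> \<sqsubseteq> config_sum V I Y" using Suc.prems v by auto
  finally show ?case unfolding Suc.hyps(2)[symmetric] by (simp only: power_Suc cst_mult mult.assoc)
qed

text \<open>
  The factors \<open>4/3\<close> undo the removal of the cluster and its boundary. Inner edges contribute
  \<open>1/4 * 4/3 = 1/3\<close> per vertex and boundary edges \<open>1/2 * 4/3 = 1 - 1/3\<close> per boundary vertex: just the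
  probabilities of site percolation with density \<open>1/3\<close>.
\<close>
lemma cluster_loss_bound:
  assumes "finite I" "finite K" "v \<in> K" "component I v K = K"
  shows "cluster_loss I K * (4/3) ^ (card K - 1 + card (boundary I K \<inter> U))
    \<le> 1/4 * ((1/3) ^ (card K - 1) * (1 - 1/3) ^ card (boundary I K \<inter> U))"
proof -
  define n b where "n = card K - 1" and "b = card (boundary I K \<inter> U)"
  have fin: "finite (touching I K - inner I K)" using assms(1) by (simp add: touching_def)
  have "finite (boundary I K)"
    by (rule finite_subset[of _ "x ` I \<union> y ` I"]) (use assms(1) in \<open>auto simp: boundary_def adj_def\<close>)
  then have b: "b \<le> card (touching I K - inner I K)"
    unfolding b_def using card_boundary_le[OF assms(1), of K] card_mono[of "boundary I K" "boundary I K \<inter> U"] by simp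
  have n: "n \<le> card (inner I K)" using card_cluster_le[OF assms] by (simp add: n_def)
  have "cluster_loss I K \<le> 1/4 * (1/4) ^ n * (1/2) ^ b"
    unfolding cluster_loss_def using n b by (intro mult_mono power_decreasing) auto
  then have "cluster_loss I K * (4/3) ^ (n + b) \<le> 1/4 * (1/4) ^ n * (1/2) ^ b * (4/3) ^ (n + b)"
    by (intro mult_right_mono) auto
  also have "\<dots> = 1/4 * ((1/4 * (4/3)) ^ n * (1/2 * (4/3)) ^ b)"
    unfolding power_add power_mult_distrib by simp
  also have "\<dots> = 1/4 * ((1/3) ^ n * (1 - 1/3) ^ b)" by simp
  finally show ?thesis by (simp only: n_def b_def)
qed

text \<open>
  Activating \<open>v\<close> adds the clusters at \<open>v\<close>. Up to positive terms each of them subtracts its loss times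
  the sum in which the cluster and its boundary are neutral; by induction the latter is comparable
  with the sum in which only \<open>v\<close> is neutral, and the percolation identity bounds the total loss
  by \<open>1/4\<close>.
\<close>
lemma config_sum_positive:
  assumes "finite V" "finite I" "U \<subseteq> V" "\<And>i. i \<in> I \<Longrightarrow> x i \<noteq> y i"
  shows "config_sum V I U \<in> schur_cone \<and> (\<forall>v\<in>U. cst (3/4) * config_sum V I (U - {v}) \<sqsubseteq> config_sum V I U)"
  using assms
proof (induction "card U" arbitrary: V I U rule: less_induct)
  case less
  have finU: "finite U" using less.prems finite_subset by blast
  have IH: "config_sum V' I' Z \<in> schur_cone" "\<And>v. v \<in> Z \<Longrightarrow> cst (3/4) * config_sum V' I' (Z - {v}) \<sqsubseteq> config_sum V' I' Z"
    if "Z \<subset> U" "Z \<subseteq> V'" "finite V'" "finite I'" "I' \<subseteq> I" for Z V' I'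
    using less.hyps[of Z V' I'] that less.prems(4) finU psubset_card_mono by blast+
  have step: "cst (3/4) * config_sum V I (U - {v}) \<sqsubseteq> config_sum V I U" if v: "v \<in> U" for v
  proof -
    let ?W = "U - {v}" and ?C = "clusters I U v"
    let ?Z = "\<lambda>K. U - K - boundary I K"
    let ?R = "\<lambda>K. config_sum (V - K) (I - touching I K) (?Z K)"
    let ?M = "\<lambda>K. weight K (touching I K) neutral"
    let ?l = "\<lambda>K. cluster_loss I K"
    have W: "config_sum V I ?W \<in> schur_cone" using v less.prems by (intro IH) auto
    have loss_pos: "0 \<le> ?l K" for K by (simp add: cluster_loss_def)
    have cl: "K \<subseteq> U" "v \<in> K" "component I v K = K" "finite K" if "K \<in> ?C" for K
      using that finU finite_subset by (auto simp: clusters_def)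
    \<comment> \<open>The gain from \<open>K\<close> is at least minus its loss times the sum with \<open>K\<close> and its boundary neutral.\<close>
    have lower: "- (cst (?l K) * config_sum V I (?Z K)) \<sqsubseteq> cluster_sum I K * ?R K" if K: "K \<in> ?C" for K
    proof -
      have R: "?R K \<in> schur_cone"
        using cl[OF K] v less.prems by (intro IH) auto
      have "(cst (?l K) * ?M K + cluster_sum I K) * ?R K \<in> schur_cone"
        using cluster_sum_ge[OF less.prems(2) cl(4,2,3)[OF K] less.prems(4)] R by (rule schur_cone_mult)
      moreover have "config_sum V I (?Z K) = ?M K * ?R K"
        using less.prems cl(1)[OF K] by (intro config_sum_off_cluster) auto
      ultimately show ?thesis by (simp add: schur_le_def algebra_simps)
    qed
    \<comment> \<open>That sum is bounded by releasing the other vertices of \<open>U\<close> one at a time.\<close>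
    have upper: "cst (?l K) * config_sum V I (?Z K)
        \<sqsubseteq> cst (1/4 * ((1/3) ^ (card K - 1) * (1 - 1/3) ^ card (boundary I K \<inter> U))) * config_sum V I ?W"
      if K: "K \<in> ?C" for K
    proof -
      let ?d = "card K - 1 + card (boundary I K \<inter> U)"
      have "?W - ?Z K = (K - {v}) \<union> (boundary I K \<inter> U)"
        using cl[OF K] by (auto simp: boundary_def)
      moreover have "card \<dots> = card (K - {v}) + card (boundary I K \<inter> U)"
        using cl[OF K] finU by (intro card_Un_disjoint) (auto simp: boundary_def)
      ultimately have d: "card (?W - ?Z K) = ?d" using cl[OF K] by simp
      have "cst ((3/4) ^ card (?W - ?Z K)) * config_sum V I (?Z K) \<sqsubseteq> config_sum V I ?W"
      proof (rule config_sum_chain)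
        fix Z u assume "Z \<subseteq> ?W" "u \<in> Z"
        then show "cst (3/4) * config_sum V I (Z - {u}) \<sqsubseteq> config_sum V I Z"
          using v less.prems by (intro IH(2)) auto
      qed (use finU cl[OF K] in auto)
      then have "cst (?l K * (4/3) ^ ?d) * (cst ((3/4) ^ ?d) * config_sum V I (?Z K))
          \<sqsubseteq> cst (?l K * (4/3) ^ ?d) * config_sum V I ?W"
        unfolding d using loss_pos by (intro schur_le_mult_left schur_cone_cst) auto
      moreover have "cst (?l K * (4/3) ^ ?d) * (cst ((3/4) ^ ?d) * config_sum V I (?Z K)) = cst (?l K) * config_sum V I (?Z K)"
      proof -
        have "?l K * (4/3) ^ ?d * (3/4) ^ ?d = ?l K" by (simp flip: power_mult_distrib add: mult.assoc)
        then show ?thesis by (simp only: mult.assoc[symmetric] cst_mult[symmetric])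
      qed
      moreover have "cst (?l K * (4/3) ^ ?d) * config_sum V I ?W
          \<sqsubseteq> cst (1/4 * ((1/3) ^ (card K - 1) * (1 - 1/3) ^ card (boundary I K \<inter> U))) * config_sum V I ?W"
        by (rule schur_le_cst[OF cluster_loss_bound W]) (use less.prems cl[OF K] in auto)
      ultimately show ?thesis by (simp only:) (rule schur_le_trans)
    qed
    have "cst (3/4) * config_sum V I ?W \<sqsubseteq> config_sum V I ?W + - (cst (1/4) * config_sum V I ?W)"
    proof -
      have "config_sum V I ?W + - (cst (1/4) * config_sum V I ?W) = cst (1 - 1/4) * config_sum V I ?W"
        unfolding cst_diff by (simp add: algebra_simps)
      then show ?thesis by simp
    qed
    also have "\<dots> \<sqsubseteq> config_sum V I ?W + (\<Sum>K\<in>?C. - (cst (?l K) * config_sum V I (?Z K)))"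
    proof (intro schur_le_add schur_le_refl)
      have "(\<Sum>K\<in>?C. cst (?l K) * config_sum V I (?Z K))
          \<sqsubseteq> (\<Sum>K\<in>?C. cst (1/4 * ((1/3) ^ (card K - 1) * (1 - 1/3) ^ card (boundary I K \<inter> U))) * config_sum V I ?W)"
        by (intro schur_le_sum upper)
      also have "\<dots> = cst (1/4 * (\<Sum>K\<in>?C. (1/3) ^ (card K - 1) * (1 - 1/3) ^ card (boundary I K \<inter> U))) * config_sum V I ?W"
        by (simp only: sum_distrib_left cst_sum sum_distrib_right)
      also have "\<dots> \<sqsubseteq> cst (1/4) * config_sum V I ?W"
        using percolation[OF finU v, of "1/3" I] by (intro schur_le_cst W) simp
      finally show "- (cst (1/4) * config_sum V I ?W) \<sqsubseteq> (\<Sum>K\<in>?C. - (cst (?l K) * config_sum V I (?Z K)))"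
        unfolding sum_negf by (simp add: schur_le_def algebra_simps)
    qed
    also have "\<dots> \<sqsubseteq> config_sum V I ?W + (\<Sum>K\<in>?C. cluster_sum I K * ?R K)"
      by (intro schur_le_add schur_le_refl schur_le_sum lower)
    also have "\<dots> = config_sum V I U" using config_sum_expand[OF less.prems(1-3) v] by simp
    finally show ?thesis .
  qed
  have "config_sum V I U \<in> schur_cone"
  proof (cases "U = {}")
    case True
    then show ?thesis by (simp add: config_sum_def weight_base_cone)
  next
    case False
    then obtain v where v: "v \<in> U" by auto
    have "config_sum V I (U - {v}) \<in> schur_cone" using v less.prems by (intro IH) auto
    then have "cst (3/4) * config_sum V I (U - {v}) \<in> schur_cone" by (intro schur_cone_cst_mult) auto
    then show ?thesis using step[OF v] by (rule schur_le_cone)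
  qed
  then show ?case using step by auto
qed

end

section \<open>Positivity of the hard-core sum\<close>

text \<open>
  The joint weight of an edge in both copies: \<open>edge_pair_state_of\<close> identifies it with the product of
  the two edge factors.
\<close>
definition edge_pair :: "real \<Rightarrow> pair_state \<Rightarrow> pair_state \<Rightarrow> bipoly" where
  "edge_pair c t u = plain_end c t * plain_end c u + special_end c t * plain_end c u + plain_end c t * special_end c u + double_edge c t u"

lemma vertex_weight_plain_end: "vertex_weight c n m t * plain_end c t = vertex_weight c (Suc n) m t"
  and vertex_weight_special_end: "vertex_weight c n m t * special_end c t = vertex_weight c n (Suc m) t"
  by (simp_all add: vertex_weight_def mult_ac)

lemma prod_vertex_weight_plain_end:
  assumes "finite V" "u \<in> V"
  shows "(\<Prod>v\<in>V. vertex_weight c (g v) (s v) (\<tau> v)) * plain_end c (\<tau> u) = (\<Prod>v\<in>V. vertex_weight c ((g(u := Suc (g u))) v) (s v) (\<tau> v))"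
proof -
  have "(\<Prod>v\<in>V - {u}. vertex_weight c ((g(u := Suc (g u))) v) (s v) (\<tau> v)) = (\<Prod>v\<in>V - {u}. vertex_weight c (g v) (s v) (\<tau> v))"
    by (rule prod.cong) auto
  then show ?thesis
    using assms by (simp add: prod.remove[of V u] vertex_weight_plain_end[symmetric] mult_ac)
qed

lemma prod_vertex_weight_special_end:
  assumes "finite V" "u \<in> V"
  shows "(\<Prod>v\<in>V. vertex_weight c (g v) (s v) (\<tau> v)) * special_end c (\<tau> u) = (\<Prod>v\<in>V. vertex_weight c (g v) ((s(u := Suc (s u))) v) (\<tau> v))"
proof -
  have "(\<Prod>v\<in>V - {u}. vertex_weight c (g v) ((s(u := Suc (s u))) v) (\<tau> v)) = (\<Prod>v\<in>V - {u}. vertex_weight c (g v) (s v) (\<tau> v))"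
    by (rule prod.cong) auto
  then show ?thesis
    using assms by (simp add: prod.remove[of V u] vertex_weight_special_end[symmetric] mult_ac)
qed

text \<open>
  Expanding one edge after another: the first three terms of \<open>edge_pair\<close> change only the numbers of
  plain and special ends at its two vertices, and the last one adds a double edge.
\<close>
lemma mixed_sum_positive:
  fixes x y :: "'e \<Rightarrow> 'v"
  assumes "c \<ge> 1" "finite V" "finite J" "finite I"
    and "I \<inter> J = {}" "\<And>i. i \<in> J \<Longrightarrow> x i \<in> V \<and> y i \<in> V"
    and "\<And>i. i \<in> I \<union> J \<Longrightarrow> x i \<noteq> y i"
  shows "(\<Sum>\<tau> | \<forall>v. v \<notin> V \<longrightarrow> \<tau> v = Neither.
      (\<Prod>v\<in>V. vertex_weight c (g v) (s v) (\<tau> v)) * (\<Prod>i\<in>I. double_edge c (\<tau> (x i)) (\<tau> (y i)))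
      * (\<Prod>i\<in>J. edge_pair c (\<tau> (x i)) (\<tau> (y i)))) \<in> schur_cone"
  using assms(3-7)
proof (induction J arbitrary: I g s rule: finite_induct)
  case empty
  interpret two_copies x y c g s by unfold_locales (use assms in auto)
  show ?case
    using config_sum_positive[OF assms(2) empty(1) subset_refl] empty(4) by (simp add: config_sum_def weight_def configs_def)
next
  case (insert j J)
  let ?S = "{\<tau>. \<forall>v. v \<notin> V \<longrightarrow> \<tau> v = Neither}"
  define F where "F I g s \<tau> = (\<Prod>v\<in>V. vertex_weight c (g v) (s v) (\<tau> v)) * (\<Prod>i\<in>I. double_edge c (\<tau> (x i)) (\<tau> (y i)))
      * (\<Prod>i\<in>J. edge_pair c (\<tau> (x i)) (\<tau> (y i)))" for I g s \<tau>
  have F: "sum (F I' g' s') ?S \<in> schur_cone" if "finite I'" "I' \<inter> J = {}" "I' \<subseteq> insert j I" for I' g' s'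
    unfolding F_def using insert.prems that by (intro insert.IH) auto
  let ?a = "x j" and ?b = "y j"
  have ab: "?a \<in> V" "?b \<in> V" using insert.prems by auto
  \<comment> \<open>Each of the four terms is a sum of the same form with one edge less to expand.\<close>
  have zz: "F I g s \<tau> * (plain_end c (\<tau> ?a) * plain_end c (\<tau> ?b))
      = F I ((g(?a := Suc (g ?a)))(?b := Suc ((g(?a := Suc (g ?a))) ?b))) s \<tau>" for \<tau>
    unfolding F_def prod_vertex_weight_plain_end[OF assms(2) ab(2), symmetric] prod_vertex_weight_plain_end[OF assms(2) ab(1), symmetric]
    by (simp add: mult_ac)
  have sz: "F I g s \<tau> * (special_end c (\<tau> ?a) * plain_end c (\<tau> ?b)) = F I (g(?b := Suc (g ?b))) (s(?a := Suc (s ?a))) \<tau>" for \<tau>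
    unfolding F_def prod_vertex_weight_plain_end[OF assms(2) ab(2), symmetric] prod_vertex_weight_special_end[OF assms(2) ab(1), symmetric]
    by (simp add: mult_ac)
  have zs: "F I g s \<tau> * (plain_end c (\<tau> ?a) * special_end c (\<tau> ?b)) = F I (g(?a := Suc (g ?a))) (s(?b := Suc (s ?b))) \<tau>" for \<tau>
    unfolding F_def prod_vertex_weight_plain_end[OF assms(2) ab(1), symmetric] prod_vertex_weight_special_end[OF assms(2) ab(2), symmetric]
    by (simp add: mult_ac)
  have "j \<notin> I" using insert.prems by auto
  then have dd: "F I g s \<tau> * double_edge c (\<tau> ?a) (\<tau> ?b) = F (insert j I) g s \<tau>" for \<tau>
    unfolding F_def using insert.prems by (simp add: mult_ac)
  have "(\<Sum>\<tau>\<in>?S. (\<Prod>v\<in>V. vertex_weight c (g v) (s v) (\<tau> v)) * (\<Prod>i\<in>I. double_edge c (\<tau> (x i)) (\<tau> (y i)))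
      * (\<Prod>i\<in>insert j J. edge_pair c (\<tau> (x i)) (\<tau> (y i))))
    = (\<Sum>\<tau>\<in>?S. F I g s \<tau> * edge_pair c (\<tau> ?a) (\<tau> ?b))"
    using insert.hyps by (simp add: F_def mult_ac)
  also have "\<dots> = (\<Sum>\<tau>\<in>?S. F I g s \<tau> * (plain_end c (\<tau> ?a) * plain_end c (\<tau> ?b)))
      + (\<Sum>\<tau>\<in>?S. F I g s \<tau> * (special_end c (\<tau> ?a) * plain_end c (\<tau> ?b)))
      + (\<Sum>\<tau>\<in>?S. F I g s \<tau> * (plain_end c (\<tau> ?a) * special_end c (\<tau> ?b)))
      + (\<Sum>\<tau>\<in>?S. F I g s \<tau> * double_edge c (\<tau> ?a) (\<tau> ?b))"
    by (simp only: edge_pair_def distrib_left sum.distrib)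
  also have "\<dots> \<in> schur_cone"
    unfolding zz sz zs dd using insert.prems insert.hyps by (intro schur_cone_add F) auto
  finally show ?case .
qed

definition edge_factor :: "nat \<Rightarrow> 'r::comm_ring_1 \<Rightarrow> bool \<Rightarrow> bool \<Rightarrow> 'r" where
  "edge_factor l z a b =
    (if a \<and> b then 1 else if a \<or> b then 1 + of_nat (l + 1) * z
     else (1 + of_nat l * z) * (1 + of_nat (l + 2) * z))"

definition state_of :: "bool \<Rightarrow> bool \<Rightarrow> pair_state" where
  "state_of a b = (if a then if b then Both else OnlyA else if b then OnlyB else Neither)"

lemma edge_pair_state_of:
  "edge_pair (real l) (state_of a b) (state_of a' b') = edge_factor l pv a a' * edge_factor l qv b b'"
  by (cases a; cases b; cases a'; cases b')
    (simp_all add: edge_pair_def state_of_def edge_factor_def special_def lin_p_def lin_q_def e2_def cst_of_nat algebra_simps)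

lemma center_factor_state_of: "center_factor (state_of a b) = (if a then pv else 1) * (if b then qv else 1)"
  by (simp add: state_of_def)

definition hard_core :: "nat \<Rightarrow> ('e \<Rightarrow> 'v) \<Rightarrow> ('e \<Rightarrow> 'v) \<Rightarrow> 'v set \<Rightarrow> 'e set \<Rightarrow> 'r::comm_ring_1 \<Rightarrow> 'r" where
  "hard_core l x y V J z = (\<Sum>S\<in>Pow V. z ^ card S * (\<Prod>i\<in>J. edge_factor l z (x i \<in> S) (y i \<in> S)))"

lemma hard_core_positive:
  fixes x y :: "'e \<Rightarrow> 'v"
  assumes "l \<ge> 1" "\<And>i. i \<in> J \<Longrightarrow> x i \<noteq> y i" "finite V" "finite J" "\<And>i. i \<in> J \<Longrightarrow> x i \<in> V \<and> y i \<in> V"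
  shows "hard_core l x y V J pv * hard_core l x y V J qv \<in> schur_cone"
proof -
  let ?st = "\<lambda>(S, S'). \<lambda>v. state_of (v \<in> S) (v \<in> S')"
  have pow: "(\<Prod>v\<in>V. if v \<in> S then z else 1) = z ^ card S" if "S \<subseteq> V" for S and z :: bipoly
    using that assms(3) by (simp add: prod.If_cases Int_absorb1)
  have "hard_core l x y V J pv * hard_core l x y V J qv
    = (\<Sum>(S, S')\<in>Pow V \<times> Pow V. (pv ^ card S * qv ^ card S') *
        (\<Prod>i\<in>J. edge_factor l pv (x i \<in> S) (y i \<in> S) * edge_factor l qv (x i \<in> S') (y i \<in> S')))"
    unfolding hard_core_def sum_product sum.cartesian_product
    by (intro sum.cong refl) (auto simp: prod.distrib mult_ac)
  also have "\<dots> = (\<Sum>\<tau> | \<forall>v. v \<notin> V \<longrightarrow> \<tau> v = Neither.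
      (\<Prod>v\<in>V. vertex_weight (real l) 0 0 (\<tau> v)) * (\<Prod>i\<in>{}. double_edge (real l) (\<tau> (x i)) (\<tau> (y i)))
      * (\<Prod>i\<in>J. edge_pair (real l) (\<tau> (x i)) (\<tau> (y i))))"
  proof (rule sum.reindex_bij_witness[of _ "\<lambda>\<tau>. ({v. \<tau> v = OnlyA \<or> \<tau> v = Both}, {v. \<tau> v = OnlyB \<or> \<tau> v = Both})" ?st])
    fix SS assume "SS \<in> Pow V \<times> Pow V"
    then obtain S S' where SS: "SS = (S, S')" "S \<subseteq> V" "S' \<subseteq> V" by auto
    show "({v. ?st SS v = OnlyA \<or> ?st SS v = Both}, {v. ?st SS v = OnlyB \<or> ?st SS v = Both}) = SS"
      by (auto simp: SS state_of_def split: if_splits)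
    show "?st SS \<in> {\<tau>. \<forall>v. v \<notin> V \<longrightarrow> \<tau> v = Neither}" using SS by (auto simp: state_of_def)
    have "(\<Prod>v\<in>V. vertex_weight (real l) 0 0 (?st SS v)) = pv ^ card S * qv ^ card S'"
      using SS by (simp add: vertex_weight_def center_factor_state_of prod.distrib pow)
    then show "(\<Prod>v\<in>V. vertex_weight (real l) 0 0 (?st SS v)) * (\<Prod>i\<in>{}. double_edge (real l) (?st SS (x i)) (?st SS (y i)))
      * (\<Prod>i\<in>J. edge_pair (real l) (?st SS (x i)) (?st SS (y i)))
      = (case SS of (S, S') \<Rightarrow> (pv ^ card S * qv ^ card S') *
        (\<Prod>i\<in>J. edge_factor l pv (x i \<in> S) (y i \<in> S) * edge_factor l qv (x i \<in> S') (y i \<in> S')))"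
      by (simp add: SS edge_pair_state_of)
  next
    fix \<tau> :: "'v \<Rightarrow> pair_state" assume \<tau>: "\<tau> \<in> {\<tau>. \<forall>v. v \<notin> V \<longrightarrow> \<tau> v = Neither}"
    show "?st ({v. \<tau> v = OnlyA \<or> \<tau> v = Both}, {v. \<tau> v = OnlyB \<or> \<tau> v = Both}) = \<tau>"
    proof
      fix v show "?st ({v. \<tau> v = OnlyA \<or> \<tau> v = Both}, {v. \<tau> v = OnlyB \<or> \<tau> v = Both}) v = \<tau> v"
        by (cases "\<tau> v") (auto simp: state_of_def)
    qed
    show "({v. \<tau> v = OnlyA \<or> \<tau> v = Both}, {v. \<tau> v = OnlyB \<or> \<tau> v = Both}) \<in> Pow V \<times> Pow V"
      using \<tau> by force
  qed
  also have "\<dots> \<in> schur_cone"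
    using assms by (intro mixed_sum_positive) auto
  finally show ?thesis .
qed

section \<open>Independent sets of the graph with replaced edges\<close>
definition no_arcs :: "'b rel \<Rightarrow> 'b set \<Rightarrow> bool" where
  "no_arcs R A \<longleftrightarrow> (\<forall>u\<in>A. \<forall>v\<in>A. (u, v) \<notin> R)"

definition indep_gf :: "'b rel \<Rightarrow> 'b set \<Rightarrow> 'r::comm_ring_1 \<Rightarrow> 'r" where
  "indep_gf R W z = (\<Sum>A | A \<subseteq> W \<and> no_arcs R A. z ^ card A)"

lemma indep_gf_empty [simp]: "indep_gf R {} z = 1"
proof -
  have "{A. A \<subseteq> {} \<and> no_arcs R A} = {{}}" by (auto simp: no_arcs_def)
  then show ?thesis by (simp add: indep_gf_def)
qed

text \<open>An independent set avoids \<open>v\<close>, or it contains \<open>v\<close> and no neighbour.\<close>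
lemma indep_gf_delete:
  assumes "finite W" "v \<in> W" "(v, v) \<notin> R"
  shows "indep_gf R W z = indep_gf R (W - {v}) z
    + z * indep_gf R {u \<in> W - {v}. (u, v) \<notin> R \<and> (v, u) \<notin> R} z"
proof -
  let ?N = "{u \<in> W - {v}. (u, v) \<notin> R \<and> (v, u) \<notin> R}"
  let ?I = "\<lambda>W. {A. A \<subseteq> W \<and> no_arcs R A}"
  have fin: "finite (?I X)" if "finite X" for X
    by (rule finite_subset[of _ "Pow X"]) (use that in auto)
  have split: "?I W = ?I (W - {v}) \<union> insert v ` ?I ?N"
  proof (rule set_eqI)
    fix A
    show "A \<in> ?I W \<longleftrightarrow> A \<in> ?I (W - {v}) \<union> insert v ` ?I ?N"
    proof (cases "v \<in> A")
      case True
      then have "A = insert v (A - {v})" by auto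
      moreover have "A \<in> ?I W \<longleftrightarrow> A - {v} \<in> ?I ?N"
        using True assms(2,3) by (auto simp: no_arcs_def)
      moreover have "A \<in> insert v ` ?I ?N \<longleftrightarrow> A - {v} \<in> ?I ?N"
      proof
        assume "A \<in> insert v ` ?I ?N"
        then obtain B where "B \<in> ?I ?N" "A = insert v B" by auto
        moreover from this have "A - {v} = B" by auto
        ultimately show "A - {v} \<in> ?I ?N" by simp
      next
        assume "A - {v} \<in> ?I ?N"
        then show "A \<in> insert v ` ?I ?N" using \<open>A = insert v (A - {v})\<close> by (rule rev_image_eqI)
      qed
      ultimately show ?thesis using True by auto
    next
      case False
      then show ?thesis by auto
    qed
  qed
  have "(\<Sum>A\<in>insert v ` ?I ?N. z ^ card A) = (\<Sum>A\<in>?I ?N. z ^ card (insert v A))"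
    by (rule sum.reindex_cong[of "insert v"]) (auto simp: inj_on_def)
  also have "\<dots> = (\<Sum>A\<in>?I ?N. z * z ^ card A)"
  proof (rule sum.cong)
    fix A assume "A \<in> ?I ?N"
    then have "finite A" "v \<notin> A" using assms(1) by (auto intro: finite_subset[of A W])
    then show "z ^ card (insert v A) = z * z ^ card A" by simp
  qed simp
  finally show ?thesis
    unfolding indep_gf_def split using assms(1)
    by (subst sum.union_disjoint) (auto intro!: fin simp: sum_distrib_left)
qed

lemma indep_gf_clique:
  assumes "finite C" "finite W" "C \<inter> W = {}"
    and "\<And>u v. u \<in> C \<Longrightarrow> v \<in> C \<Longrightarrow> (u, v) \<in> R \<longleftrightarrow> u \<noteq> v"
    and "\<And>u v. u \<in> C \<Longrightarrow> v \<in> W \<Longrightarrow> (u, v) \<notin> R \<and> (v, u) \<notin> R"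
  shows "indep_gf R (C \<union> W) z = (1 + of_nat (card C) * z) * indep_gf R W z"
  using assms
proof (induction C rule: finite_induct)
  case (insert v C)
  have "indep_gf R (insert v C \<union> W) z = indep_gf R ((insert v C \<union> W) - {v}) z
    + z * indep_gf R {u \<in> (insert v C \<union> W) - {v}. (u, v) \<notin> R \<and> (v, u) \<notin> R} z"
    using insert by (intro indep_gf_delete) auto
  also have "(insert v C \<union> W) - {v} = C \<union> W" using insert by auto
  also have "{u \<in> C \<union> W. (u, v) \<notin> R \<and> (v, u) \<notin> R} = W" using insert by auto
  also have "indep_gf R (C \<union> W) z = (1 + of_nat (card C) * z) * indep_gf R W z"
    using insert.prems by (intro insert.IH) auto
  finally show ?case using insert.hyps by (simp add: algebra_simps)
qed simp

definition flagged :: "'b \<Rightarrow> bool \<Rightarrow> 'b \<Rightarrow> bool \<Rightarrow> 'b set" where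
  "flagged p i q j = (if i then {p} else {}) \<union> (if j then {q} else {})"

text \<open>
  Only the vertices other than the endpoints are counted, as the endpoints are shared by several
  gadgets.
\<close>
definition gadget_gf :: "'b pair_pre_digraph \<Rightarrow> 'b \<Rightarrow> 'b \<Rightarrow> 'r::comm_ring_1 \<Rightarrow> bool \<Rightarrow> bool \<Rightarrow> 'r" where
  "gadget_gf H p q z i j =
     (\<Sum>B | B \<subseteq> pverts H - {p, q} \<and> no_arcs (parcs H) (B \<union> flagged p i q j). z ^ card B)"

text \<open>
  An independent set consists of a set \<open>S\<close> of old vertices and a set of inner vertices for each
  gadget; all conditions are within one gadget and see only the part of \<open>S\<close> at its endpoints.
\<close>
lemma replace_edges_gf:
  fixes z :: "'r::comm_ring_1"
  assumes "finite V" "finite E" "\<And>e. e \<in> E \<Longrightarrow> finite (pverts (H e))"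
    and "V = pverts G" "E = edge_sets G"
    and "\<And>e. e \<in> E \<Longrightarrow> fst (ends e) \<in> V \<and> snd (ends e) \<in> V"
    and "p \<noteq> q"
  shows "(\<Sum>A | independent_set (replace_edges H p q ends G) A. z ^ card A)
    = (\<Sum>S\<in>Pow V. z ^ card S * (\<Prod>e\<in>E. gadget_gf (H e) p q z (fst (ends e) \<in> S) (snd (ends e) \<in> S)))"
proof -
  let ?D = "replace_edges H p q ends G"
  let ?cv = "copy_vertex ends p q"
  define W where "W e = pverts (H e) - {p, q}" for e
  define fl where "fl S e = flagged p (fst (ends e) \<in> S) q (snd (ends e) \<in> S)" for S e
  define F where "F S e = {B. B \<subseteq> W e \<and> no_arcs (parcs (H e)) (B \<union> fl S e)}" for S e
  define mk where "mk = (\<lambda>(S, f). Inl ` S \<union> (\<Union>e\<in>E. (\<lambda>w. Inr (e, w)) ` f e) :: ('a + 'a set \<times> 'b) set)"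
  define st :: "('a + 'a set \<times> 'b) set \<Rightarrow> 'a set \<times> ('a set \<Rightarrow> 'b set)"
    where "st A = ({v. Inl v \<in> A}, restrict (\<lambda>e. {w. Inr (e, w) \<in> A}) E)" for A
  have finW: "finite (W e)" if "e \<in> E" for e using assms(3)[OF that] by (simp add: W_def)
  have finF: "finite (F S e)" if "e \<in> E" for S e
    by (rule finite_subset[of _ "Pow (W e)"]) (use finW[OF that] in \<open>auto simp: F_def\<close>)
  have verts: "pverts ?D = Inl ` V \<union> (\<Union>e\<in>E. (\<lambda>w. Inr (e, w)) ` W e)" (is "?l = ?r")
  proof
    show "?l \<subseteq> ?r"
      using assms(4-6) by (auto simp: replace_edges_def copy_vertex_def W_def)
    show "?r \<subseteq> ?l"
    proof
      fix u assume "u \<in> ?r"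
      then consider v where "v \<in> V" "u = Inl v" | e w where "e \<in> E" "w \<in> W e" "u = Inr (e, w)" by auto
      then show "u \<in> ?l"
      proof cases
        case 1 then show ?thesis using assms(4) by (simp add: replace_edges_def)
      next
        case 2
        then have "u = ?cv e w" "w \<in> pverts (H e)" by (auto simp: copy_vertex_def W_def)
        then show ?thesis using 2(1) assms(5) by (auto simp: replace_edges_def)
      qed
    qed
  qed
  have arcs: "no_arcs (parcs ?D) A \<longleftrightarrow> (\<forall>e\<in>E. no_arcs (parcs (H e)) {w. ?cv e w \<in> A})" for A
    unfolding no_arcs_def replace_edges_def using assms(5) by fastforce
  have indep: "independent_set ?D A \<longleftrightarrow> A \<subseteq> pverts ?D \<and> no_arcs (parcs ?D) A" for A
    by (auto simp: independent_set_def no_arcs_def)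
  \<comment> \<open>The trace of the set on the copy belonging to \<open>e\<close> consists of its inner vertices and the endpoints in \<open>S\<close>.\<close>
  have pre: "{w. ?cv e w \<in> mk (S, f)} = f e \<union> fl S e"
    if "e \<in> E" "f e \<subseteq> W e" for e S f
  proof (rule set_eqI)
    fix w
    show "w \<in> {w. ?cv e w \<in> mk (S, f)} \<longleftrightarrow> w \<in> f e \<union> fl S e"
      using that assms(7) by (auto simp: mk_def copy_vertex_def fl_def flagged_def W_def)
  qed
  have "(\<Sum>A | independent_set ?D A. z ^ card A)
     = (\<Sum>(S, f)\<in>(SIGMA S:Pow V. PiE E (F S)). z ^ card S * (\<Prod>e\<in>E. z ^ card (f e)))"
  proof (rule sum.reindex_bij_witness[of _ mk st])
    fix A assume "A \<in> {A. independent_set ?D A}"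
    then have A: "A \<subseteq> pverts ?D" "no_arcs (parcs ?D) A" by (auto simp: indep)
    show mkst: "mk (st A) = A"
    proof (rule set_eqI)
      fix u
      have "e \<in> E" if "Inr (e, w) \<in> A" for e w using A(1) that unfolding verts by auto
      then show "u \<in> mk (st A) \<longleftrightarrow> u \<in> A" by (cases u) (auto simp: mk_def st_def)
    qed
    obtain S f where Sf: "st A = (S, f)" by (cases "st A")
    have f: "f e \<subseteq> W e" if "e \<in> E" for e
      using A(1) Sf that unfolding verts by (auto simp: st_def)
    have S: "S \<subseteq> V" using A(1) Sf unfolding verts by (auto simp: st_def)
    have "f \<in> PiE E (F S)"
    proof (rule PiE_I)
      fix e assume e: "e \<in> E"
      have "no_arcs (parcs (H e)) {w. ?cv e w \<in> A}" using A(2) e by (simp add: arcs)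
      then have "no_arcs (parcs (H e)) {w. ?cv e w \<in> mk (S, f)}" using mkst Sf by simp
      then show "f e \<in> F S e" using pre[where S = S, where f = f, OF e f[OF e]] f[OF e] by (simp add: F_def)
    next
      fix e assume "e \<notin> E" then show "f e = undefined" using Sf by (auto simp: st_def)
    qed
    then show "st A \<in> (SIGMA S:Pow V. PiE E (F S))" using S Sf by simp
    have "card (mk (S, f)) = card S + (\<Sum>e\<in>E. card (f e))"
    proof -
      have finf: "finite (f e)" if "e \<in> E" for e using f[OF that] finW[OF that] finite_subset by blast
      have "finite S" using S assms(1) finite_subset by blast
      have "card (\<Union>e\<in>E. (\<lambda>w. Inr (e, w)) ` f e :: ('a + 'a set \<times> 'b) set) = (\<Sum>e\<in>E. card ((\<lambda>w. Inr (e, w)) ` f e :: ('a + 'a set \<times> 'b) set))"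
        using assms(2) finf by (intro card_UN_disjoint) auto
      also have "\<dots> = (\<Sum>e\<in>E. card (f e))"
        by (intro sum.cong refl card_image) (auto simp: inj_on_def)
      finally have "card (\<Union>e\<in>E. (\<lambda>w. Inr (e, w)) ` f e :: ('a + 'a set \<times> 'b) set) = (\<Sum>e\<in>E. card (f e))" .
      moreover have "card (Inl ` S :: ('a + 'a set \<times> 'b) set) = card S" by (intro card_image) auto
      moreover have "card (Inl ` S \<union> (\<Union>e\<in>E. (\<lambda>w. Inr (e, w)) ` f e) :: ('a + 'a set \<times> 'b) set)
          = card (Inl ` S :: ('a + 'a set \<times> 'b) set) + card (\<Union>e\<in>E. (\<lambda>w. Inr (e, w)) ` f e :: ('a + 'a set \<times> 'b) set)"
        using \<open>finite S\<close> assms(2) finf by (intro card_Un_disjoint) auto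
      ultimately show ?thesis by (simp add: mk_def)
    qed
    then show "(case st A of (S, f) \<Rightarrow> z ^ card S * (\<Prod>e\<in>E. z ^ card (f e))) = z ^ card A"
      using mkst Sf by (simp add: power_add power_sum)
  next
    fix Sf assume "Sf \<in> (SIGMA S:Pow V. PiE E (F S))"
    then obtain S f where Sf: "Sf = (S, f)" "S \<subseteq> V" "f \<in> PiE E (F S)" by auto
    have f: "f e \<subseteq> W e" "no_arcs (parcs (H e)) (f e \<union> fl S e)" if "e \<in> E" for e
      using Sf(3) that by (auto simp: F_def PiE_iff)
    show "st (mk Sf) = Sf"
      using Sf(3) by (auto simp: Sf(1) st_def mk_def fun_eq_iff PiE_iff extensional_def)
    have "mk Sf \<subseteq> pverts ?D"
    proof
      fix u assume "u \<in> mk Sf"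
      then consider v where "v \<in> S" "u = Inl v" | e w where "e \<in> E" "w \<in> f e" "u = Inr (e, w)"
        by (auto simp: mk_def Sf(1))
      then show "u \<in> pverts ?D" unfolding verts by cases (use Sf(2) f(1) in blast)+
    qed
    moreover have "no_arcs (parcs ?D) (mk Sf)"
      unfolding arcs using pre f Sf(1) by simp
    ultimately show "mk Sf \<in> {A. independent_set ?D A}" by (simp add: indep)
  qed
  also have "\<dots> = (\<Sum>S\<in>Pow V. \<Sum>f\<in>PiE E (F S). z ^ card S * (\<Prod>e\<in>E. z ^ card (f e)))"
    using assms(1,2) finF by (subst sum.Sigma) (auto intro!: finite_PiE)
  also have "\<dots> = (\<Sum>S\<in>Pow V. z ^ card S * (\<Prod>e\<in>E. gadget_gf (H e) p q z (fst (ends e) \<in> S) (snd (ends e) \<in> S)))"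
  proof (rule sum.cong)
    fix S assume "S \<in> Pow V"
    have "(\<Prod>e\<in>E. \<Sum>B\<in>F S e. z ^ card B) = (\<Sum>f\<in>PiE E (F S). \<Prod>e\<in>E. z ^ card (f e))"
      using assms(2) finF by (intro prod_sum_PiE) auto
    then show "(\<Sum>f\<in>PiE E (F S). z ^ card S * (\<Prod>e\<in>E. z ^ card (f e)))
        = z ^ card S * (\<Prod>e\<in>E. gadget_gf (H e) p q z (fst (ends e) \<in> S) (snd (ends e) \<in> S))"
      by (simp add: gadget_gf_def F_def W_def fl_def sum_distrib_left)
  qed simp
  finally show ?thesis .
qed

text \<open>
  What remains of the four complete graphs in one half of the gadget when the neighbours of the
  center (if \<open>i\<close>) and of \<open>XVertex\<close> (if \<open>j\<close>) are removed.
\<close>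
definition free_cliques :: "nat \<Rightarrow> nat \<Rightarrow> nat \<Rightarrow> nat \<Rightarrow> F_choice \<Rightarrow> bool \<Rightarrow> bool \<Rightarrow> F_vertex set" where
  "free_cliques l m t s a i j =
     KM ` ({..<m} - (if i then c_KM a else {}) - (if j then {..<m} else {})) \<union>
     KL ` ({..<l} - (if i then c_KL a else {}) - (if j then x_KL a else {})) \<union>
     KMS ` ({..<m - s} - (if i then {..<m - s} else {})) \<union>
     KLT ` ({..<l - t} - (if i then c_KLT a else {}))"

lemma F_arcs [simp]:
  "(KM i, KM j) \<in> parcs (F_graph l m t s a) \<longleftrightarrow> i < m \<and> j < m \<and> i \<noteq> j"
  "(KL i, KL j) \<in> parcs (F_graph l m t s a) \<longleftrightarrow> i < l \<and> j < l \<and> i \<noteq> j"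
  "(KMS i, KMS j) \<in> parcs (F_graph l m t s a) \<longleftrightarrow> i < m - s \<and> j < m - s \<and> i \<noteq> j"
  "(KLT i, KLT j) \<in> parcs (F_graph l m t s a) \<longleftrightarrow> i < l - t \<and> j < l - t \<and> i \<noteq> j"
  "(KM i, KL j) \<notin> parcs (F_graph l m t s a)" "(KL i, KM j) \<notin> parcs (F_graph l m t s a)"
  "(KM i, KMS j) \<notin> parcs (F_graph l m t s a)" "(KMS i, KM j) \<notin> parcs (F_graph l m t s a)"
  "(KM i, KLT j) \<notin> parcs (F_graph l m t s a)" "(KLT i, KM j) \<notin> parcs (F_graph l m t s a)"
  "(KL i, KMS j) \<notin> parcs (F_graph l m t s a)" "(KMS i, KL j) \<notin> parcs (F_graph l m t s a)"
  "(KL i, KLT j) \<notin> parcs (F_graph l m t s a)" "(KLT i, KL j) \<notin> parcs (F_graph l m t s a)"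
  "(KMS i, KLT j) \<notin> parcs (F_graph l m t s a)" "(KLT i, KMS j) \<notin> parcs (F_graph l m t s a)"
  "(Center, Center) \<notin> parcs (F_graph l m t s a)" "(XVertex, XVertex) \<notin> parcs (F_graph l m t s a)"
  "(Center, XVertex) \<in> parcs (F_graph l m t s a)" "(XVertex, Center) \<in> parcs (F_graph l m t s a)"
  "(Center, KM j) \<in> parcs (F_graph l m t s a) \<longleftrightarrow> j \<in> c_KM a"
  "(KM j, Center) \<in> parcs (F_graph l m t s a) \<longleftrightarrow> j \<in> c_KM a"
  "(Center, KL j) \<in> parcs (F_graph l m t s a) \<longleftrightarrow> j \<in> c_KL a"
  "(KL j, Center) \<in> parcs (F_graph l m t s a) \<longleftrightarrow> j \<in> c_KL a"
  "(Center, KMS j) \<in> parcs (F_graph l m t s a) \<longleftrightarrow> j < m - s"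
  "(KMS j, Center) \<in> parcs (F_graph l m t s a) \<longleftrightarrow> j < m - s"
  "(Center, KLT j) \<in> parcs (F_graph l m t s a) \<longleftrightarrow> j \<in> c_KLT a"
  "(KLT j, Center) \<in> parcs (F_graph l m t s a) \<longleftrightarrow> j \<in> c_KLT a"
  "(XVertex, KM j) \<in> parcs (F_graph l m t s a) \<longleftrightarrow> j < m"
  "(KM j, XVertex) \<in> parcs (F_graph l m t s a) \<longleftrightarrow> j < m"
  "(XVertex, KL j) \<in> parcs (F_graph l m t s a) \<longleftrightarrow> j \<in> x_KL a"
  "(KL j, XVertex) \<in> parcs (F_graph l m t s a) \<longleftrightarrow> j \<in> x_KL a"
  "(XVertex, KMS j) \<notin> parcs (F_graph l m t s a)" "(KMS j, XVertex) \<notin> parcs (F_graph l m t s a)"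
  "(XVertex, KLT j) \<notin> parcs (F_graph l m t s a)" "(KLT j, XVertex) \<notin> parcs (F_graph l m t s a)"
  by (auto simp: F_graph_def complete_arcs_def join_arcs_def)

lemma G4_arcs [simp]:
  "(Inl u, Inl v) \<in> parcs (G4_graph l m t s a b) \<longleftrightarrow> (u, v) \<in> parcs (F_graph l m t s a)"
  "(Inr u, Inr v) \<in> parcs (G4_graph l m t s a b) \<longleftrightarrow> (u, v) \<in> parcs (F_graph l m t s b)"
  "(Inl u, Inr v) \<in> parcs (G4_graph l m t s a b) \<longleftrightarrow> u = XVertex \<and> v = XVertex"
  "(Inr u, Inl v) \<in> parcs (G4_graph l m t s a b) \<longleftrightarrow> u = XVertex \<and> v = XVertex"
  by (auto simp: G4_graph_def join_arcs_def)

lemma F_verts: "pverts (F_graph l m t s a) = insert Center (insert XVertex (free_cliques l m t s a False False))"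
  by (auto simp: F_graph_def free_cliques_def)

lemma G4_verts: "pverts (G4_graph l m t s a b) = Inl ` pverts (F_graph l m t s a) \<union> Inr ` pverts (F_graph l m t s b)"
  by (simp add: G4_graph_def Plus_def)

lemma finite_free_cliques [simp]: "finite (free_cliques l m t s a i j)"
  by (simp add: free_cliques_def)

lemma finite_G4: "finite (pverts (G4_graph l m t s a b))"
  by (simp add: G4_verts F_verts)

definition common_factor :: "nat \<Rightarrow> nat \<Rightarrow> nat \<Rightarrow> nat \<Rightarrow> 'r::comm_ring_1 \<Rightarrow> 'r" where
  "common_factor l m t s z =
     (1 + of_nat m * z) * (1 + of_nat (m - s) * z) * (1 + of_nat (l - t) * z)"

definition half_gf :: "nat \<Rightarrow> nat \<Rightarrow> nat \<Rightarrow> nat \<Rightarrow> 'r::comm_ring_1 \<Rightarrow> bool \<Rightarrow> bool \<Rightarrow> 'r" where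
  "half_gf l m t s z i j =
     (if i \<or> j then common_factor l m t s z else common_factor l m t s z * (1 + of_nat l * z))"

lemma indep_gf_four_cliques:
  fixes f :: "F_vertex \<Rightarrow> 'b"
  assumes "inj f" "finite A1" "finite A2" "finite A3" "finite A4" "finite Y"
    and "\<And>u v. (f u, f v) \<in> R \<longleftrightarrow> (u, v) \<in> parcs (F_graph l m t s a)"
    and "A1 \<subseteq> {..<m}" "A2 \<subseteq> {..<l}" "A3 \<subseteq> {..<m - s}" "A4 \<subseteq> {..<l - t}"
    and "\<And>u v. u \<noteq> XVertex \<Longrightarrow> v \<in> Y \<Longrightarrow> v \<notin> range f \<and> (f u, v) \<notin> R \<and> (v, f u) \<notin> R"
  shows "indep_gf R (f ` (KM ` A1 \<union> KL ` A2 \<union> KMS ` A3 \<union> KLT ` A4) \<union> Y) z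
    = (1 + of_nat (card A1) * z) * (1 + of_nat (card A2) * z) * (1 + of_nat (card A3) * z)
      * (1 + of_nat (card A4) * z) * indep_gf R Y z"
proof -
  have inj: "f u = f v \<longleftrightarrow> u = v" for u v using assms(1) by (auto simp: inj_def)
  have card: "card ((\<lambda>i. f (k i)) ` A) = card A" if "inj k" for k :: "nat \<Rightarrow> F_vertex" and A
    using that by (intro card_image) (auto simp: inj_on_def inj)
  have notin: "f u \<notin> Y" if "u \<noteq> XVertex" for u using assms(12)[of u "f u"] that by auto
  let ?W4 = "Y" and ?k1 = "(\<lambda>i. f (KM i)) ` A1" and ?k2 = "(\<lambda>i. f (KL i)) ` A2"
    and ?k3 = "(\<lambda>i. f (KMS i)) ` A3" and ?k4 = "(\<lambda>i. f (KLT i)) ` A4"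
  have "f ` (KM ` A1 \<union> KL ` A2 \<union> KMS ` A3 \<union> KLT ` A4) \<union> Y = ?k1 \<union> (?k2 \<union> (?k3 \<union> (?k4 \<union> Y)))"
    by auto
  moreover have "indep_gf R (?k4 \<union> Y) z = (1 + of_nat (card ?k4) * z) * indep_gf R Y z"
    by (rule indep_gf_clique) (use assms in \<open>auto simp: inj notin\<close>)
  moreover have "indep_gf R (?k3 \<union> (?k4 \<union> Y)) z = (1 + of_nat (card ?k3) * z) * indep_gf R (?k4 \<union> Y) z"
    by (rule indep_gf_clique) (use assms in \<open>auto simp: inj notin\<close>)
  moreover have "indep_gf R (?k2 \<union> (?k3 \<union> (?k4 \<union> Y))) z = (1 + of_nat (card ?k2) * z) * indep_gf R (?k3 \<union> (?k4 \<union> Y)) z"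
    by (rule indep_gf_clique) (use assms in \<open>auto simp: inj notin\<close>)
  moreover have "indep_gf R (?k1 \<union> (?k2 \<union> (?k3 \<union> (?k4 \<union> Y)))) z = (1 + of_nat (card ?k1) * z) * indep_gf R (?k2 \<union> (?k3 \<union> (?k4 \<union> Y))) z"
    by (rule indep_gf_clique) (use assms in \<open>auto simp: inj notin\<close>)
  ultimately show ?thesis
    using card[of KM A1] card[of KL A2] card[of KMS A3] card[of KLT A4] by (simp add: inj_def mult_ac)
qed

text \<open>
  The reason for the shape of the gadget: removing the neighbours of the center turns sizes
  \<open>m, l, m - s, l - t\<close> into \<open>m - s, l - t, 0, m\<close>, and removing those of \<open>XVertex\<close> turns them into
  \<open>0, m, m - s, l - t\<close>. Both leave the same polynomial, whatever neighbours were chosen.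
\<close>
lemma indep_gf_free_cliques:
  fixes f :: "F_vertex \<Rightarrow> 'b"
  assumes "inj f" "valid_F_choice l m t s a" "l \<ge> m" "m \<ge> s" "l \<ge> t + m" "\<not> (i \<and> j)" "finite Y"
    and "\<And>u v. (f u, f v) \<in> R \<longleftrightarrow> (u, v) \<in> parcs (F_graph l m t s a)"
    and "\<And>u v. u \<noteq> XVertex \<Longrightarrow> v \<in> Y \<Longrightarrow> v \<notin> range f \<and> (f u, v) \<notin> R \<and> (v, f u) \<notin> R"
  shows "indep_gf R (f ` free_cliques l m t s a i j \<union> Y) z = half_gf l m t s z i j * indep_gf R Y z"
proof -
  have v: "c_KM a \<subseteq> {..<m}" "card (c_KM a) = s" "c_KL a \<subseteq> {..<l}" "card (c_KL a) = t"
    "c_KLT a \<subseteq> {..<l - t}" "card (c_KLT a) = l - t - m" "x_KL a \<subseteq> {..<l}" "card (x_KL a) = l - m"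
    using assms(2) by (auto simp: valid_F_choice_def)
  have card: "card ({..<n} - X) = n - card X" if "X \<subseteq> {..<n}" for n :: nat and X
    using that by (simp add: card_Diff_subset finite_subset)
  have c: "card ({..<m} - c_KM a) = m - s" "card ({..<l} - c_KL a) = l - t"
    "card ({..<l - t} - c_KLT a) = m" "card ({..<l} - x_KL a) = m"
    using assms(3-5) by (simp_all add: card v)
  show ?thesis
    unfolding free_cliques_def
    by (subst indep_gf_four_cliques[where l = l and m = m and t = t and s = s and a = a])
      (use assms in \<open>auto simp: c half_gf_def common_factor_def mult_ac split: if_splits\<close>)
qed

lemma gadget_gf_eq:
  fixes z :: "'r::comm_ring_1"
  assumes "valid_F_choice l m t s a" "valid_F_choice l m t s b" "l \<ge> m" "m \<ge> s" "l \<ge> t + m"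
  shows "gadget_gf (G4_graph l m t s a b) (Inl Center) (Inr Center) z i j
    = common_factor l m t s z ^ 2 * edge_factor l z i j"
proof -
  let ?R = "parcs (G4_graph l m t s a b)"
  let ?fa = "free_cliques l m t s a" and ?fb = "free_cliques l m t s b" and ?h = "half_gf l m t s z"
  let ?x = "Inl XVertex :: F_vertex + F_vertex" and ?y = "Inr XVertex :: F_vertex + F_vertex"
  have va: "c_KM a \<subseteq> {..<m}" "c_KL a \<subseteq> {..<l}" "c_KLT a \<subseteq> {..<l - t}" "x_KL a \<subseteq> {..<l}"
    and vb: "c_KM b \<subseteq> {..<m}" "c_KL b \<subseteq> {..<l}" "c_KLT b \<subseteq> {..<l - t}" "x_KL b \<subseteq> {..<l}"
    using assms by (auto simp: valid_F_choice_def)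
  define X where "X = (if i then {} else {?x}) \<union> (if j then {} else {?y}) \<union> (Inl ` ?fa i False \<union> Inr ` ?fb j False)"
  have "gadget_gf (G4_graph l m t s a b) (Inl Center) (Inr Center) z i j = indep_gf ?R X z"
    unfolding gadget_gf_def indep_gf_def
  proof (rule sum.cong[OF Collect_cong refl])
    fix B
    have "u \<in> X \<longleftrightarrow> u \<in> pverts (G4_graph l m t s a b) - {Inl Center, Inr Center}
        \<and> (\<forall>p\<in>flagged (Inl Center) i (Inr Center) j. (u, p) \<notin> ?R \<and> (p, u) \<notin> ?R)" for u
      by (cases u; rename_tac w; case_tac w)
        (auto simp: X_def G4_verts F_verts flagged_def free_cliques_def)
    moreover have "no_arcs ?R (flagged (Inl Center) i (Inr Center) j)"
      by (auto simp: no_arcs_def flagged_def)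
    ultimately show "B \<subseteq> pverts (G4_graph l m t s a b) - {Inl Center, Inr Center}
         \<and> no_arcs ?R (B \<union> flagged (Inl Center) i (Inr Center) j) \<longleftrightarrow> B \<subseteq> X \<and> no_arcs ?R B"
      unfolding no_arcs_def subset_iff by (simp add: ball_Un) blast
  qed
  also have "indep_gf ?R X z = common_factor l m t s z ^ 2 * edge_factor l z i j"
  proof -
    have two: "indep_gf ?R (Inl ` ?fa i' ia \<union> Inr ` ?fb j' ja) z = ?h i' ia * ?h j' ja"
      if "\<not> (i' \<and> ia)" "\<not> (j' \<and> ja)" for i' ia j' ja
    proof -
      have "indep_gf ?R (Inl ` ?fa i' ia \<union> Inr ` ?fb j' ja) z = ?h i' ia * indep_gf ?R (Inr ` ?fb j' ja) z"
        using assms that by (intro indep_gf_free_cliques[where a = a]) auto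
      also have "indep_gf ?R (Inr ` ?fb j' ja) z = ?h j' ja"
        using indep_gf_free_cliques[of Inr l m t s b j' ja "{}" ?R z] assms that by simp
      finally show ?thesis .
    qed
    have dely: "indep_gf ?R (insert ?y (Inl ` ?fa i' ia \<union> Inr ` ?fb False False)) z
        = ?h i' ia * (?h False False + z * ?h False True)" if "\<not> (i' \<and> ia)" for i' ia
    proof -
      let ?W = "insert ?y (Inl ` ?fa i' ia \<union> Inr ` ?fb False False)"
      have 1: "?W - {?y} = Inl ` ?fa i' ia \<union> Inr ` ?fb False False" by (auto simp: free_cliques_def)
      have 2: "{u \<in> Inl ` ?fa i' ia \<union> Inr ` ?fb False False. (u, ?y) \<notin> ?R \<and> (?y, u) \<notin> ?R}
          = Inl ` ?fa i' ia \<union> Inr ` ?fb False True" by (auto simp: free_cliques_def)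
      have "indep_gf ?R ?W z = indep_gf ?R (?W - {?y}) z + z * indep_gf ?R {u \<in> ?W - {?y}. (u, ?y) \<notin> ?R \<and> (?y, u) \<notin> ?R} z"
        by (rule indep_gf_delete) auto
      then show ?thesis unfolding 1 2 using that by (simp add: two algebra_simps)
    qed
    have delx: "indep_gf ?R (insert ?x (Inl ` ?fa False False \<union> Inr ` ?fb j' ja)) z
        = ?h j' ja * (?h False False + z * ?h False True)" if "\<not> (j' \<and> ja)" for j' ja
    proof -
      let ?W = "insert ?x (Inl ` ?fa False False \<union> Inr ` ?fb j' ja)"
      have 1: "?W - {?x} = Inl ` ?fa False False \<union> Inr ` ?fb j' ja" by (auto simp: free_cliques_def)
      have 2: "{u \<in> Inl ` ?fa False False \<union> Inr ` ?fb j' ja. (u, ?x) \<notin> ?R \<and> (?x, u) \<notin> ?R}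
          = Inl ` ?fa False True \<union> Inr ` ?fb j' ja" by (auto simp: free_cliques_def)
      have "indep_gf ?R ?W z = indep_gf ?R (?W - {?x}) z + z * indep_gf ?R {u \<in> ?W - {?x}. (u, ?x) \<notin> ?R \<and> (?x, u) \<notin> ?R} z"
        by (rule indep_gf_delete) auto
      then show ?thesis unfolding 1 2 using that by (simp add: two algebra_simps)
    qed
    have delxy: "indep_gf ?R (insert ?x (insert ?y (Inl ` ?fa False False \<union> Inr ` ?fb False False))) z
        = ?h False False * (?h False False + z * ?h False True) + z * (?h False True * ?h False False)"
    proof -
      let ?W = "insert ?x (insert ?y (Inl ` ?fa False False \<union> Inr ` ?fb False False))"
      have 1: "?W - {?x} = insert ?y (Inl ` ?fa False False \<union> Inr ` ?fb False False)" by (auto simp: free_cliques_def)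
      have 2: "{u \<in> insert ?y (Inl ` ?fa False False \<union> Inr ` ?fb False False). (u, ?x) \<notin> ?R \<and> (?x, u) \<notin> ?R}
          = Inl ` ?fa False True \<union> Inr ` ?fb False False" by (auto simp: free_cliques_def)
      have "indep_gf ?R ?W z = indep_gf ?R (?W - {?x}) z + z * indep_gf ?R {u \<in> ?W - {?x}. (u, ?x) \<notin> ?R \<and> (?x, u) \<notin> ?R} z"
        by (rule indep_gf_delete) auto
      then show ?thesis unfolding 1 2 by (simp add: two dely)
    qed
    show ?thesis
      unfolding X_def using two[of True False True False] dely[of True False] delx[of True False] delxy
      by (cases i; cases j)
        (simp_all add: insert_commute[of ?y ?x] half_gf_def edge_factor_def power2_eq_square algebra_simps)
  qed
  finally show ?thesis .
qed

lemma finite_edge_sets: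
  assumes "pair_graph G"
  shows "finite (edge_sets G)"
proof -
  interpret pair_graph G by fact
  have "edge_sets G = (\<lambda>(u, v). {u, v}) ` parcs G" by (auto simp: edge_sets_def)
  then show ?thesis using pair_finite_arcs by simp
qed

lemma valid_ends_edge:
  assumes "pair_graph G" "valid_ends G ends" "e \<in> edge_sets G"
  shows "fst (ends e) \<noteq> snd (ends e)" "fst (ends e) \<in> pverts G" "snd (ends e) \<in> pverts G"
proof -
  interpret pair_graph G by fact
  obtain u v where uv: "e = {u, v}" "(u, v) \<in> parcs G" using assms(3) by (auto simp: edge_sets_def)
  have "u \<noteq> v" "u \<in> pverts G" "v \<in> pverts G"
    using uv(2) pair_no_loops[of "(u, v)"] arc_fst_in_verts[of "(u, v)"] arc_snd_in_verts[of "(u, v)"] by auto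
  moreover have "{u, v} = {fst (ends e), snd (ends e)}"
    using assms(2,3) uv(1) by (simp add: valid_ends_def)
  ultimately show "fst (ends e) \<noteq> snd (ends e)" "fst (ends e) \<in> pverts G" "snd (ends e) \<in> pverts G"
    by (auto simp: doubleton_eq_iff)
qed

lemma E_G4_gf:
  fixes z :: "'r::comm_ring_1"
  assumes "l \<ge> m" "m \<ge> s" "l \<ge> t + m" "pair_graph G" "valid_ends G ends"
    and "\<And>e. e \<in> edge_sets G \<Longrightarrow> valid_F_choice l m t s (a e)"
    and "\<And>e. e \<in> edge_sets G \<Longrightarrow> valid_F_choice l m t s (b e)"
  shows "(\<Sum>A | independent_set (E_G4 l m t s a b ends G) A. z ^ card A)
    = (common_factor l m t s z ^ 2) ^ card (edge_sets G)
      * hard_core l (\<lambda>e. fst (ends e)) (\<lambda>e. snd (ends e)) (pverts G) (edge_sets G) z"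
proof -
  interpret pair_graph G by fact
  have "(\<Sum>A | independent_set (E_G4 l m t s a b ends G) A. z ^ card A)
    = (\<Sum>S\<in>Pow (pverts G). z ^ card S * (\<Prod>e\<in>edge_sets G.
        gadget_gf (G4_graph l m t s (a e) (b e)) (Inl Center) (Inr Center) z (fst (ends e) \<in> S) (snd (ends e) \<in> S)))"
    unfolding E_G4_def
    using pair_finite_verts finite_edge_sets[OF assms(4)] finite_G4 valid_ends_edge[OF assms(4,5)]
    by (intro replace_edges_gf) auto
  also have "\<dots> = (\<Sum>S\<in>Pow (pverts G). z ^ card S * (\<Prod>e\<in>edge_sets G.
        common_factor l m t s z ^ 2 * edge_factor l z (fst (ends e) \<in> S) (snd (ends e) \<in> S)))"
    using assms by (intro sum.cong prod.cong arg_cong2[where f = "(*)"] refl gadget_gf_eq) auto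
  also have "\<dots> = (common_factor l m t s z ^ 2) ^ card (edge_sets G)
      * hard_core l (\<lambda>e. fst (ends e)) (\<lambda>e. snd (ends e)) (pverts G) (edge_sets G) z"
    unfolding hard_core_def sum_distrib_left by (intro sum.cong refl) (simp add: prod.distrib mult_ac)
  finally show ?thesis .
qed

section \<open>Log-concavity\<close>
lemma linear_pair_cone: "(1 + of_nat n * pv) * (1 + of_nat n * qv) \<in> schur_cone"
proof -
  have "(1 + of_nat n * pv) * (1 + of_nat n * qv) = 1 + of_nat n * (e1 + of_nat n * e2)"
    by (simp add: e1_def e2_def algebra_simps)
  then show ?thesis by (simp add: schur_cone_add schur_cone_mult)
qed

lemma common_factor_cone: "common_factor l m t s pv * common_factor l m t s qv \<in> schur_cone"
proof -
  have "common_factor l m t s pv * common_factor l m t s qv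
    = ((1 + of_nat m * pv) * (1 + of_nat m * qv)) * ((1 + of_nat (m - s) * pv) * (1 + of_nat (m - s) * qv))
      * ((1 + of_nat (l - t) * pv) * (1 + of_nat (l - t) * qv))"
    by (simp only: common_factor_def mult_ac)
  then show ?thesis by (simp only:) (intro schur_cone_mult linear_pair_cone)
qed

lemma coeff_size_gf_product:
  assumes "finite \<A>"
  shows "coeff (coeff ((\<Sum>A\<in>\<A>. pv ^ card A) * (\<Sum>B\<in>\<A>. qv ^ card B)) i) j
    = real (card {A \<in> \<A>. card A = i}) * real (card {A \<in> \<A>. card A = j})"
proof -
  have "(\<Sum>A\<in>\<A>. pv ^ card A) * (\<Sum>B\<in>\<A>. qv ^ card B)
      = (\<Sum>A\<in>\<A>. \<Sum>B\<in>\<A>. monom (monom 1 (card B)) (card A))"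
    by (simp add: sum_product pv_qv_power)
  then have "coeff (coeff ((\<Sum>A\<in>\<A>. pv ^ card A) * (\<Sum>B\<in>\<A>. qv ^ card B)) i) j
      = (\<Sum>A\<in>\<A>. \<Sum>B\<in>\<A>. (if card A = i then 1 else 0) * (if card B = j then 1 else 0))"
    by (simp add: coeff_sum) (intro sum.cong refl, simp)
  also have "\<dots> = (\<Sum>A\<in>\<A>. if card A = i then 1 else 0) * (\<Sum>B\<in>\<A>. if card B = j then 1 else 0)"
    by (simp add: sum_product)
  also have "\<dots> = real (card {A \<in> \<A>. card A = i}) * real (card {A \<in> \<A>. card A = j})"
    using assms by (simp add: sum.If_cases Int_def conj_commute)
  finally show ?thesis .
qed

text \<open>The Schur criterion, applied to the coefficients of \<open>p\<^sup>k q\<^sup>k\<close> and \<open>p\<^bsup>k-1\<^esup> q\<^bsup>k+1\<^esup>\<close>.\<close>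
lemma log_concave_of_cone:
  assumes "finite {A. independent_set D A}"
    and "(\<Sum>A | independent_set D A. pv ^ card A) * (\<Sum>A | independent_set D A. qv ^ card A) \<in> schur_cone"
  shows "independence_poly_log_concave D"
  unfolding independence_poly_log_concave_def
proof (intro allI impI)
  fix k assume k: "1 \<le> k \<and> k \<le> independence_number D - 1"
  have num: "card {A \<in> {A. independent_set D A}. card A = n} = num_independent_sets D n" for n
    by (simp add: num_independent_sets_def)
  have co: "coeff (independence_poly D) n = int (num_independent_sets D n)"
    if "n \<le> independence_number D" for n
    using that by (simp add: independence_poly_def coeff_sum)
  have "real (num_independent_sets D (k - 1)) * real (num_independent_sets D (k + 1))
      \<le> real (num_independent_sets D k) * real (num_independent_sets D k)"
    using schur_cone_coeff_unimodal[OF assms(2), of k] k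
    unfolding coeff_size_gf_product[OF assms(1)] num by simp
  then have "num_independent_sets D (k - 1) * num_independent_sets D (k + 1)
      \<le> num_independent_sets D k * num_independent_sets D k"
    by (simp flip: of_nat_mult)
  moreover have "k - 1 \<le> independence_number D" "k \<le> independence_number D" "k + 1 \<le> independence_number D"
    using k by auto
  ultimately show "coeff (independence_poly D) (k - 1) * coeff (independence_poly D) (k + 1)
      \<le> (coeff (independence_poly D) k)\<^sup>2"
    by (simp add: co power2_eq_square flip: of_nat_mult)
qed

theorem theorem3p2:
  fixes l m s t :: nat
    and G :: "'a pair_pre_digraph"
    and a b :: "'a set \<Rightarrow> F_choice"
    and ends :: "'a set \<Rightarrow> 'a \<times> 'a"
  assumes "l \<ge> 1" and "l \<ge> m" and "m \<ge> s" and "l \<ge> t + m"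
    and "pair_graph G"
    and "\<And>v. v \<in> pverts G \<Longrightarrow> out_degree (with_proj G) v \<noteq> 2"
    and "valid_ends G ends"
    and "\<And>e. e \<in> edge_sets G \<Longrightarrow> valid_F_choice l m t s (a e)"
    and "\<And>e. e \<in> edge_sets G \<Longrightarrow> valid_F_choice l m t s (b e)"
  shows "independence_poly_log_concave (E_G4 l m t s a b ends G)"
proof (rule log_concave_of_cone)
  interpret pair_graph G by fact
  let ?D = "E_G4 l m t s a b ends G" and ?E = "edge_sets G"
  have finE: "finite ?E" by (rule finite_edge_sets) fact
  have finD: "finite (pverts ?D)"
    using finE pair_finite_verts finite_G4 by (simp add: E_G4_def replace_edges_def)
  show "finite {A. independent_set ?D A}"
    by (rule finite_subset[of _ "Pow (pverts ?D)"]) (use finD in \<open>auto simp: independent_set_def\<close>)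
  let ?C = "common_factor l m t s :: bipoly \<Rightarrow> bipoly"
  let ?Q = "hard_core l (\<lambda>e. fst (ends e)) (\<lambda>e. snd (ends e)) (pverts G) ?E :: bipoly \<Rightarrow> bipoly"
  have gf: "(\<Sum>A | independent_set ?D A. z ^ card A) = (?C z ^ 2) ^ card ?E * ?Q z" for z
    using assms by (intro E_G4_gf) auto
  have "((?C pv * ?C qv) ^ 2) ^ card ?E * (?Q pv * ?Q qv) \<in> schur_cone"
    using assms(1) valid_ends_edge[OF assms(5,7)] finE pair_finite_verts
    by (intro schur_cone_mult[OF _ hard_core_positive] schur_cone_power common_factor_cone) auto
  then show "(\<Sum>A | independent_set ?D A. pv ^ card A) * (\<Sum>A | independent_set ?D A. qv ^ card A) \<in> schur_cone"
    unfolding gf by (simp only: power_mult_distrib mult_ac)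
qed

end
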